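(* Let $0<\alpha_1<\alpha_2\le1$, $\alpha=(\alpha_1,\alpha_2)$, let $A=(a_{ij})\in\mathbb R^{2\times2}$, and set $$q_1=\frac{\sin\frac{\alpha_1\pi}{2}}{\sin\frac{(\alpha_1+\alpha_2)\pi}{2}},\qquad q_2=\frac{\sin\frac{\alpha_2\pi}{2}}{\sin\frac{(\alpha_1+\alpha_2)\pi}{2}}.$$ Let $\Omega\subset\mathbb R^2$ be open with $0\in\Omega$, and let $f:\Omega\to\mathbb R^2$ be locally Lipschitz continuous at the origin with $f(0)=0$ and $\lim_{r\to0}l_f(r)=0$, where $l_f(r):=\sup_{x,y\in B(0,r),\,x\ne y}\frac{\|f(x)-f(y)\|}{\|x-y\|}$. Consider $${}^CD^{\alpha}_{0^+}x(t)=Ax(t)+f(x(t))\quad(t>0),\qquad x(0)=x^0\in\Omega. \qquad(\ast)$$ Assume that one of the following conditions is satisfied: (i) $a_{11},a_{22}\le0$ and $\det A>0$; (ii) $a_{11}=0$, $a_{22}>0$, $\det A>0$ and $(a_{22}q_1)^{\alpha_1/\alpha_2}a_{22}q_2<\det A$; (iii) $a_{22}=0$, $a_{11}>0$, $\det A>0$ and $(a_{11}q_2)^{\alpha_2/\alpha_1}a_{11}q_1<\det A$; (iv) $a_{11},a_{22},\det A>0$ and one of the following holds: (iv)$_1$ $a_{11}q_2+a_{22}q_1>1$ and $a_{11}q_2\left((a_{11}+a_{22})q_2\right)^{\alpha_2/\alpha_1}+a_{22}(a_{11}+a_{22})q_2^2\le\det A$; (iv)$_2$ $a_{11}q_2+a_{22}q_1\le1$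 and $a_{11}q_1+a_{22}q_2<\det A$; (v) $a_{11}<0$, $a_{22},\det A>0$ and one of the following holds: (v)$_1$ $a_{11}q_2+a_{22}q_1>1$ and $(a_{22}q_1)^{\alpha_1/\alpha_2}a_{22}q_2\le\det A$; (v)$_2$ $a_{11}q_2+a_{22}q_1\le1$ and $a_{22}q_2\le\det A$. Then the trivial solution of the differential equation in $(\ast)$ is Mittag-Leffler stable. More precisely, there exist constants $\delta,\varepsilon>0$ such that for any $x^0$ with $\|x^0\|<\delta$ the unique solution $\varphi(\cdot,x^0)$ of $(\ast)$ exists globally on $[0,\infty)$ and $\sup_{t\ge1}t^{\nu}\|\varphi(t,x^0)\|\le\varepsilon$, where $\nu=\min\{\alpha_1,\alpha_2\}$.
   Context: On $\mathbb R^2$ use $\|x\|=\max\{|x_1|,|x_2|\}$, and $B(0,r)=\{x\in\mathbb R^2:\|x\|\le r\}$. "Locally Lipschitz continuous at the origin" means that $f$ is Lipschitz continuous on some ball $B(0,\varepsilon_0)\subset\Omega$, $\varepsilon_0>0$. For $0<\kappa<1$ the Riemann–Liouville integral is $I^{\kappa}_{0^+}g(t)=\frac{1}{\Gamma(\kappa)}\int_0^t(t-s)^{\kappa-1}g(s)\,ds$, and the Caputo derivative of order $\kappa\in(0,1)$ is ${}^CD^{\kappa}_{0^+}g(t)=\frac{d}{dt}I^{1-\kappa}_{0^+}(g(t)-g(0))$, $t>0$; for $\kappa=1$ it is the usual derivative. For $x=(x_1,x_2)$, ${}^CD^{\alpha}_{0^+}x=({}^CD^{\alpha_1}_{0^+}x_1,{}^CD^{\alpha_2}_{0^+}x_2)$.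 A solution is a continuous function $x$ with values in $\Omega$, $x(0)=x^0$, satisfying the differential equations for $t>0$. Definition (Mittag-Leffler stability): the trivial solution is Mittag-Leffler stable if there exist positive constants $\gamma,m,\delta$ such that for any initial condition $x^0\in B(0,\delta)$ the solution $\varphi(\cdot,x^0)$ of the initial value problem exists globally on $[0,\infty)$ and $\max\{\sup_{t\in[0,1]}\|\varphi(t,x^0)\|,\ \sup_{t\ge1}t^{\gamma}\|\varphi(t,x^0)\|\}\le m$. *)

theory Defs
  imports "HOL-Analysis.Analysis"
begin

text \<open>
  The norm on the plane is the maximum norm, i.e. the library's \<^const>\<open>infnorm\<close>
  (and not the Euclidean \<^const>\<open>norm\<close>).
\<close>

definition max_ball :: "real \<Rightarrow> (real ^ 2) set" where
  "max_ball r = {x. infnorm x \<le> r}"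

text \<open>
  Below, this integral is only used at functions continuous on \<open>{0..t}\<close>, for which the integrand
  is absolutely integrable. The convention \<open>0 powr a = 0\<close> affects only the endpoint \<open>s = t\<close>.
\<close>

definition RL_integral :: "real \<Rightarrow> (real \<Rightarrow> real) \<Rightarrow> real \<Rightarrow> real" where
  "RL_integral \<kappa> g t = 1 / Gamma \<kappa> * integral {0..t} (\<lambda>s. (t - s) powr (\<kappa> - 1) * g s)"

text \<open>
  As a relation: the Caputo derivative of order \<open>\<kappa> \<in> {0<..1}\<close> of \<open>g\<close> at \<open>t > 0\<close> exists and
  equals \<open>D\<close>.
\<close>

definition has_caputo_derivative :: "real \<Rightarrow> (real \<Rightarrow> real) \<Rightarrow> real \<Rightarrow> real \<Rightarrow> bool" where
  "has_caputo_derivative \<kappa> g D t \<longleftrightarrow>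
     (if \<kappa> = 1 then (g has_real_derivative D) (at t)
      else (RL_integral (1 - \<kappa>) (\<lambda>s. g s - g 0) has_real_derivative D) (at t))"

definition has_caputo_derivative2 ::
    "real ^ 2 \<Rightarrow> (real \<Rightarrow> real ^ 2) \<Rightarrow> real ^ 2 \<Rightarrow> real \<Rightarrow> bool" where
  "has_caputo_derivative2 \<alpha> x D t \<longleftrightarrow>
     (\<forall>i. has_caputo_derivative (\<alpha> $ i) (\<lambda>s. x s $ i) (D $ i) t)"

definition locally_lipschitz_at_origin ::
    "(real ^ 2) set \<Rightarrow> (real ^ 2 \<Rightarrow> real ^ 2) \<Rightarrow> bool" where
  "locally_lipschitz_at_origin \<Omega> f \<longleftrightarrow>
     (\<exists>\<epsilon>\<^sub>0>0. max_ball \<epsilon>\<^sub>0 \<subseteq> \<Omega> \<and> (\<exists>L. L-lipschitz_on (max_ball \<epsilon>\<^sub>0) f))"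

text \<open>
  The supremum is taken in \<^typ>\<open>ereal\<close>, so that it is meaningful also when the quotients are
  unbounded. It is relevant only for small \<open>r\<close>, where \<open>max_ball r\<close> lies in the domain of \<open>f\<close>.
\<close>

definition lip_modulus :: "(real ^ 2 \<Rightarrow> real ^ 2) \<Rightarrow> real \<Rightarrow> ereal" where
  "lip_modulus f r =
     (SUP (x, y) \<in> {(x, y). x \<in> max_ball r \<and> y \<in> max_ball r \<and> x \<noteq> y}.
        ereal (infnorm (f x - f y) / infnorm (x - y)))"

text \<open>
  \<open>x\<close> solves the initial value problem for \<open>D\<^sup>\<alpha> x = A x + f x\<close> on \<open>[0, T)\<close>, where
  \<open>T \<le> \<infinity>\<close>. Values of \<open>x\<close> outside \<open>[0, T)\<close> are irrelevant.
\<close>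

definition solution_on ::
    "real ^ 2 \<Rightarrow> real ^ 2 ^ 2 \<Rightarrow> (real ^ 2) set \<Rightarrow> (real ^ 2 \<Rightarrow> real ^ 2) \<Rightarrow> real ^ 2 \<Rightarrow> ereal \<Rightarrow>
     (real \<Rightarrow> real ^ 2) \<Rightarrow> bool" where
  "solution_on \<alpha> A \<Omega> f x0 T x \<longleftrightarrow>
     continuous_on {t. 0 \<le> t \<and> ereal t < T} x \<and>
     (\<forall>t. 0 \<le> t \<and> ereal t < T \<longrightarrow> x t \<in> \<Omega>) \<and>
     x 0 = x0 \<and>
     (\<forall>t. 0 < t \<and> ereal t < T \<longrightarrow> has_caputo_derivative2 \<alpha> x (A *v x t + f (x t)) t)"

text \<open>
  \<open>\<phi>\<close> is the unique solution and exists globally: every solution, be it only on some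
  \<open>[0, T)\<close>, agrees with \<open>\<phi>\<close> where it is defined.
\<close>

definition unique_global_solution ::
    "real ^ 2 \<Rightarrow> real ^ 2 ^ 2 \<Rightarrow> (real ^ 2) set \<Rightarrow> (real ^ 2 \<Rightarrow> real ^ 2) \<Rightarrow> real ^ 2 \<Rightarrow>
     (real \<Rightarrow> real ^ 2) \<Rightarrow> bool" where
  "unique_global_solution \<alpha> A \<Omega> f x0 \<phi> \<longleftrightarrow>
     solution_on \<alpha> A \<Omega> f x0 \<infinity> \<phi> \<and>
     (\<forall>T y. 0 < T \<and> solution_on \<alpha> A \<Omega> f x0 T y \<longrightarrow>
        (\<forall>t. 0 \<le> t \<and> ereal t < T \<longrightarrow> y t = \<phi> t))"

definition mittag_leffler_stable ::
    "real ^ 2 \<Rightarrow> real ^ 2 ^ 2 \<Rightarrow> (real ^ 2) set \<Rightarrow> (real ^ 2 \<Rightarrow> real ^ 2) \<Rightarrow> bool" where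
  "mittag_leffler_stable \<alpha> A \<Omega> f \<longleftrightarrow>
     (\<exists>\<gamma>>0. \<exists>m>0. \<exists>\<delta>>0. \<forall>x0 \<in> max_ball \<delta>.
        \<exists>\<phi>. unique_global_solution \<alpha> A \<Omega> f x0 \<phi> \<and>
          max (SUP t\<in>{0..1}. ereal (infnorm (\<phi> t)))
              (SUP t\<in>{1..}. ereal (t powr \<gamma> * infnorm (\<phi> t))) \<le> ereal m)"

end

theory Submission imports Defs "HOL-Complex_Analysis.Complex_Analysis"
begin

text \<open>
  The condition on \<open>A\<close> ensures that the characteristic function
  \<open>Q(s) = s\<^bsup>\<alpha>\<^sub>1 + \<alpha>\<^sub>2\<^esup> - a\<^sub>1\<^sub>1 s\<^bsup>\<alpha>\<^sub>2\<^esup> - a\<^sub>2\<^sub>2 s\<^bsup>\<alpha>\<^sub>1\<^esup> + det A\<close> of the linear part has no zero with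
  \<open>\<bar>arg s\<bar> \<le> pi / 2\<close>: on a ray, the imaginary part of \<open>Q(s) = 0\<close> determines \<open>\<bar>s\<bar>\<close>, and the
  condition prevents the real part from vanishing there. By compactness a slightly larger sector
  is free of zeros, so the inverse Laplace transforms of the entries of
  \<open>(diag(s\<^bsup>\<alpha>\<^sub>1\<^esup>, s\<^bsup>\<alpha>\<^sub>2\<^esup>) - A)\<^bsup>-1\<^esup>\<close> are integrals along a ray in the left half plane. These kernels are
  integrable and \<open>O(t\<^bsup>-1-\<alpha>\<^sub>1\<^esup>)\<close> at infinity, and their total mass is \<open>- A\<^bsup>-1\<^esup>\<close>. Hence the solution
  operator of the linear system preserves the weight \<open>(1 + t)\<^bsup>-\<alpha>\<^sub>1\<^esup>\<close>, and since \<open>l\<^sub>f(r) \<rightarrow> 0\<close>, the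
  variation of constants formula is a contraction on a small ball of the weighted space.
\<close>

text \<open>The two orders may be incommensurable, so \<open>Q\<close> need not be a polynomial in
  one power of \<open>s\<close>, and its zeros are excluded ray by ray instead of being computed. No
  inversion theorem is invoked: the kernels are written down as contour integrals, their transforms
  are computed forwards by Fubini and Cauchy, and uniqueness of the transform turns identities
  between transforms into integral equations. The entries are real on the real axis, so the upper
  half of the contour suffices. Writing \<open>x = x0 + y\<close> makes \<open>y\<close> start at 0
  with forcing \<open>A x0 + h\<close>, hence one family of kernels serves both the initial value
  and the inhomogeneity. A constant forcing does not decay under convolution; its limit is exactly
  \<open>- x0\<close> because the mass is \<open>- A^(-1)\<close>, so the mass has to be known and
  not merely bounded. The rate comes from the expansion \<open>const + O(s^a)\<close> at
  \<open>s = 0\<close> with the smaller order \<open>a\<close>. The contraction yields a solution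
  that is unique only among small decaying ones. Uniqueness among all continuous solutions, also on
  shorter intervals, needs the equivalence with a Volterra equation and an exponentially weighted
  estimate.\<close>

unbundle no fps_syntax

section \<open>Location of the characteristic roots\<close>

text \<open>This is the numerator in the derivative of
  \<open>sin (\<mu> * t) / sin (\<nu> * t)\<close>. It vanishes at 0, and its own derivative is
  \<open>(\<nu>\<^sup>2 - \<mu>\<^sup>2) * sin (\<mu> * t) * sin (\<nu> * t)\<close>, which is
  nonnegative as long as both angles are at most \<open>pi\<close>.\<close>

lemma sin_cos_wronskian_nonneg:
  fixes \<mu> \<nu> t :: real
  assumes "0 < \<mu>" "\<mu> \<le> \<nu>" "0 \<le> t" "\<nu> * t \<le> pi"
  shows "0 \<le> \<mu> * cos (\<mu> * t) * sin (\<nu> * t) - \<nu> * sin (\<mu> * t) * cos (\<nu> * t)"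
proof -
  let ?h = "\<lambda>t. \<mu> * cos (\<mu> * t) * sin (\<nu> * t) - \<nu> * sin (\<mu> * t) * cos (\<nu> * t)"
  have "?h 0 \<le> ?h t"
  proof (rule DERIV_nonneg_imp_nondecreasing[OF assms(3)])
    fix x assume x: "0 \<le> x" "x \<le> t"
    have lx: "\<nu> * x \<le> pi"
      using x assms by (smt (verit) mult_left_mono)
    have mx: "\<mu> * x \<le> pi"
      using x assms lx by (smt (verit) mult_right_mono)
    have "(?h has_real_derivative (\<nu>\<^sup>2 - \<mu>\<^sup>2) * (sin (\<mu> * x) * sin (\<nu> * x))) (at x)"
      by (auto intro!: derivative_eq_intros simp: algebra_simps power2_eq_square)
    moreover have "0 \<le> sin (\<mu> * x)" "0 \<le> sin (\<nu> * x)"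
      using x assms lx mx by (auto intro!: sin_ge_zero)
    moreover have "\<mu>\<^sup>2 \<le> \<nu>\<^sup>2" using assms by (simp add: power_mono)
    ultimately show "\<exists>y. (?h has_real_derivative y) (at x) \<and> 0 \<le> y"
      by (intro exI[of _ "(\<nu>\<^sup>2 - \<mu>\<^sup>2) * (sin (\<mu> * x) * sin (\<nu> * x))"]) auto
  qed
  then show ?thesis by simp
qed

text \<open>With \<open>\<nu> = a + b\<close> this bounds the weights on each ray by
  \<open>q1\<close> and \<open>q2\<close>. With \<open>\<mu> = a\<close> and
  \<open>\<nu> = b\<close> it bounds their quotient by \<open>q1 / q2\<close>.\<close>

lemma sin_ratio_mono:
  fixes \<mu> \<nu> \<theta> \<phi> :: real
  assumes "0 < \<mu>" "\<mu> \<le> \<nu>" "0 < \<theta>" "\<theta> \<le> \<phi>" "\<nu> * \<phi> < pi"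
  shows "sin (\<mu> * \<theta>) / sin (\<nu> * \<theta>) \<le> sin (\<mu> * \<phi>) / sin (\<nu> * \<phi>)"
proof (rule DERIV_nonneg_imp_nondecreasing[OF assms(4)])
  fix x assume x: "\<theta> \<le> x" "x \<le> \<phi>"
  have lx: "\<nu> * x < pi" using x assms by (smt (verit) mult_left_mono)
  have pos: "0 < sin (\<nu> * x)" using lx x assms by (intro sin_gt_zero) auto
  have "((\<lambda>t. sin (\<mu> * t) / sin (\<nu> * t)) has_real_derivative
      (\<mu> * cos (\<mu> * x) * sin (\<nu> * x) - \<nu> * sin (\<mu> * x) * cos (\<nu> * x)) / (sin (\<nu> * x))\<^sup>2) (at x)"
    using pos by (auto intro!: derivative_eq_intros simp: algebra_simps power2_eq_square)
  moreover have "0 \<le> (\<mu> * cos (\<mu> * x) * sin (\<nu> * x) - \<nu> * sin (\<mu> * x) * cos (\<nu> * x)) / (sin (\<nu> * x))\<^sup>2"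
    using sin_cos_wronskian_nonneg[of \<mu> \<nu> x] x assms lx by simp
  ultimately show "\<exists>y. ((\<lambda>t. sin (\<mu> * t) / sin (\<nu> * t)) has_real_derivative y) (at x) \<and> 0 \<le> y"
    by blast
qed

text \<open>The left side is the limit of the quotient as the angle tends to 0, so this is the same
  comparison for the positive real axis. It holds because
  \<open>\<nu> * sin (\<mu> * t) - \<mu> * sin (\<nu> * t)\<close> vanishes at 0 and has derivative
  \<open>\<nu> * \<mu> * (cos (\<mu> * t) - cos (\<nu> * t))\<close>.\<close>

lemma sin_ratio_ge_0:
  fixes \<mu> \<nu> \<phi> :: real
  assumes "0 < \<mu>" "\<mu> \<le> \<nu>" "0 < \<phi>" "\<nu> * \<phi> < pi"
  shows "\<mu> / \<nu> \<le> sin (\<mu> * \<phi>) / sin (\<nu> * \<phi>)"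
proof -
  let ?k = "\<lambda>t. \<nu> * sin (\<mu> * t) - \<mu> * sin (\<nu> * t)"
  have "?k 0 \<le> ?k \<phi>"
  proof (rule DERIV_nonneg_imp_nondecreasing[of 0 \<phi> ?k])
    fix x assume x: "0 \<le> x" "x \<le> \<phi>"
    have lx: "\<nu> * x < pi" using x assms by (smt (verit) mult_left_mono)
    have "(?k has_real_derivative \<nu> * \<mu> * (cos (\<mu> * x) - cos (\<nu> * x))) (at x)"
      by (auto intro!: derivative_eq_intros simp: algebra_simps)
    moreover have "cos (\<nu> * x) \<le> cos (\<mu> * x)"
      using x assms lx by (intro cos_monotone_0_pi_le) (auto intro: mult_right_mono)
    ultimately show "\<exists>y. (?k has_real_derivative y) (at x) \<and> 0 \<le> y"
      using assms by (intro exI[of _ "\<nu> * \<mu> * (cos (\<mu> * x) - cos (\<nu> * x))"]) auto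
  qed (use assms in auto)
  moreover have "0 < sin (\<nu> * \<phi>)" using assms by (intro sin_gt_zero) auto
  ultimately show ?thesis using assms by (simp add: field_simps)
qed

text \<open>The parameters \<open>a\<close>, \<open>b\<close>, \<open>d\<close> stand for the two
  orders and the determinant. Positivity of the determinant is common to all five cases and is
  pulled out in front.\<close>

definition stability_condition :: "real \<Rightarrow> real \<Rightarrow> real \<Rightarrow> real \<Rightarrow> real \<Rightarrow> real \<Rightarrow> real \<Rightarrow> bool" where
  "stability_condition a b q1 q2 a11 a22 d \<longleftrightarrow>
     d > 0 \<and>
     ((a11 \<le> 0 \<and> a22 \<le> 0) \<or>
      (a11 = 0 \<and> a22 > 0 \<and> (a22 * q1) powr (a / b) * a22 * q2 < d) \<or>
      (a22 = 0 \<and> a11 > 0 \<and> (a11 * q2) powr (b / a) * a11 * q1 < d) \<or>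
      (a11 > 0 \<and> a22 > 0 \<and>
        ((a11 * q2 + a22 * q1 > 1 \<and>
          a11 * q2 * ((a11 + a22) * q2) powr (b / a) + a22 * (a11 + a22) * q2 ^ 2 \<le> d) \<or>
         (a11 * q2 + a22 * q1 \<le> 1 \<and> a11 * q1 + a22 * q2 < d))) \<or>
      (a11 < 0 \<and> a22 > 0 \<and>
        ((a11 * q2 + a22 * q1 > 1 \<and> (a22 * q1) powr (a / b) * a22 * q2 \<le> d) \<or>
         (a11 * q2 + a22 * q1 \<le> 1 \<and> a22 * q2 \<le> d))))"

text \<open>
  On the ray at angle \<open>\<theta>\<close> the weights are \<open>u\<^sub>1 = sin (a \<theta>) / sin ((a + b) \<theta>)\<close> and
  \<open>u\<^sub>2 = sin (b \<theta>) / sin ((a + b) \<theta>)\<close>. They increase with \<open>\<theta>\<close>, from \<open>a / (a + b)\<close> and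
  \<open>b / (a + b)\<close> at \<open>\<theta> = 0\<close> to \<open>q\<^sub>1\<close> and \<open>q\<^sub>2\<close> at the imaginary axis.
\<close>

lemma crossing_bound:
  fixes a b q1 q2 u1 u2 a11 a22 d r :: real
  assumes ab: "0 < a" "a < b"
    and u: "0 < u1" "u1 \<le> q1" "0 < u2" "u2 \<le> q2" "u1 \<le> u2" "q1 < q2" "q2 * u1 \<le> q1 * u2"
    and r: "0 < r"
    and cond: "stability_condition a b q1 q2 a11 a22 d"
    and eq: "r powr (a + b) = a11 * u2 * r powr b + a22 * u1 * r powr a"
  shows "a11 * u1 * r powr b + a22 * u2 * r powr a < d"
proof -
  define X where "X = r powr a"
  define Y where "Y = r powr b"
  have X: "0 < X" and Y: "0 < Y" using r by (simp_all add: X_def Y_def)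
  have eq: "X * Y = a11 * u2 * Y + a22 * u1 * X"
    using eq by (simp add: X_def Y_def powr_add)
  have YX: "Y = X powr (b / a)" and XY: "X = Y powr (a / b)"
    using ab r by (simp_all add: X_def Y_def powr_powr)
  \<comment> \<open>The position of \<open>r\<close> relative to 1 orders \<open>1\<close>,
    \<open>X\<close> and \<open>Y\<close>. This is the source of the threshold 1 in cases (iv) and
    (v).\<close>
  have gt1: "1 < X \<and> X < Y" if "1 < r"
    using that ab powr_less_mono[of 0 a r] powr_less_mono[of a b r] by (simp add: X_def Y_def)
  have le1: "X \<le> 1 \<and> Y \<le> 1" if "r \<le> 1"
    using that ab r by (simp add: X_def Y_def powr_le1)
  have d: "d > 0" using cond by (simp add: stability_condition_def)
  \<comment> \<open>A negative \<open>a11\<close> makes the summand with \<open>Y\<close> negative,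
    so only \<open>a22 * u2 * X\<close> has to be bounded. Dropping the negative summand from the
    crossing equation bounds \<open>Y\<close>, and thereby \<open>X\<close>.\<close>
  have neg2: "a11 * u1 * Y + a22 * u2 * X < d" if "a11 < 0" "a22 > 0" and
    alt: "(a11 * q2 + a22 * q1 > 1 \<and> (a22 * q1) powr (a / b) * a22 * q2 \<le> d) \<or>
         (a11 * q2 + a22 * q1 \<le> 1 \<and> a22 * q2 \<le> d)"
  proof -
    have n: "a11 * u1 * Y < 0" using that u Y by (simp add: mult_neg_pos)
    have "a11 * u2 * Y < 0" using that u Y by (simp add: mult_neg_pos)
    then have "X * Y < a22 * u1 * X" using eq by linarith
    then have "Y < a22 * u1" using X by (simp add: mult.commute)
    also have "a22 * u1 \<le> a22 * q1" using that u by simp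
    finally have Yl: "Y < a22 * q1" .
    show ?thesis
      using alt
    proof
      assume h: "a11 * q2 + a22 * q1 > 1 \<and> (a22 * q1) powr (a / b) * a22 * q2 \<le> d"
      have "X \<le> (a22 * q1) powr (a / b)"
        unfolding XY using Yl Y ab by (intro powr_mono2) auto
      then have "a22 * u2 * X \<le> a22 * q2 * (a22 * q1) powr (a / b)"
        using that u X by (intro mult_mono) auto
      with n h show ?thesis by (simp add: algebra_simps)
    next
      assume h: "a11 * q2 + a22 * q1 \<le> 1 \<and> a22 * q2 \<le> d"
      have "r \<le> 1"
      proof (rule ccontr)
        assume "\<not> r \<le> 1"
        then have g: "1 < X" "X < Y" using gt1 by auto
        \<comment> \<open>For negative \<open>a11\<close> the estimate \<open>u2 \<le> q2\<close>
          points the wrong way, so \<open>a11 * q2 + a22 * q1 \<le> 1\<close> cannot be transferred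
          to the weights one by one. The comparison of quotients
          \<open>q2 * u1 \<le> q1 * u2\<close> transfers it.\<close>
        have "a22 * u1 * q1 = (a22 * q1) * u1" by simp
        also have "\<dots> \<le> (1 - a11 * q2) * u1" using h u by (intro mult_right_mono) auto
        also have "\<dots> = u1 + (- a11) * (q2 * u1)" by (simp add: algebra_simps)
        also have "\<dots> \<le> q1 + (- a11) * (q1 * u2)" using u that by (intro add_mono mult_left_mono) auto
        also have "\<dots> = (1 - a11 * u2) * q1" by (simp add: algebra_simps)
        finally have k: "a22 * u1 \<le> 1 - a11 * u2" using u by simp
        have "X * Y = a11 * u2 * Y + a22 * u1 * X" by (rule eq)
        also have "\<dots> \<le> a11 * u2 * Y + (1 - a11 * u2) * X" using k X by (intro add_left_mono mult_right_mono) auto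
        also have "\<dots> = X + (a11 * u2) * (Y - X)" by (simp add: algebra_simps)
        also have "\<dots> \<le> X" using that u g by (simp add: mult_nonpos_nonneg)
        finally show False using g X by simp
      qed
      then have "X \<le> 1" using le1 by simp
      then have "a22 * u2 * X \<le> a22 * q2 * 1" using that u X by (intro mult_mono) auto
      with n h show ?thesis by simp
    qed
  qed
  have both: "a11 * u1 * Y + a22 * u2 * X < d" if p: "a11 > 0" "a22 > 0" and
    alt: "(a11 * q2 + a22 * q1 > 1 \<and>
          a11 * q2 * ((a11 + a22) * q2) powr (b / a) + a22 * (a11 + a22) * q2 ^ 2 \<le> d) \<or>
         (a11 * q2 + a22 * q1 \<le> 1 \<and> a11 * q1 + a22 * q2 < d)"
    using alt
  proof
    assume h: "a11 * q2 + a22 * q1 > 1 \<and>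
          a11 * q2 * ((a11 + a22) * q2) powr (b / a) + a22 * (a11 + a22) * q2 ^ 2 \<le> d"
    have m: "a11 * q2 + a22 * q1 < (a11 + a22) * q2"
      using p u by (simp add: algebra_simps)
    \<comment> \<open>For \<open>r > 1\<close> replace \<open>X\<close> by the larger
      \<open>Y\<close> on the right of the crossing equation and cancel \<open>Y\<close>. For
      \<open>r \<le> 1\<close> the bound holds because \<open>X \<le> 1\<close> and the threshold
      sum exceeds 1.\<close>
    have Xl: "X < (a11 + a22) * q2"
    proof (cases "1 < r")
      case True
      then have g: "X < Y" using gt1 by auto
      have "X * Y < a11 * u2 * Y + a22 * u1 * Y"
        using eq g p u by simp
      then have "X < a11 * u2 + a22 * u1" using Y by (metis distrib_right mult_less_cancel_right_pos)
      also have "\<dots> \<le> a11 * q2 + a22 * q1" using u p by (intro add_mono mult_left_mono) auto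
      finally show ?thesis using m by simp
    next
      case False then show ?thesis using le1 h m by auto
    qed
    then have "Y \<le> ((a11 + a22) * q2) powr (b / a)"
      unfolding YX using X ab by (intro powr_mono2) auto
    then have "a11 * u1 * Y \<le> a11 * q2 * ((a11 + a22) * q2) powr (b / a)"
      using p u Y by (intro mult_mono) auto
    moreover have "a22 * u2 * X \<le> a22 * q2 * X" using p u X by simp
    moreover have "a22 * q2 * X < a22 * q2 * ((a11 + a22) * q2)"
      using p u Xl by simp
    ultimately show ?thesis using h by (simp add: power2_eq_square algebra_simps)
  next
    assume h: "a11 * q2 + a22 * q1 \<le> 1 \<and> a11 * q1 + a22 * q2 < d"
    have "r \<le> 1"
    proof (rule ccontr)
      assume "\<not> r \<le> 1"
      then have g: "1 < X" "X < Y" using gt1 by auto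
      have "X * Y < a11 * u2 * Y + a22 * u1 * Y"
        using eq g p u by simp
      then have "X < a11 * u2 + a22 * u1" using Y by (metis distrib_right mult_less_cancel_right_pos)
      also have "\<dots> \<le> a11 * q2 + a22 * q1" using u p by (intro add_mono mult_left_mono) auto
      finally show False using g h by simp
    qed
    then have "X \<le> 1" "Y \<le> 1" using le1 by auto
    then have "a11 * u1 * Y \<le> a11 * q1 * 1" "a22 * u2 * X \<le> a22 * q2 * 1"
      using p u X Y by (intro mult_mono; simp)+
    with h show ?thesis by simp
  qed
  have c3: "a11 * u1 * Y + a22 * u2 * X < d"
    if p: "a11 = 0" "a22 > 0" and h: "(a22 * q1) powr (a / b) * a22 * q2 < d"
  proof -
    have "Y = a22 * u1" using eq p X by simp
    also have "\<dots> \<le> a22 * q1" using p u by simp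
    finally have "X \<le> (a22 * q1) powr (a / b)" 
      unfolding XY using Y ab by (intro powr_mono2) auto
    then have "a22 * u2 * X \<le> a22 * q2 * (a22 * q1) powr (a / b)"
      using p u X by (intro mult_mono) auto
    also have "\<dots> < d" using h by (simp add: mult.commute mult.left_commute)
    finally show ?thesis using p by simp
  qed
  have c4: "a11 * u1 * Y + a22 * u2 * X < d"
    if p: "a22 = 0" "a11 > 0" and h: "(a11 * q2) powr (b / a) * a11 * q1 < d"
  proof -
    have "X = a11 * u2" using eq p Y by simp
    also have "\<dots> \<le> a11 * q2" using p u by simp
    finally have "Y \<le> (a11 * q2) powr (b / a)" 
      unfolding YX using X ab by (intro powr_mono2) auto
    then have "a11 * u1 * Y \<le> a11 * q1 * (a11 * q2) powr (b / a)"
      using p u Y by (intro mult_mono) auto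
    also have "\<dots> < d" using h by (simp add: mult.commute mult.left_commute)
    finally show ?thesis using p by simp
  qed
  have c5: False if "a11 \<le> 0" "a22 \<le> 0"
  proof -
    have "a11 * u2 * Y \<le> 0" "a22 * u1 * X \<le> 0"
      using that u X Y by (simp_all add: mult_nonpos_nonneg)
    with eq mult_pos_pos[OF X Y] show False by linarith
  qed
  have "a11 * u1 * Y + a22 * u2 * X < d"
    using cond neg2 both c3 c4 c5 unfolding stability_condition_def by blast
  then show ?thesis by (simp add: X_def Y_def)
qed

section \<open>Absence of zeros in a sector larger than the right half plane\<close>

lemma powr_lower_order_dominated:
  fixes a b c1 c2 :: real
  assumes "0 < a" "0 < b"
  shows "eventually (\<lambda>r. c1 * r powr b + c2 * r powr a \<le> r powr (a + b) / 2) at_top"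
proof -
  have "((\<lambda>r. c1 * r powr (- a) + c2 * r powr (- b)) \<longlongrightarrow> c1 * 0 + c2 * 0) at_top"
    using assms by (intro tendsto_intros tendsto_neg_powr filterlim_ident) auto
  then have "eventually (\<lambda>r. c1 * r powr (- a) + c2 * r powr (- b) < 1 / 2) at_top"
    by (rule order_tendstoD) simp
  then show ?thesis
    using eventually_gt_at_top[of 0]
  proof eventually_elim
    case (elim r)
    have "c1 * r powr b + c2 * r powr a = (c1 * r powr (- a) + c2 * r powr (- b)) * r powr (a + b)"
      by (simp add: distrib_right mult.assoc powr_add[symmetric])
    also have "\<dots> \<le> 1 / 2 * r powr (a + b)"
      using elim by (intro mult_right_mono) auto
    finally show ?case by simp
  qed
qed

text \<open>
  The complex variable is \<open>z = log s\<close> throughout, so that powers of \<open>s\<close> become entire functions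
  and sectors become strips.
\<close>

definition char_fun :: "real \<Rightarrow> real \<Rightarrow> real \<Rightarrow> real \<Rightarrow> real \<Rightarrow> complex \<Rightarrow> complex" where
  "char_fun a b a11 a22 d z =
     exp (of_real (a + b) * z) - of_real a11 * exp (of_real b * z)
       - of_real a22 * exp (of_real a * z) + of_real d"

lemma exp_of_real_mult_Complex:
  "exp (of_real \<beta> * Complex x \<theta>) = of_real (exp x powr \<beta>) * cis (\<beta> * \<theta>)"
  by (simp add: powr_def exp_eq_polar complex_eq_iff)

text \<open>At a zero with \<open>\<theta> > 0\<close>, the vanishing imaginary part is the crossing
  equation, and eliminating the highest power from the real part expresses \<open>d\<close> as
  exactly the sum that \<open>crossing_bound\<close> keeps below \<open>d\<close>. For
  \<open>\<theta> = 0\<close> the imaginary part carries no information; stationarity at a minimum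
  of the real function then supplies the crossing equation, with the limiting weights.\<close>

lemma char_fun_nonzero:
  fixes a b a11 a22 d :: real
  assumes ab: "0 < a" "a < b" "b \<le> 1"
    and q: "q1 = sin (a * pi / 2) / sin ((a + b) * pi / 2)"
      "q2 = sin (b * pi / 2) / sin ((a + b) * pi / 2)"
    and cond: "stability_condition a b q1 q2 a11 a22 d"
    and th: "0 \<le> \<theta>" "\<theta> \<le> pi / 2"
  shows "char_fun a b a11 a22 d (Complex x \<theta>) \<noteq> 0"
proof -
  have d: "d > 0" using cond by (simp add: stability_condition_def)
  have abpi: "(a + b) * (pi / 2) < pi" using ab by simp
  have qq: "q1 = sin (a * (pi / 2)) / sin ((a + b) * (pi / 2))"
      "q2 = sin (b * (pi / 2)) / sin ((a + b) * (pi / 2))"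
    using q by simp_all
  have spos: "0 < sin ((a + b) * (pi / 2))" using abpi ab by (intro sin_gt_zero) auto
  have sb: "sin (a * (pi / 2)) < sin (b * (pi / 2))"
    using ab by (intro sin_monotone_2pi) (auto simp: mult_less_cancel_right_pos intro: order_trans[of _ 0])
  have q12: "q1 < q2" unfolding qq using sb spos by (simp add: divide_strict_right_mono)
  have sa: "0 < sin (a * (pi / 2))" using ab by (intro sin_gt_zero) auto
  show ?thesis
  proof (cases "\<theta> = 0")
    case False
    then have th: "0 < \<theta>" "\<theta> \<le> pi / 2" using th by auto
    define s where "s = sin ((a + b) * \<theta>)"
    define s1 where "s1 = sin (a * \<theta>)"
    define s2 where "s2 = sin (b * \<theta>)"
    have abth: "(a + b) * \<theta> < pi"
      using abpi th ab by (smt (verit) mult_left_mono)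
    have s: "0 < s" unfolding s_def using abth th ab by (intro sin_gt_zero) auto
    have bth: "b * \<theta> \<le> pi / 2" using th ab by (smt (verit) mult_left_le_one_le pi_gt_zero)
    have ath: "a * \<theta> < b * \<theta>" using th ab by simp
    have s1: "0 < s1" unfolding s1_def using th ab ath bth pi_gt_zero by (intro sin_gt_zero) (simp, linarith)
    have s12: "s1 < s2" unfolding s1_def s2_def
      using ath bth th ab by (intro sin_monotone_2pi) (auto intro: order_trans[of _ 0])
    define u1 where "u1 = s1 / s"
    define u2 where "u2 = s2 / s"
    have u1q: "u1 \<le> q1" unfolding u1_def s1_def s_def qq
      using sin_ratio_mono[of a "a + b" \<theta> "pi / 2"] ab th abpi by simp
    have u2q: "u2 \<le> q2" unfolding u2_def s2_def s_def qq
      using sin_ratio_mono[of b "a + b" \<theta> "pi / 2"] ab th abpi by simp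
    have "s1 / s2 \<le> sin (a * (pi / 2)) / sin (b * (pi / 2))"
      unfolding s1_def s2_def using sin_ratio_mono[of a b \<theta> "pi / 2"] ab th abpi by simp
    then have "s1 / s2 \<le> q1 / q2" unfolding qq using spos by simp
    moreover have "0 < q2" "0 < q1" using sa sb spos by (auto simp: qq)
    ultimately have "q2 * s1 \<le> q1 * s2" using s1 s12
      by (simp add: field_simps)
    then have rat: "q2 * u1 \<le> q1 * u2" using s by (simp add: u1_def u2_def divide_right_mono)
    show ?thesis
    proof
      assume z: "char_fun a b a11 a22 d (Complex x \<theta>) = 0"
      define r where "r = exp x"
      have Im0: "r powr (a + b) * s = a11 * (r powr b * s2) + a22 * (r powr a * s1)"
        using arg_cong[OF z, of Im]
        unfolding char_fun_def exp_of_real_mult_Complex r_def[symmetric]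
        by (simp add: s_def s1_def s2_def)
      have Re0: "r powr (a + b) * cos ((a + b) * \<theta>) - a11 * (r powr b * cos (b * \<theta>))
           - a22 * (r powr a * cos (a * \<theta>)) + d = 0"
        using arg_cong[OF z, of Re]
        unfolding char_fun_def exp_of_real_mult_Complex r_def[symmetric]
        by simp
      have e1: "r powr (a + b) = a11 * u2 * r powr b + a22 * u1 * r powr a"
        using Im0 s by (simp add: u1_def u2_def field_simps)
      \<comment> \<open>These two addition formulas are what interchanges the roles of
        \<open>s1\<close> and \<open>s2\<close> when the real part is multiplied by \<open>s\<close>
        and the imaginary part is substituted.\<close>
      have t1: "sin (a * \<theta>) = s * cos (b * \<theta>) - cos ((a + b) * \<theta>) * s2"
        using sin_diff[of "(a + b) * \<theta>" "b * \<theta>"] by (simp add: s_def s2_def algebra_simps)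
      have t2: "sin (b * \<theta>) = s * cos (a * \<theta>) - cos ((a + b) * \<theta>) * s1"
        using sin_diff[of "(a + b) * \<theta>" "a * \<theta>"] by (simp add: s_def s1_def algebra_simps)
      have "d * s = a11 * (r powr b * (cos (b * \<theta>) * s)) + a22 * (r powr a * (cos (a * \<theta>) * s))
         - cos ((a + b) * \<theta>) * (r powr (a + b) * s)"
        using Re0 by algebra
      also have "\<dots> = a11 * r powr b * s1 + a22 * r powr a * s2"
        unfolding Im0 s1_def[symmetric] s2_def[symmetric] using t1 t2
        unfolding s1_def[symmetric] s2_def[symmetric] by algebra
      finally have "d = a11 * u1 * r powr b + a22 * u2 * r powr a"
        using s by (simp add: u1_def u2_def field_simps)
      moreover have "a11 * u1 * r powr b + a22 * u2 * r powr a < d"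
        using s s1 s12 by (intro crossing_bound[OF ab(1,2) _ u1q _ u2q _ q12 rat _ cond e1])
          (auto simp: u1_def u2_def r_def divide_right_mono)
      ultimately show False by simp
    qed
  next
    case True
    define P where "P = (\<lambda>r::real. r powr (a + b) - a11 * r powr b - a22 * r powr a + d)"
    have Ppos: "0 < P r" if r: "0 < r" for r :: real
    proof (rule ccontr)
      \<comment> \<open>\<open>P\<close> equals \<open>d > 0\<close> at 0 and is positive at a large
        \<open>R\<close>, so a nonpositive value forces an interior minimum \<open>m\<close>.
        Multiplying \<open>P'(m) = 0\<close> by \<open>m\<close> gives the crossing equation with
        the weights \<open>a / (a + b)\<close> and \<open>b / (a + b)\<close>.\<close>
      assume neg: "\<not> 0 < P r"
      have "eventually (\<lambda>R. a11 * R powr b + a22 * R powr a \<le> R powr (a + b) / 2 \<and> r < R) at_top"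
        using powr_lower_order_dominated[of a b a11 a22] eventually_gt_at_top[of r] ab
        by (auto intro: eventually_conj)
      then obtain R where R: "a11 * R powr b + a22 * R powr a \<le> R powr (a + b) / 2" "r < R"
        using eventually_happens'[OF trivial_limit_at_top_linorder] by blast
      have "0 \<le> R powr (a + b)" by simp
      then have R: "0 < P R" "r < R" using R d unfolding P_def by linarith+
      have "continuous_on {0..R} P" unfolding P_def
        using ab by (intro continuous_intros continuous_on_powr') auto
      then obtain m where m: "m \<in> {0..R}" "\<And>y. y \<in> {0..R} \<Longrightarrow> P m \<le> P y"
        using continuous_attains_inf[of "{0..R}" P] R r by fastforce
      have "P m \<le> P r" using m(2)[of r] R r by auto
      then have Pm: "P m \<le> 0" using neg by simp
      have "m \<noteq> 0" using Pm d ab by (auto simp: P_def)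
      moreover have "m \<noteq> R" using Pm R by auto
      ultimately have mR: "0 < m" "m < R" using m by auto
      define u1 where "u1 = a / (a + b)"
      define u2 where "u2 = b / (a + b)"
      have der: "(P has_real_derivative
          ((a + b) * m powr (a + b - 1) - a11 * (b * m powr (b - 1)) - a22 * (a * m powr (a - 1)))) (at m)"
        unfolding P_def using mR by (auto intro!: derivative_eq_intros)
      have "(a + b) * m powr (a + b - 1) - a11 * (b * m powr (b - 1)) - a22 * (a * m powr (a - 1)) = 0"
      proof (rule DERIV_local_min[OF der, of "min m (R - m)"])
        show "0 < min m (R - m)" using mR by simp
        show "\<forall>y. \<bar>m - y\<bar> < min m (R - m) \<longrightarrow> P m \<le> P y"
          by (intro allI impI m(2)) (auto simp: abs_less_iff)
      qed
      then have "m * ((a + b) * m powr (a + b - 1) - a11 * (b * m powr (b - 1)) - a22 * (a * m powr (a - 1))) = 0"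
        by simp
      moreover have "m * m powr (a + b - 1) = m powr (a + b)" "m * m powr (b - 1) = m powr b"
        "m * m powr (a - 1) = m powr a"
        using mR by (simp_all add: powr_diff)
      ultimately have "(a + b) * m powr (a + b) = a11 * b * m powr b + a22 * a * m powr a"
        by algebra
      then have e1: "m powr (a + b) = a11 * u2 * m powr b + a22 * u1 * m powr a"
        using ab by (simp add: u1_def u2_def add_divide_distrib[symmetric] nonzero_eq_divide_eq ac_simps)
      have u1q: "u1 \<le> q1" unfolding u1_def qq
        using sin_ratio_ge_0[of a "a + b" "pi / 2"] ab abpi by simp
      have u2q: "u2 \<le> q2" unfolding u2_def qq
        using sin_ratio_ge_0[of b "a + b" "pi / 2"] ab abpi by simp
      have "a / b \<le> sin (a * (pi / 2)) / sin (b * (pi / 2))"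
        using sin_ratio_ge_0[of a b "pi / 2"] ab by simp
      then have "a / b \<le> q1 / q2" unfolding qq using spos by simp
      moreover have "0 < q2" "0 < q1" using sa sb spos by (auto simp: qq)
      ultimately have "q2 * a \<le> q1 * b" using ab
        by (simp add: field_simps)
      then have rat: "q2 * u1 \<le> q1 * u2" using ab by (simp add: u1_def u2_def divide_right_mono)
      have "a11 * u1 * m powr b + a22 * u2 * m powr a < d"
        using ab mR by (intro crossing_bound[OF ab(1,2) _ u1q _ u2q _ q12 rat _ cond e1])
          (auto simp: u1_def u2_def divide_right_mono)
      \<comment> \<open>Since \<open>P m \<le> 0\<close> and the limiting weights sum to 1,
        substituting the crossing equation bounds \<open>d\<close> by the very sum that was just
        shown to be smaller than \<open>d\<close>.\<close>
      also have "d = P m - m powr (a + b) + a11 * m powr b + a22 * m powr a"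
        by (simp add: P_def)
      also have "\<dots> \<le> a11 * (1 - u2) * m powr b + a22 * (1 - u1) * m powr a"
        using Pm e1 by (simp add: algebra_simps)
      also have "\<dots> = a11 * u1 * m powr b + a22 * u2 * m powr a"
      proof -
        have "1 - u2 = u1" "1 - u1 = u2" using ab by (simp_all add: u1_def u2_def field_simps)
        then show ?thesis by simp
      qed
      finally show False by simp
    qed
    have "char_fun a b a11 a22 d (Complex x 0) = of_real (P (exp x))"
      unfolding char_fun_def exp_of_real_mult_Complex by (simp add: P_def)
    then show ?thesis using Ppos[of "exp x"] True by simp
  qed
qed

text \<open>A minimum over a bounded part of the closed quadrant, uniform continuity to enlarge the
  angle, and dominance of the leading power outside. The quantitative form
  \<open>1 + \<bar>s\<bar>^(a + b)\<close> is needed later, since it controls the quotients near the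
  origin and near infinity at once.\<close>

lemma char_fun_lower_bound:
  fixes a b a11 a22 d :: real
  assumes ab: "0 < a" "a < b" "b \<le> 1"
    and q: "q1 = sin (a * pi / 2) / sin ((a + b) * pi / 2)"
      "q2 = sin (b * pi / 2) / sin ((a + b) * pi / 2)"
    and cond: "stability_condition a b q1 q2 a11 a22 d"
  obtains \<psi> c where "pi / 2 < \<psi>" "\<psi> < pi" "0 < c"
    "\<And>z. 0 \<le> Im z \<Longrightarrow> Im z \<le> \<psi> \<Longrightarrow>
      c * (1 + exp ((a + b) * Re z)) \<le> cmod (char_fun a b a11 a22 d z)"
proof -
  have d: "d > 0" using cond by (simp add: stability_condition_def)
  define s where "s = a + b"
  have s: "0 < s" using ab by (simp add: s_def)
  \<comment> \<open>In the variable \<open>z\<close> the strip is unbounded to the left. Polar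
    coordinates add the origin as \<open>r = 0\<close>, where \<open>0 powr \<beta> = 0\<close>
    gives the correct continuous value \<open>d\<close>, so that compactness applies.\<close>
  define Q where "Q = (\<lambda>(r, \<theta>). of_real (r powr s) * cis (s * \<theta>)
      - of_real a11 * (of_real (r powr b) * cis (b * \<theta>))
      - of_real a22 * (of_real (r powr a) * cis (a * \<theta>)) + complex_of_real d)"
  have charQ: "char_fun a b a11 a22 d z = Q (exp (Re z), Im z)" for z
  proof -
    have e: "exp (of_real \<beta> * z) = of_real (exp (Re z) powr \<beta>) * cis (\<beta> * Im z)" for \<beta>
      using exp_of_real_mult_Complex[of \<beta> "Re z" "Im z"] by simp
    show ?thesis by (simp only: char_fun_def Q_def s_def prod.case e)
  qed
  have contQ: "continuous_on ({0..R} \<times> {0..pi}) Q" for R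
  proof -
    have "continuous_on ({0..R} \<times> {0..pi}) (\<lambda>p. complex_of_real (fst p powr \<beta>) * cis (\<beta> * snd p))"
      if "0 < \<beta>" for \<beta>
      by (rule continuous_on_mult[OF continuous_on_of_real[OF continuous_on_powr'] continuous_on_cis])
        (use that in \<open>auto intro!: continuous_on_fst continuous_on_snd continuous_on_mult continuous_on_const continuous_on_id\<close>)
    from this[of s] this[of b] this[of a] show ?thesis
      unfolding Q_def case_prod_beta using ab s
      by (auto intro!: continuous_on_add continuous_on_diff continuous_on_mult_left continuous_on_const)
  qed
  have nz: "Q (r, \<theta>) \<noteq> 0" if "0 \<le> r" "0 \<le> \<theta>" "\<theta> \<le> pi / 2" for r \<theta>
  proof (cases "r = 0")
    case True
    then show ?thesis using d by (simp add: Q_def)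
  next
    case False
    then have "Q (r, \<theta>) = char_fun a b a11 a22 d (Complex (ln r) \<theta>)"
      using that by (simp add: charQ)
    then show ?thesis using char_fun_nonzero[OF ab q cond, of \<theta> "ln r"] that by simp
  qed
  have "eventually (\<lambda>r. \<bar>a11\<bar> * r powr b + \<bar>a22\<bar> * r powr a \<le> r powr s / 2 \<and> 4 * d \<le> r powr s \<and> 1 \<le> r) at_top"
    unfolding s_def
  proof (intro eventually_conj powr_lower_order_dominated eventually_ge_at_top)
    show "\<forall>\<^sub>F r in at_top. 4 * d \<le> r powr (a + b)"
      using eventually_ge_at_top[of "(4 * d) powr (1 / (a + b))"]
    proof eventually_elim
      case (elim r)
      then have "((4 * d) powr (1 / (a + b))) powr (a + b) \<le> r powr (a + b)"
        using ab by (intro powr_mono2) auto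
      then show ?case using ab d by (simp add: powr_powr)
    qed
  qed (use ab in auto)
  then obtain R where R: "\<And>r. R \<le> r \<Longrightarrow> \<bar>a11\<bar> * r powr b + \<bar>a22\<bar> * r powr a \<le> r powr s / 2"
    "\<And>r. R \<le> r \<Longrightarrow> 4 * d \<le> r powr s" "\<And>r. R \<le> r \<Longrightarrow> 1 \<le> r"
    unfolding eventually_at_top_linorder by auto
  \<comment> \<open>The lower powers cost at most half of \<open>r powr s\<close> and
    \<open>d\<close> at most a quarter; what is left is at least \<open>r powr s / 4\<close>, hence
    at least an eighth of \<open>1 + r powr s\<close> because
    \<open>r powr s \<ge> 1\<close>.\<close>
  have far: "1 / 8 * (1 + r powr s) \<le> cmod (Q (r, \<theta>))" if r: "R \<le> r" for r \<theta>
  proof -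
    let ?A = "of_real (r powr s) * cis (s * \<theta>)"
    let ?B = "of_real a11 * (of_real (r powr b) * cis (b * \<theta>))"
    let ?C = "of_real a22 * (of_real (r powr a) * cis (a * \<theta>))"
    have n: "cmod ?A = r powr s" "cmod ?B = \<bar>a11\<bar> * r powr b" "cmod ?C = \<bar>a22\<bar> * r powr a"
      by (simp_all add: norm_mult)
    have "cmod ?A \<le> cmod (?A - ?B - ?C + complex_of_real d) + cmod ?B + cmod ?C + d"
    proof -
      have "cmod ?A \<le> cmod ((?A - ?B - ?C + complex_of_real d) + ?B + ?C) + cmod (complex_of_real d)"
        using norm_triangle_ineq4[of "(?A - ?B - ?C + complex_of_real d) + ?B + ?C" "complex_of_real d"] by simp
      moreover have "cmod ((?A - ?B - ?C + complex_of_real d) + ?B + ?C)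
        \<le> cmod (?A - ?B - ?C + complex_of_real d) + cmod ?B + cmod ?C"
        using norm_triangle_ineq[of "(?A - ?B - ?C + complex_of_real d) + ?B" ?C]
          norm_triangle_ineq[of "(?A - ?B - ?C + complex_of_real d)" ?B] by linarith
      ultimately show ?thesis using d by simp
    qed
    moreover have "1 \<le> r powr s" using R(3)[OF r] s by (simp add: ge_one_powr_ge_zero)
    ultimately show ?thesis using R(1)[OF r] R(2)[OF r] unfolding n Q_def by simp
  qed
  have R0: "1 \<le> R" using R(3) by blast
  let ?K0 = "{0..R} \<times> {0..pi / 2}"
  have "compact ?K0" "?K0 \<noteq> {}" using R0 by (auto intro: compact_Times)
  moreover have "continuous_on ?K0 (\<lambda>p. cmod (Q p))"
    by (intro continuous_on_norm continuous_on_subset[OF contQ[of R]]) auto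
  ultimately obtain p0 where p0: "p0 \<in> ?K0" "\<And>p. p \<in> ?K0 \<Longrightarrow> cmod (Q p0) \<le> cmod (Q p)"
    using continuous_attains_inf[of ?K0 "\<lambda>p. cmod (Q p)"] by blast
  define m where "m = cmod (Q p0)"
  have m: "0 < m" using nz[of "fst p0" "snd p0"] p0(1) by (auto simp: m_def)
  have "uniformly_continuous_on ({0..R} \<times> {0..pi}) Q"
    by (intro compact_uniformly_continuous contQ compact_Times) auto
  then obtain \<delta> where \<delta>: "0 < \<delta>" "\<And>x y. x \<in> {0..R} \<times> {0..pi} \<Longrightarrow> y \<in> {0..R} \<times> {0..pi} \<Longrightarrow>
      dist y x < \<delta> \<Longrightarrow> dist (Q y) (Q x) < m / 2"
    using m by (elim uniformly_continuous_onE[of _ _ "m / 2"]) auto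
  \<comment> \<open>The first bound keeps the added angle below the modulus of continuity
    \<open>\<delta>\<close>, the second keeps \<open>\<psi>\<close> below \<open>pi\<close>.\<close>
  define \<psi> where "\<psi> = pi / 2 + min (\<delta> / 2) (pi / 4)"
  have \<psi>: "pi / 2 < \<psi>" "\<psi> < pi" "\<psi> - pi / 2 < \<delta>" using \<delta>(1) pi_gt_zero unfolding \<psi>_def by linarith+
  have near: "m / 2 \<le> cmod (Q (r, \<theta>))" if "0 \<le> r" "r \<le> R" "0 \<le> \<theta>" "\<theta> \<le> \<psi>" for r \<theta>
  proof (cases "\<theta> \<le> pi / 2")
    case True
    then show ?thesis using p0(2)[of "(r, \<theta>)"] that m unfolding m_def[symmetric] by simp
  next
    case False
    have "dist (r, \<theta>) (r, pi / 2) < \<delta>" using False that \<psi> by (simp add: dist_Pair_Pair dist_real_def)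
    then have "dist (Q (r, \<theta>)) (Q (r, pi / 2)) < m / 2"
      using False that \<psi> by (intro \<delta>(2)) auto
    moreover have "m \<le> cmod (Q (r, pi / 2))" using p0(2)[of "(r, pi / 2)"] that by (simp add: m_def)
    ultimately show ?thesis
      using norm_triangle_ineq2[of "Q (r, pi / 2)" "Q (r, \<theta>)"] by (simp add: dist_norm norm_minus_commute)
  qed
  define c where "c = min (1 / 8) (m / 2 / (1 + R powr s))"
  have pos1: "0 < 1 + R powr s" by (simp add: add_pos_nonneg)
  have c: "0 < c" using m pos1 by (simp add: c_def)
  have "c * (1 + exp ((a + b) * Re z)) \<le> cmod (char_fun a b a11 a22 d z)"
    if "0 \<le> Im z" "Im z \<le> \<psi>" for z
  proof -
    have e: "exp ((a + b) * Re z) = exp (Re z) powr s" by (simp add: powr_def s_def)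
    show ?thesis
    proof (cases "exp (Re z) \<le> R")
      case True
      have "exp (Re z) powr s \<le> R powr s" using True s by (intro powr_mono2) auto
      then have "c * (1 + exp (Re z) powr s) \<le> m / 2 / (1 + R powr s) * (1 + R powr s)"
        using m pos1 by (intro mult_mono) (auto simp: c_def add_nonneg_nonneg)
      also have "\<dots> = m / 2" proof -
        have "m / 2 / N * N = m / 2" if "0 < N" for N :: real using that by simp
        then show ?thesis using pos1 .
      qed
      also have "\<dots> \<le> cmod (Q (exp (Re z), Im z))" using near that True by simp
      finally show ?thesis by (simp add: charQ e)
    next
      case False
      have "c * (1 + exp (Re z) powr s) \<le> 1 / 8 * (1 + exp (Re z) powr s)"
        unfolding c_def by (intro mult_right_mono min.cobounded1) (auto simp: add_nonneg_nonneg)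
      also have "\<dots> \<le> cmod (Q (exp (Re z), Im z))" using far False by simp
      finally show ?thesis by (simp add: charQ e)
    qed
  qed
  then show ?thesis using that \<psi> c by blast
qed

section \<open>Auxiliary integrals\<close>

text \<open>The integrand is the derivative of a bounded monotone function. It serves as the
  explicit integrable majorant for the other integrals over the whole line in the logarithmic
  variable.\<close>

lemma integrable_deriv_exp_neg_exp:
  fixes \<beta> \<kappa> :: real
  assumes "0 < \<beta>" "0 < \<kappa>"
  shows "integrable lborel (\<lambda>x. exp (\<beta> * x) * exp (- \<kappa> * exp (\<beta> * x)))"
proof -
  let ?F = "\<lambda>x. - exp (- \<kappa> * exp (\<beta> * x)) / (\<kappa> * \<beta>)"
  have "set_integrable lborel (einterval (-\<infinity>) \<infinity>) (\<lambda>x. exp (\<beta> * x) * exp (- \<kappa> * exp (\<beta> * x)))"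
  proof (rule interval_integral_FTC_nonneg(1)[where F = ?F and A = "- 1 / (\<kappa> * \<beta>)" and B = 0])
    fix x show "(?F has_real_derivative exp (\<beta> * x) * exp (- \<kappa> * exp (\<beta> * x))) (at x)"
      using assms by (auto intro!: derivative_eq_intros simp: field_simps)
  next
    have l: "filterlim (\<lambda>x. \<beta> * x) at_bot at_bot"
      using assms by (simp add: filterlim_tendsto_pos_mult_at_bot[OF tendsto_const _ filterlim_ident])
    have "((\<lambda>x. exp (\<beta> * x)) \<longlongrightarrow> 0) at_bot" by (rule filterlim_compose[OF exp_at_bot l])
    then have "(?F \<longlongrightarrow> - exp (- \<kappa> * 0) / (\<kappa> * \<beta>)) at_bot"
      using assms by (intro tendsto_intros) auto
    then show "((?F \<circ> real_of_ereal) \<longlongrightarrow> - 1 / (\<kappa> * \<beta>)) (at_right (-\<infinity>))"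
      by (simp add: ereal_tendsto_simps)
  next
    have l: "filterlim (\<lambda>x. \<beta> * x) at_top at_top"
      using assms by (simp add: filterlim_tendsto_pos_mult_at_top[OF tendsto_const _ filterlim_ident])
    have "filterlim (\<lambda>x. exp (\<beta> * x)) at_top at_top" by (rule filterlim_compose[OF exp_at_top l])
    then have "filterlim (\<lambda>x. - \<kappa> * exp (\<beta> * x)) at_bot at_top"
      using assms by (intro filterlim_tendsto_neg_mult_at_bot[OF tendsto_const]) auto
    then have "((\<lambda>x. exp (- \<kappa> * exp (\<beta> * x))) \<longlongrightarrow> 0) at_top" by (rule filterlim_compose[OF exp_at_bot])
    then have "(?F \<longlongrightarrow> - 0 / (\<kappa> * \<beta>)) at_top"
      using assms by (intro tendsto_intros) auto
    then show "((?F \<circ> real_of_ereal) \<longlongrightarrow> 0) (at_left \<infinity>)"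
      by (simp add: ereal_tendsto_simps)
  qed (auto intro!: continuous_intros)
  then show ?thesis by (simp add: set_integrable_def)
qed

text \<open>With \<open>s = exp x\<close> this is the integrand of Euler's integral for
  \<open>Gamma \<beta>\<close> with rate \<open>\<kappa>\<close>. It is dominated by two exact
  derivatives, one for each sign of \<open>x\<close>.\<close>

lemma integrable_exp_minus_exp:
  fixes \<beta> \<kappa> :: real
  assumes b: "0 < \<beta>" and k: "0 < \<kappa>"
  shows "integrable lborel (\<lambda>x. exp (\<beta> * x - \<kappa> * exp x))"
proof -
  \<comment> \<open>For \<open>x \<ge> 0\<close>, completing the square and
    \<open>x\<^sup>2 / 2 \<le> exp x\<close> give \<open>(\<beta> - 1) * x \<le> (\<beta> -
    1)\<^sup>2 / \<kappa> + (\<kappa> / 2) * exp x\<close>. Half of the decay rate pays for changing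
    \<open>\<beta>\<close> to 1, at the cost of the constant factor \<open>D\<close>.\<close>
  define D where "D = exp ((\<beta> - 1)\<^sup>2 / \<kappa>)"
  have "integrable lborel (\<lambda>x. exp 1 * (exp (\<beta> * x) * exp (- 1 * exp (\<beta> * x)))
      + D * (exp (1 * x) * exp (- (\<kappa> / 2) * exp (1 * x))))"
    by (intro Bochner_Integration.integrable_add integrable_mult_right integrable_deriv_exp_neg_exp) (use assms in auto)
  then show ?thesis
  proof (rule Bochner_Integration.integrable_bound)
    show "AE x in lborel. norm (exp (\<beta> * x - \<kappa> * exp x)) \<le> norm (exp 1 * (exp (\<beta> * x) * exp (- 1 * exp (\<beta> * x)))
      + D * (exp (1 * x) * exp (- (\<kappa> / 2) * exp (1 * x))))"
    proof (intro AE_I2)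
      fix x :: real
      have D: "0 < D" by (simp add: D_def)
      have "exp (\<beta> * x - \<kappa> * exp x) \<le> exp 1 * (exp (\<beta> * x) * exp (- 1 * exp (\<beta> * x)))
        + D * (exp (1 * x) * exp (- (\<kappa> / 2) * exp (1 * x)))"
      proof (cases "0 \<le> x")
        case True
        have "(\<beta> - 1) * x \<le> (\<beta> - 1)\<^sup>2 / \<kappa> + \<kappa> / 4 * x\<^sup>2"
        proof -
          have "0 \<le> (2 * (\<beta> - 1) - \<kappa> * x)\<^sup>2" by simp
          then have "4 * (\<beta> - 1) * (\<kappa> * x) \<le> 4 * (\<beta> - 1)\<^sup>2 + \<kappa>\<^sup>2 * x\<^sup>2" by (simp add: power2_eq_square algebra_simps)
          then have "(4 * (\<beta> - 1) * (\<kappa> * x)) / (4 * \<kappa>) \<le> (4 * (\<beta> - 1)\<^sup>2 + \<kappa>\<^sup>2 * x\<^sup>2) / (4 * \<kappa>)"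
            using k by (intro divide_right_mono) auto
          moreover have "(4 * (\<beta> - 1) * (\<kappa> * x)) / (4 * \<kappa>) = (\<beta> - 1) * x" using k by simp
          moreover have "(4 * (\<beta> - 1)\<^sup>2 + \<kappa>\<^sup>2 * x\<^sup>2) / (4 * \<kappa>) = (\<beta> - 1)\<^sup>2 / \<kappa> + \<kappa> / 4 * x\<^sup>2"
            using k by (simp add: add_divide_distrib power2_eq_square[of \<kappa>])
          ultimately show ?thesis by simp
        qed
        moreover have "x\<^sup>2 / 2 \<le> exp x" using exp_lower_Taylor_quadratic[OF True] True by simp
        then have "\<kappa> / 2 * (x\<^sup>2 / 2) \<le> \<kappa> / 2 * exp x" using k by (intro mult_left_mono) auto
        ultimately have "\<beta> * x - \<kappa> * exp x \<le> (\<beta> - 1)\<^sup>2 / \<kappa> + (x + (- (\<kappa> / 2) * exp x))"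
          by (simp add: algebra_simps)
        then have "exp (\<beta> * x - \<kappa> * exp x) \<le> exp ((\<beta> - 1)\<^sup>2 / \<kappa> + (x + (- (\<kappa> / 2) * exp x)))"
          by (simp only: exp_le_cancel_iff)
        also have "\<dots> = D * (exp (1 * x) * exp (- (\<kappa> / 2) * exp (1 * x)))"
          by (simp only: exp_add D_def) simp
        finally show ?thesis by (smt (verit) exp_gt_zero mult_pos_pos)
      next
        case False
        have "exp (\<beta> * x) \<le> 1" using False b by (simp add: mult_nonneg_nonpos)
        moreover have "0 \<le> \<kappa> * exp x" using k by simp
        ultimately have "\<beta> * x - \<kappa> * exp x \<le> 1 + (\<beta> * x + (- 1 * exp (\<beta> * x)))" by linarith
        then have "exp (\<beta> * x - \<kappa> * exp x) \<le> exp (1 + (\<beta> * x + (- 1 * exp (\<beta> * x))))"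
          by (simp only: exp_le_cancel_iff)
        also have "\<dots> = exp 1 * (exp (\<beta> * x) * exp (- 1 * exp (\<beta> * x)))" by (simp only: exp_add)
        finally show ?thesis using D by (smt (verit) exp_gt_zero mult_pos_pos)
      qed
      then show "norm (exp (\<beta> * x - \<kappa> * exp x)) \<le> norm (exp 1 * (exp (\<beta> * x) * exp (- 1 * exp (\<beta> * x)))
      + D * (exp (1 * x) * exp (- (\<kappa> / 2) * exp (1 * x))))"
        by simp
    qed
  qed simp
qed

text \<open>Scaling \<open>s\<close> by \<open>t\<close> is a translation by \<open>ln t\<close> in
  the logarithmic variable. This is where all powers of \<open>t\<close> in the kernel bounds come
  from.\<close>

lemma exp_minus_exp_scaling:
  fixes \<beta> \<kappa> t :: real
  assumes b: "0 < \<beta>" and k: "0 < \<kappa>" and t: "0 < t"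
  shows "integrable lborel (\<lambda>x. exp (\<beta> * x - \<kappa> * t * exp x))"
    and "(\<integral>x. exp (\<beta> * x - \<kappa> * t * exp x) \<partial>lborel)
      = t powr (- \<beta>) * (\<integral>x. exp (\<beta> * x - \<kappa> * exp x) \<partial>lborel)"
proof -
  let ?f = "\<lambda>x. exp (\<beta> * x - \<kappa> * exp x)"
  have e: "?f (ln t + 1 * x) = t powr \<beta> * exp (\<beta> * x - \<kappa> * t * exp x)" for x
    using t by (simp add: exp_add exp_diff powr_def distrib_left)
  show "integrable lborel (\<lambda>x. exp (\<beta> * x - \<kappa> * t * exp x))"
    by (intro integrable_exp_minus_exp) (use assms in auto)
  have "(\<integral>x. ?f x \<partial>lborel) = (\<integral>x. ?f (ln t + 1 * x) \<partial>lborel)"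
    by (subst lborel_integral_real_affine[of 1 ?f "ln t"]) simp_all
  also have "\<dots> = t powr \<beta> * (\<integral>x. exp (\<beta> * x - \<kappa> * t * exp x) \<partial>lborel)"
    unfolding e by simp
  finally show "(\<integral>x. exp (\<beta> * x - \<kappa> * t * exp x) \<partial>lborel) = t powr (- \<beta>) * (\<integral>x. ?f x \<partial>lborel)"
    using t by (simp add: powr_minus)
qed

text \<open>Euler's integral after the substitution of \<open>p * t\<close>. It gives the Laplace
  transform of the fractional kernel and, for \<open>\<kappa> = 1\<close>, the integrability of the
  exponential.\<close>

lemma has_bochner_integral_Gamma_scaled:
  fixes \<kappa> p :: real
  assumes k: "0 < \<kappa>" and p: "0 < p"
  shows "has_bochner_integral lborel (\<lambda>t. indicator {0<..} t * (t powr (\<kappa> - 1) * exp (- p * t))) (Gamma \<kappa> / p powr \<kappa>)"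
proof -
  let ?f = "\<lambda>t. indicator {0..} t * t powr (\<kappa> - 1) / exp t :: real"
  have "has_bochner_integral lborel ?f (Gamma \<kappa>)"
    using Gamma_conv_nn_integral_real[OF k] k Gamma_real_pos[OF k]
    by (intro has_bochner_integral_nn_integral) auto
  then have "has_bochner_integral lborel (\<lambda>t. ?f (0 + p * t)) (Gamma \<kappa> /\<^sub>R \<bar>p\<bar>)"
    using p by (subst lborel_has_bochner_integral_real_affine_iff[symmetric]) auto
  then have "has_bochner_integral lborel (\<lambda>t. p powr (1 - \<kappa>) * ?f (0 + p * t)) (p powr (1 - \<kappa>) * (Gamma \<kappa> /\<^sub>R \<bar>p\<bar>))"
    by (rule has_bochner_integral_mult_right)
  moreover have "p powr (1 - \<kappa>) * ?f (0 + p * t) = indicator {0<..} t * (t powr (\<kappa> - 1) * exp (- p * t))" for t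
  proof (cases "0 < t")
    case True
    then have "p powr (1 - \<kappa>) * (p * t) powr (\<kappa> - 1) = t powr (\<kappa> - 1)"
      using p by (simp add: powr_mult powr_diff)
    then show ?thesis using True p by (simp add: exp_minus field_simps)
  next
    case False
    then show ?thesis using p by (cases "t = 0") (auto simp: indicator_def zero_le_mult_iff)
  qed
  moreover have "p powr (1 - \<kappa>) * (Gamma \<kappa> /\<^sub>R \<bar>p\<bar>) = Gamma \<kappa> / p powr \<kappa>"
    using p by (simp add: powr_diff field_simps)
  ultimately show ?thesis by simp
qed

lemma set_integrable_powr_tail:
  fixes a T :: real
  assumes a: "0 < a" and T: "0 < T"
  shows "set_integrable lborel {T<..} (\<lambda>t. t powr (- 1 - a))"
    and "(LINT t:{T<..}|lborel. t powr (- 1 - a)) = T powr (- a) / a"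
proof -
  let ?F = "\<lambda>t::real. - (t powr (- a)) / a"
  have e: "einterval (ereal T) \<infinity> = {T<..}" by (auto simp: einterval_def)
  have F: "(?F has_real_derivative x powr (- 1 - a)) (at x)" if "ereal T < ereal x" "ereal x < \<infinity>" for x
    using that T a by (auto intro!: derivative_eq_intros simp: powr_diff powr_minus field_simps)
  have A: "((?F \<circ> real_of_ereal) \<longlongrightarrow> - (T powr (- a)) / a) (at_right (ereal T))"
    using T a by (auto simp: ereal_tendsto_simps intro!: tendsto_eq_intros)
  have "(?F \<longlongrightarrow> - 0 / a) at_top"
    using a by (intro tendsto_intros tendsto_neg_powr filterlim_ident) auto
  then have B: "((?F \<circ> real_of_ereal) \<longlongrightarrow> 0) (at_left \<infinity>)"
    by (simp add: ereal_tendsto_simps)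
  have c: "isCont (\<lambda>t. t powr (- 1 - a)) x" if "ereal T < ereal x" "ereal x < \<infinity>" for x
    using that T by (auto intro!: continuous_intros)
  have lt: "ereal T < \<infinity>" by simp
  have nn: "AE x in lborel. ereal T < ereal x \<longrightarrow> ereal x < \<infinity> \<longrightarrow> 0 \<le> x powr (- 1 - a)" by simp
  note FTC = interval_integral_FTC_nonneg[OF lt F c nn A B]
  show "set_integrable lborel {T<..} (\<lambda>t. t powr (- 1 - a))" using FTC(1) by (simp add: e)
  show "(LINT t:{T<..}|lborel. t powr (- 1 - a)) = T powr (- a) / a"
    using FTC(2) by (simp add: interval_lebesgue_integral_def e)
qed

section \<open>Inverse Laplace transform along a ray\<close>

text \<open>Where \<open>exp (\<beta> * x) \<le> 1\<close>, it differs from the exact derivative of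
  \<open>integrable_deriv_exp_neg_exp\<close> by a factor of at most \<open>exp 1\<close>; the right
  half line is handled by the reflected majorant.\<close>

lemma integrable_two_sided_exp_bound:
  fixes f :: "real \<Rightarrow> 'a::{banach, second_countable_topology}"
  assumes b: "0 < \<beta>" and meas: "f \<in> borel_measurable lborel"
    and neg: "\<And>x. x \<le> 0 \<Longrightarrow> norm (f x) \<le> A * exp (\<beta> * x)"
    and pos: "\<And>x. 0 \<le> x \<Longrightarrow> norm (f x) \<le> A * exp (- \<beta> * x)"
  shows "integrable lborel f"
proof -
  let ?g = "\<lambda>x. exp (\<beta> * x) * exp (- 1 * exp (\<beta> * x))"
  have g: "integrable lborel ?g" by (rule integrable_deriv_exp_neg_exp[OF b]) simp
  have "integrable lborel (\<lambda>x. ?g (0 + (-1) * x))" by (rule lborel_integrable_real_affine[OF g]) simp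
  with g have "integrable lborel (\<lambda>x. A * exp 1 * (?g x + ?g (0 + (-1) * x)))"
    by (intro integrable_mult_right Bochner_Integration.integrable_add)
  then show ?thesis
  proof (rule Bochner_Integration.integrable_bound[OF _ meas], intro AE_I2)
    fix x :: real
    have A: "0 \<le> A" using order_trans[OF norm_ge_zero neg[of 0]] by simp
    have *: "exp (\<beta> * y) \<le> exp 1 * ?g y" if "y \<le> 0" for y
    proof -
      have "exp (\<beta> * y) \<le> 1" using that b by (simp add: mult_nonneg_nonpos)
      then have "exp 0 \<le> exp (1 + (- 1 * exp (\<beta> * y)))" by (subst exp_le_cancel_iff) simp
      then have "1 \<le> exp 1 * exp (- 1 * exp (\<beta> * y))" by (simp only: exp_add exp_zero)
      then have "exp (\<beta> * y) * 1 \<le> exp (\<beta> * y) * (exp 1 * exp (- 1 * exp (\<beta> * y)))"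
        by (intro mult_left_mono) auto
      then show ?thesis by (simp add: ac_simps)
    qed
    have gp: "0 \<le> ?g y" for y by simp
    have "norm (f x) \<le> A * exp 1 * (?g x + ?g (0 + (-1) * x))"
    proof (cases "x \<le> 0")
      case True
      have "norm (f x) \<le> A * exp (\<beta> * x)" using neg True by simp
      also have "\<dots> \<le> A * (exp 1 * ?g x)" by (intro mult_left_mono * True A)
      also have "\<dots> \<le> A * (exp 1 * (?g x + ?g (0 + (-1) * x)))"
        by (intro mult_left_mono A) (use gp in \<open>auto\<close>)
      finally show ?thesis by (simp only: mult.assoc)
    next
      case False
      have "norm (f x) \<le> A * exp (\<beta> * (0 + (-1) * x))" using pos[of x] False by simp
      also have "\<dots> \<le> A * (exp 1 * ?g (0 + (-1) * x))" using False by (intro mult_left_mono * A) simp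
      also have "\<dots> \<le> A * (exp 1 * (?g x + ?g (0 + (-1) * x)))"
        by (intro mult_left_mono A) (use gp in \<open>auto\<close>)
      finally show ?thesis by (simp only: mult.assoc)
    qed
    then show "norm (f x) \<le> norm (A * exp 1 * (?g x + ?g (0 + (-1) * x)))" by simp
  qed
qed

text \<open>\<open>G\<close> is a transform in the variable \<open>z = log s\<close>, and the strip
  is the upper half of the sector. \<open>decay\<close> reads \<open>O(s^(-a))\<close> at infinity
  and will give \<open>t^(a - 1)\<close> at \<open>t = 0\<close>; \<open>origin\<close> reads
  \<open>G0 + O(s^a)\<close> at 0 and will give \<open>t^(-1 - a)\<close> at infinity.
  \<open>real_axis\<close> makes the lower half of the contour the conjugate of the upper
  one.\<close>

locale ray_kernel =
  fixes G :: "complex \<Rightarrow> complex" and U :: "complex set" and \<psi> a C G0 :: real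
  assumes a: "0 < a" "a < 1"
    and psi: "pi / 2 < \<psi>" "\<psi> < pi"
    and open_U: "open U"
    and strip: "\<And>z. 0 \<le> Im z \<Longrightarrow> Im z \<le> \<psi> \<Longrightarrow> z \<in> U"
    and hol: "G holomorphic_on U"
    and bounded: "\<And>z. 0 \<le> Im z \<Longrightarrow> Im z \<le> \<psi> \<Longrightarrow> cmod (G z) \<le> C"
    and decay: "\<And>z. 0 \<le> Im z \<Longrightarrow> Im z \<le> \<psi> \<Longrightarrow> cmod (G z) \<le> C * exp (- a * Re z)"
    and origin: "\<And>z. 0 \<le> Im z \<Longrightarrow> Im z \<le> \<psi> \<Longrightarrow> cmod (G z - of_real G0) \<le> C * exp (a * Re z)"
    and real_axis: "\<And>x. Im (G (of_real x)) = 0"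
begin

definition ray :: "real \<Rightarrow> complex" where
  "ray x = of_real x + \<i> * of_real \<psi>"

lemma Re_ray [simp]: "Re (ray x) = x" and Im_ray [simp]: "Im (ray x) = \<psi>"
  by (simp_all add: ray_def)

lemma exp_ray: "exp (ray x) = of_real (exp x) * cis \<psi>"
  by (simp add: ray_def exp_add cis_conv_exp exp_of_real)

lemma Re_exp_ray: "Re (exp (ray x)) = exp x * cos \<psi>" and Im_exp_ray: "Im (exp (ray x)) = exp x * sin \<psi>"
  by (simp_all add: exp_ray)

lemma norm_exp_ray: "cmod (exp (ray x)) = exp x"
  by (simp add: exp_ray norm_mult)

lemma sin_psi: "0 < sin \<psi>"
  using psi pi_half_gt_zero by (intro sin_gt_zero) linarith+

lemma cos_psi: "cos \<psi> < 0"
  using cos_monotone_0_pi[of "pi / 2" \<psi>] psi pi_half_gt_zero by simp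

lemma psi_pos: "0 < \<psi>"
  using psi pi_half_gt_zero by linarith

lemma C_nonneg: "0 \<le> C"
  using bounded[of 0] psi_pos norm_ge_zero[of "G 0"] by (simp del: norm_ge_zero)

lemma ray_strip: "ray x \<in> U"
  using psi_pos by (intro strip) auto

lemma continuous_ray [continuous_intros]: "continuous_on S ray"
  unfolding ray_def by (intro continuous_intros)

lemma ray_vector_derivative: "(ray has_vector_derivative 1) (at x within S)"
  unfolding ray_def by (auto intro!: derivative_eq_intros has_vector_derivative_real_field)

lemma continuous_G_ray: "continuous_on S (\<lambda>x. G (ray x))"
  using continuous_on_compose2[OF holomorphic_on_imp_continuous_on[OF hol] continuous_ray, of S] ray_strip
  by blast

text \<open>The distances of \<open>q\<close> from the line of the ray and of the point on the ray
  from the real axis: compare imaginary parts, in the first case after a rotation by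
  \<open>- \<psi>\<close>. The two bounds serve the two ends of the ray.\<close>

lemma ray_distance: "q * sin \<psi> \<le> cmod (of_real q - exp (ray x))" "exp x * sin \<psi> \<le> cmod (of_real q - exp (ray x))"
  for q :: real
proof -
  show "exp x * sin \<psi> \<le> cmod (of_real q - exp (ray x))"
    using abs_Im_le_cmod[of "of_real q - exp (ray x)"] sin_psi by (simp add: Im_exp_ray abs_mult)
  have "cmod (of_real q - exp (ray x)) = cmod ((of_real q - exp (ray x)) * cis (- \<psi>))"
    by (simp add: norm_mult)
  also have "(of_real q - exp (ray x)) * cis (- \<psi>) = of_real q * cis (- \<psi>) - of_real (exp x)"
    by (simp add: exp_ray left_diff_distrib mult.assoc cis_mult)
  finally show "q * sin \<psi> \<le> cmod (of_real q - exp (ray x))"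
    using abs_Im_le_cmod[of "of_real q * cis (- \<psi>) - of_real (exp x)"] by simp
qed

lemma ray_minus_nonzero: "of_real q - exp (ray x) \<noteq> 0" for q :: real
proof -
  have "0 < exp x * sin \<psi>" using sin_psi by simp
  with ray_distance(2)[of x q] show ?thesis by auto
qed

lemma ray_plus_1_nonzero: "exp (ray x) + 1 \<noteq> 0"
proof
  assume "exp (ray x) + 1 = 0"
  then have "exp (ray x) = - 1" by (simp only: eq_neg_iff_add_eq_0)
  then have "of_real (-1) - exp (ray x) = 0" by simp
  then show False using ray_minus_nonzero by blast
qed

lemma exp_ray_at_bot: "((\<lambda>x. exp (ray x)) \<longlongrightarrow> 0) at_bot"
proof -
  have "((\<lambda>x. of_real (exp x) * cis \<psi>) \<longlongrightarrow> of_real 0 * cis \<psi>) at_bot"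
    by (intro tendsto_intros exp_at_bot)
  then show ?thesis unfolding exp_ray by simp
qed

lemma exp_minus_ray_at_top: "((\<lambda>x. exp (- ray x)) \<longlongrightarrow> 0) at_top"
proof -
  have "((\<lambda>x::real. exp (- x)) \<longlongrightarrow> 0) at_top"
    by (intro filterlim_compose[OF exp_at_bot] filterlim_uminus_at_bot_at_top)
  then have "((\<lambda>x. of_real (exp (- x)) * cis (- \<psi>)) \<longlongrightarrow> of_real 0 * cis (- \<psi>)) at_top"
    by (intro tendsto_intros)
  moreover have "exp (- ray x) = of_real (exp (- x)) * cis (- \<psi>)" for x
    by (simp add: exp_minus exp_ray)
  ultimately show ?thesis by simp
qed

text \<open>In the variable \<open>s\<close> this is the logarithmic derivative of
  \<open>(s + 1) / (p - s)\<close>, with \<open>exp z\<close> coming from \<open>ds = s dz\<close>.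
  The factor \<open>(p + 1) / (s + 1)\<close> is 1 at \<open>s = p\<close>, so the singularity there
  is that of \<open>s / (p - s)\<close>, while at infinity it adds decay. Its own pole
  \<open>s = -1\<close> lies outside the strip because \<open>\<psi> < pi\<close>.\<close>

definition comparison :: "real \<Rightarrow> complex \<Rightarrow> complex" where
  "comparison p z = of_real (p + 1) * exp z / ((exp z + 1) * (of_real p - exp z))"

lemma continuous_comparison: "continuous_on S (\<lambda>x. comparison p (ray x))"
  unfolding comparison_def using ray_minus_nonzero ray_plus_1_nonzero by (intro continuous_intros) auto

lemma comparison_integrable:
  assumes p: "0 < p"
  shows "integrable lborel (\<lambda>x. comparison p (ray x))"
proof (rule integrable_two_sided_exp_bound[of 1 _ "(p + 1) / (sin \<psi>)\<^sup>2 * max 1 (1 / p)"])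
  show "(\<lambda>x. comparison p (ray x)) \<in> borel_measurable lborel"
    using continuous_comparison[of UNIV p] borel_measurable_continuous_onI by auto
  have e: "cmod (exp (ray x) + 1) = cmod (of_real (-1) - exp (ray x))" for x
  proof -
    have "exp (ray x) + 1 = - (of_real (-1) - exp (ray x))" by simp
    then show ?thesis by (simp only: norm_minus_cancel)
  qed
  have pp: "0 < cmod (exp (ray x) + 1) * cmod (of_real p - exp (ray x))" for x
    using ray_plus_1_nonzero ray_minus_nonzero by simp
  have n: "norm (comparison p (ray x)) = (p + 1) * exp x / (cmod (exp (ray x) + 1) * cmod (of_real p - exp (ray x)))" for x
    using p unfolding comparison_def norm_mult norm_divide norm_exp_ray by (simp add: norm_of_real del: of_real_add)
  have e1: "sin \<psi> \<le> cmod (exp (ray x) + 1)" for x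
  proof -
    have "cmod (exp (ray x) + 1) = cmod ((of_real (-1) - exp (ray x)) * cis (- \<psi>))" by (simp add: e norm_mult)
    also have "(of_real (-1) - exp (ray x)) * cis (- \<psi>) = - cis (- \<psi>) - of_real (exp x)"
      by (simp add: exp_ray left_diff_distrib mult.assoc cis_mult)
    finally show ?thesis using abs_Im_le_cmod[of "- cis (- \<psi>) - of_real (exp x)"] by simp
  qed
  fix x :: real
  have s: "0 < sin \<psi>" by (rule sin_psi)
  show "norm (comparison p (ray x)) \<le> (p + 1) / (sin \<psi>)\<^sup>2 * max 1 (1 / p) * exp (1 * x)"
  proof -
    have "norm (comparison p (ray x)) \<le> (p + 1) * exp x / (sin \<psi> * (p * sin \<psi>))"
      unfolding n using p s
      by (intro divide_left_mono mult_mono e1 ray_distance(1) mult_pos_pos[OF pp]) (auto intro!: mult_pos_pos)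
    also have "\<dots> = (p + 1) / (sin \<psi>)\<^sup>2 * (1 / p) * exp (1 * x)"
      using p s by (simp add: power2_eq_square field_simps)
    also have "\<dots> \<le> (p + 1) / (sin \<psi>)\<^sup>2 * max 1 (1 / p) * exp (1 * x)"
      using p s by (intro mult_right_mono mult_left_mono) auto
    finally show ?thesis .
  qed
  show "norm (comparison p (ray x)) \<le> (p + 1) / (sin \<psi>)\<^sup>2 * max 1 (1 / p) * exp (- 1 * x)"
  proof -
    have "norm (comparison p (ray x)) \<le> (p + 1) * exp x / ((exp x * sin \<psi>) * (exp x * sin \<psi>))"
      unfolding n using p s
      by (intro divide_left_mono mult_mono ray_distance(2)[of x "-1", folded e] ray_distance(2) mult_pos_pos[OF pp])
        (auto intro!: mult_pos_pos)
    also have "\<dots> = (p + 1) / (sin \<psi>)\<^sup>2 * 1 * exp (- 1 * x)"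
      using p s by (simp add: power2_eq_square field_simps exp_minus)
    also have "\<dots> \<le> (p + 1) / (sin \<psi>)\<^sup>2 * max 1 (1 / p) * exp (- 1 * x)"
      using p s by (intro mult_right_mono mult_left_mono) auto
    finally show ?thesis .
  qed
qed simp

text \<open>
  The Moebius transform \<open>s \<mapsto> (s + 1) / (p - s)\<close> maps the ray into the upper half plane, so that
  the logarithm of its rotation by \<open>-\<i>\<close> is an antiderivative that is continuous up to both ends.
\<close>

lemma comparison_integral:
  assumes p: "0 < p"
  shows "Im (\<integral>x. comparison p (ray x) \<partial>lborel) = pi"
proof -
  define m where "m z = - \<i> * ((exp z + 1) / (of_real p - exp z))" for z :: complex
  have Re_m: "0 < Re (m (ray x))" for x
  proof -
    let ?s = "exp (ray x)"
    have "Re (- \<i> * w) = Im w" for w by simp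
    then have "Re (m (ray x)) = Im ((?s + 1) / (of_real p - ?s))" unfolding m_def .
    also have "\<dots> = Im ?s * (p + 1) / (cmod (of_real p - ?s))\<^sup>2"
      by (simp add: Im_divide cmod_power2 algebra_simps)
    also have "\<dots> > 0" using p sin_psi ray_minus_nonzero[of p x] by (auto simp: Im_exp_ray)
    finally show ?thesis .
  qed
  have nonpos: "m (ray x) \<notin> \<real>\<^sub>\<le>\<^sub>0" for x
    using Re_m[of x] by (auto simp: complex_nonpos_Reals_iff)
  have d: "((\<lambda>x. Ln (m (ray x))) has_vector_derivative comparison p (ray x)) (at x)" for x
  proof -
    have "((\<lambda>z. Ln (m z)) has_field_derivative comparison p (ray x)) (at (ray x))"
    proof -
      let ?s = "exp (ray x)"
      have "(m has_field_derivative (- \<i> * ((?s * (of_real p - ?s) + (?s + 1) * ?s) / (of_real p - ?s)\<^sup>2))) (at (ray x))"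
        unfolding m_def using ray_minus_nonzero[of p x]
        by (auto intro!: derivative_eq_intros simp: power2_eq_square algebra_simps)
      from DERIV_chain2[where f = Ln and g = m, OF has_field_derivative_Ln[OF nonpos] this]
      have "((\<lambda>z. Ln (m z)) has_field_derivative inverse (m (ray x)) *
        (- \<i> * ((?s * (of_real p - ?s) + (?s + 1) * ?s) / (of_real p - ?s)\<^sup>2))) (at (ray x))" .
      moreover have "inverse (m (ray x)) *
        (- \<i> * ((?s * (of_real p - ?s) + (?s + 1) * ?s) / (of_real p - ?s)\<^sup>2)) = comparison p (ray x)"
      proof -
        have 1: "of_real p - ?s \<noteq> 0" "?s + 1 \<noteq> 0" using ray_minus_nonzero ray_plus_1_nonzero by auto
        have "inverse (m (ray x)) * (- \<i> * W) = (of_real p - ?s) / (?s + 1) * W" for W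
        proof -
          have "- \<i> * w * (\<i> * (1 / w)) = 1" if "w \<noteq> 0" for w using that by (simp add: field_simps)
          then have "inverse (m (ray x)) = \<i> * (1 / ((?s + 1) / (of_real p - ?s)))"
            using 1 unfolding m_def by (intro inverse_unique) auto
          then have "inverse (m (ray x)) = \<i> * ((of_real p - ?s) / (?s + 1))" by simp
          moreover have "\<i> * w * (- \<i> * W) = w * W" for w by (simp add: complex_eq_iff algebra_simps)
          ultimately show ?thesis by (simp only:)
        qed
        moreover have "A / B * (N / A\<^sup>2) = N / (B * A)" if "A \<noteq> 0" for A B N :: complex
          using that by (simp add: power2_eq_square)
        moreover have "?s * (of_real p - ?s) + (?s + 1) * ?s = of_real (p + 1) * ?s"
          by (simp add: algebra_simps)
        ultimately show ?thesis using 1 by (simp only: comparison_def)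
      qed
      ultimately show ?thesis by simp
    qed
    from field_vector_diff_chain_at[OF ray_vector_derivative this]
    show ?thesis by (simp add: o_def)
  qed
  have lim_bot: "((\<lambda>x. Ln (m (ray x))) \<longlongrightarrow> Ln (- \<i> * ((0 + 1) / (of_real p - 0)))) at_bot"
    unfolding m_def
    by (intro tendsto_intros exp_ray_at_bot) (use p in \<open>auto simp: complex_nonpos_Reals_iff Im_divide_of_real\<close>)
  \<comment> \<open>Dividing numerator and denominator by \<open>s\<close> exposes the limit at
    \<open>s = \<infinity>\<close>.\<close>
  have eq: "m (ray x) = - \<i> * ((1 + exp (- ray x)) / (of_real p * exp (- ray x) - 1))" for x
  proof -
    have "(1 + exp (- ray x)) / (of_real p * exp (- ray x) - 1)
      = (exp (ray x) * (1 + exp (- ray x))) / (exp (ray x) * (of_real p * exp (- ray x) - 1))" by simp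
    also have "\<dots> = (exp (ray x) + 1) / (of_real p - exp (ray x))"
      by (simp add: algebra_simps exp_minus)
    finally show ?thesis by (simp add: m_def)
  qed
  have lim_top: "((\<lambda>x. Ln (m (ray x))) \<longlongrightarrow> Ln (- \<i> * ((1 + 0) / (of_real p * 0 - 1)))) at_top"
    unfolding eq
    by (intro tendsto_intros exp_minus_ray_at_top) (auto simp: complex_nonpos_Reals_iff)
  \<comment> \<open>The end \<open>s = 0\<close> is mapped to \<open>- \<i> / p\<close> and the end
    \<open>s = \<infinity>\<close> to \<open>\<i>\<close>. Their arguments are
    \<open>- pi / 2\<close> and \<open>pi / 2\<close>, whence the value \<open>pi\<close>.\<close>
  have "(LBINT x=-\<infinity>..\<infinity>. comparison p (ray x)) = Ln \<i> - Ln (- \<i> * (1 / of_real p))"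
  proof (rule interval_integral_FTC_integrable[where F = "\<lambda>x. Ln (m (ray x))"])
    show "isCont (\<lambda>x. comparison p (ray x)) x" for x
      using continuous_comparison[of UNIV p] by (auto simp: continuous_on_eq_continuous_at)
    show "set_integrable lborel (einterval (-\<infinity>) \<infinity>) (\<lambda>x. comparison p (ray x))"
      using comparison_integrable[OF p] by (simp add: set_integrable_def)
  qed (use d lim_bot lim_top in \<open>auto simp: ereal_tendsto_simps\<close>)
  then have "(\<integral>x. comparison p (ray x) \<partial>lborel) = Ln \<i> - Ln (- \<i> * (1 / of_real p))"
    by (simp add: interval_lebesgue_integral_def set_lebesgue_integral_def)
  also have "Ln (- \<i> * (1 / of_real p)) = ln (1 / p) + Ln (- \<i>)"
    using Ln_times_of_real[of "1 / p" "- \<i>"] p Ln_of_real[of "1 / p"] by (simp add: mult.commute)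
  finally show ?thesis by simp
qed

end

section \<open>Cauchy's theorem in the strip\<close>

lemma convex_Im_strip: "convex {z. 0 \<le> Im z \<and> Im z \<le> c}"
proof -
  have "{z. 0 \<le> Im z \<and> Im z \<le> c} = {z. Im z \<ge> 0} \<inter> {z. Im z \<le> c}" by auto
  then show ?thesis by (simp add: convex_Int convex_halfspace_Im_ge convex_halfspace_Im_le)
qed

lemma convex_vertical_segment: "convex {z. Re z = x \<and> 0 \<le> Im z \<and> Im z \<le> c}"
proof -
  have "{z. Re z = x \<and> 0 \<le> Im z \<and> Im z \<le> c} = {z. Re z \<ge> x} \<inter> {z. Re z \<le> x} \<inter> {z. 0 \<le> Im z \<and> Im z \<le> c}" by auto
  then show ?thesis
    by (simp add: convex_Int convex_Im_strip convex_halfspace_Re_ge convex_halfspace_Re_le)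
qed

text \<open>This locates the zeros of the denominators in the strip: \<open>exp z = -1\<close> has
  no solution there, and \<open>exp z = p\<close> only the real one.\<close>

lemma exp_real_in_strip:
  assumes "0 \<le> Im z" "Im z < pi" "exp z = of_real r"
  shows "0 < r \<and> z = of_real (ln r)"
proof -
  have "Im (exp z) = 0" using assms by simp
  then have "sin (Im z) = 0" by (simp add: Im_exp)
  then have "Im z = 0" using assms sin_gt_zero[of "Im z"] by fastforce
  then have z: "z = of_real (Re z)" by (simp add: complex_eq_iff)
  then have "exp (of_real (Re z)) = complex_of_real r" using assms by simp
  then have "exp (Re z) = r" by (metis exp_of_real of_real_eq_iff)
  then show ?thesis using z by auto
qed

context ray_kernel
begin

lemma resolvent_integrable:
  assumes p: "0 < p"
  shows "integrable lborel (\<lambda>x. G (ray x) * exp (ray x) / (of_real p - exp (ray x)))"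
proof (rule integrable_two_sided_exp_bound[OF a(1), of _ "C / sin \<psi> * max 1 (1 / p)"])
  have "continuous_on UNIV (\<lambda>x. G (ray x) * exp (ray x) / (of_real p - exp (ray x)))"
    using ray_minus_nonzero by (intro continuous_intros continuous_G_ray) auto
  then show "(\<lambda>x. G (ray x) * exp (ray x) / (of_real p - exp (ray x))) \<in> borel_measurable lborel"
    using borel_measurable_continuous_onI by auto
  fix x :: real
  have s: "0 < sin \<psi>" by (rule sin_psi)
  have st: "0 \<le> Im (ray x)" "Im (ray x) \<le> \<psi>" using psi_pos by auto
  have pp: "0 < cmod (of_real p - exp (ray x))" using ray_minus_nonzero by simp
  have n: "norm (G (ray x) * exp (ray x) / (of_real p - exp (ray x)))
    = cmod (G (ray x)) * exp x / cmod (of_real p - exp (ray x))"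
    by (simp only: norm_mult norm_divide norm_exp_ray)
  show "norm (G (ray x) * exp (ray x) / (of_real p - exp (ray x))) \<le> C / sin \<psi> * max 1 (1 / p) * exp (a * x)"
    if "x \<le> 0"
  proof -
    \<comment> \<open>Near \<open>s = 0\<close> the integrand is \<open>O(s)\<close>. Since
      \<open>a < 1\<close> this is also \<open>O(s^a)\<close>, so one exponent \<open>a\<close>
      serves both ends.\<close>
    have "(1 - a) * x \<le> 0" using that a by (simp add: mult_nonneg_nonpos)
    then have ex: "exp x \<le> exp (a * x)" by (simp add: algebra_simps)
    have "norm (G (ray x) * exp (ray x) / (of_real p - exp (ray x))) \<le> C * exp x / (p * sin \<psi>)"
      unfolding n using p s C_nonneg pp ray_distance(1)[of p x]
      by (intro frac_le mult_mono bounded st) auto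
    also have "\<dots> = C / sin \<psi> * (1 / p) * exp x" by simp
    also have "\<dots> \<le> C / sin \<psi> * max 1 (1 / p) * exp (a * x)"
      using p s C_nonneg ex by (intro mult_mono) auto
    finally show ?thesis .
  qed
  show "norm (G (ray x) * exp (ray x) / (of_real p - exp (ray x))) \<le> C / sin \<psi> * max 1 (1 / p) * exp (- a * x)"
  proof -
    have "norm (G (ray x) * exp (ray x) / (of_real p - exp (ray x))) \<le> (C * exp (- a * x)) * exp x / (exp x * sin \<psi>)"
      unfolding n using p s C_nonneg pp ray_distance(2)[of x p] decay[OF st]
      by (intro frac_le mult_mono) auto
    also have "\<dots> = C / sin \<psi> * 1 * exp (- a * x)" by simp
    also have "\<dots> \<le> C / sin \<psi> * max 1 (1 / p) * exp (- a * x)"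
      using p s C_nonneg by (intro mult_right_mono mult_left_mono) auto
    finally show ?thesis .
  qed
qed

text \<open>
  Subtracting a multiple of the comparison function removes the pole at \<open>ln p\<close>. The difference is
  real on the real axis, so Cauchy's theorem in the strip shows that the imaginary part of its
  integral along the ray vanishes.
\<close>

lemma resolvent_integral:
  assumes p: "0 < p"
  shows "Im (\<integral>x. G (ray x) * exp (ray x) / (of_real p - exp (ray x)) \<partial>lborel) = pi * Re (G (of_real (ln p)))"
proof -
  define z0 where "z0 = complex_of_real (ln p)"
  define g0 where "g0 = Re (G z0)"
  have Gz0: "G z0 = of_real g0" using real_axis[of "ln p"] by (simp add: g0_def z0_def complex_eq_iff)
  have ez0: "exp z0 = of_real p" using p by (simp add: z0_def exp_of_real)
  define N where "N z = (G z - of_real g0 * (of_real (p + 1) / (exp z + 1))) * exp z" for z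
  define E where "E z = complex_of_real p - exp z" for z
  define S where "S = {z. 0 \<le> Im z \<and> Im z \<le> \<psi>}"
  define V where "V = U \<inter> (\<lambda>z. exp z + 1) -` (- {0})"
  have plus1: "exp z + 1 \<noteq> 0" if "z \<in> S" for z
  proof
    assume "exp z + 1 = 0"
    then have "exp z = of_real (-1)" by (simp add: eq_neg_iff_add_eq_0)
    then show False using exp_real_in_strip[of z "-1"] that psi by (simp add: S_def)
  qed
  have Enz: "E z \<noteq> 0" if "z \<in> S" "z \<noteq> z0" for z
  proof
    assume "E z = 0"
    then have "exp z = of_real p" by (simp add: E_def)
    then show False using exp_real_in_strip[of z p] that psi by (simp add: S_def z0_def)
  qed
  have "open ((\<lambda>z. exp z + 1 :: complex) -` (- {0}))"
    by (intro continuous_open_vimage continuous_intros)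
  then have V: "open V" using open_U by (simp add: V_def open_Int)
  have SV: "S \<subseteq> V" using plus1 strip by (auto simp: V_def S_def)
  have z0S: "z0 \<in> S" using psi_pos by (simp add: z0_def S_def)
  have holN: "N holomorphic_on V"
    unfolding N_def V_def by (intro holomorphic_intros holomorphic_on_subset[OF hol]) auto
  have holE: "E holomorphic_on UNIV" unfolding E_def by (intro holomorphic_intros)
  \<comment> \<open>With this normalisation \<open>N\<close> vanishes at \<open>z0\<close>, where
    \<open>E\<close> has a simple zero.\<close>
  have "complex_of_real (p + 1) / (exp z0 + 1) = 1"
    using p unfolding ez0 of_real_add of_real_1 by (metis divide_self_if of_real_1 of_real_add of_real_eq_0_iff add_pos_pos less_irrefl zero_less_one)
  then have N0: "N z0 = 0" by (simp add: N_def Gz0)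
  have E0: "E z0 = 0" by (simp add: E_def ez0)
  have dE: "deriv E z0 \<noteq> 0"
  proof -
    have "(E has_field_derivative - exp z0) (at z0)"
      unfolding E_def by (auto intro!: derivative_eq_intros)
    then show ?thesis using DERIV_imp_deriv by fastforce
  qed
  \<comment> \<open>The singularity of \<open>N / E\<close> is removed by dividing both by
    \<open>z - z0\<close>: each difference quotient, completed by the derivative at
    \<open>z0\<close>, is holomorphic, and the one of \<open>E\<close> has no zero in the
    strip.\<close>
  define D where "D z = (if z = z0 then deriv N z0 else (N z - N z0) / (z - z0)) /
     (if z = z0 then deriv E z0 else (E z - E z0) / (z - z0))" for z
  have holD: "D holomorphic_on S"
    unfolding D_def
  proof (rule holomorphic_on_divide)
    show "(\<lambda>z. if z = z0 then deriv N z0 else (N z - N z0) / (z - z0)) holomorphic_on S"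
      using pole_lemma_open[OF holN V] SV holomorphic_on_subset by blast
    show "(\<lambda>z. if z = z0 then deriv E z0 else (E z - E z0) / (z - z0)) holomorphic_on S"
      using pole_lemma_open[OF holE open_UNIV] holomorphic_on_subset by blast
    show "(if z = z0 then deriv E z0 else (E z - E z0) / (z - z0)) \<noteq> 0" if "z \<in> S" for z
      using dE Enz[OF that] E0 by auto
  qed
  have Deq: "D z = N z / E z" if "z \<noteq> z0" for z
    using that by (simp add: D_def N0 E0)
  \<comment> \<open>Cauchy's theorem enters through a primitive on the convex strip, so that no
    closed contour has to be estimated.\<close>
  obtain h where h: "\<And>z. z \<in> S \<Longrightarrow> (h has_field_derivative D z) (at z within S)"
  proof (rule holomorphic_convex_primitive[of S "{}" D])
    show "convex S" unfolding S_def by (rule convex_Im_strip)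
    show "continuous_on S D" using holD by (rule holomorphic_on_imp_continuous_on)
    show "D field_differentiable at x" if "x \<in> interior S - {}" for x
      using holomorphic_on_imp_differentiable_at[OF holomorphic_on_subset[OF holD interior_subset] open_interior] that by simp
  qed auto
  have h_along: "((\<lambda>x. h (c x)) has_vector_derivative D (c x)) (at x)"
    if c: "\<And>x. (c has_vector_derivative 1) (at x)" "range c \<subseteq> S" for c :: "real \<Rightarrow> complex" and x
  proof -
    have "(h has_field_derivative D (c x)) (at (c x) within range c)"
      using h[of "c x"] c(2) has_field_derivative_subset by blast
    from field_vector_diff_chain_within[OF c(1) this] show ?thesis by (simp add: o_def)
  qed
  have real0: "Im (D (of_real x)) = 0" if "x \<noteq> ln p" for x
  proof -
    have Gx: "G (of_real x) = of_real (Re (G (of_real x)))" using real_axis[of x] by (simp add: complex_eq_iff)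
    have "N (of_real x) = of_real ((Re (G (of_real x)) - g0 * ((p + 1) / (exp x + 1))) * exp x)"
      unfolding N_def by (subst Gx) (simp add: exp_of_real)
    moreover have "E (of_real x) = of_real (p - exp x)" by (simp add: E_def exp_of_real)
    moreover have "complex_of_real x \<noteq> z0" using that by (simp add: z0_def)
    ultimately have "D (of_real x) = of_real ((Re (G (of_real x)) - g0 * ((p + 1) / (exp x + 1))) * exp x / (p - exp x))"
      by (simp only: Deq[of "of_real x"] of_real_divide not_False_eq_True)
    then show ?thesis by (simp only: Im_complex_of_real)
  qed
  have real: "Im (D (of_real x)) = 0" for x
  proof (cases "x = ln p")
    case True
    have "continuous_on UNIV (\<lambda>x. Im (D (of_real x)))"
      by (intro continuous_on_Im continuous_on_compose2[OF holomorphic_on_imp_continuous_on[OF holD]] continuous_intros)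
        (use psi_pos in \<open>auto simp: S_def\<close>)
    then have "((\<lambda>x. Im (D (of_real x))) \<longlongrightarrow> Im (D (of_real x))) (at x)"
      by (simp add: continuous_on_def)
    moreover have "\<forall>\<^sub>F y in at x. Im (D (of_real y)) = 0"
      using True real0 by (auto simp: eventually_at intro!: exI[of _ 1])
    then have "((\<lambda>x. Im (D (of_real x))) \<longlongrightarrow> 0) (at x)" by (rule tendsto_eventually)
    ultimately show ?thesis by (rule tendsto_unique[OF at_neq_bot])
  qed (use real0 in auto)
  have const: "Im (h (of_real x)) = Im (h (of_real 0))" for x :: real
  proof (rule DERIV_isconst_all[where f = "\<lambda>x. Im (h (complex_of_real x))"])
    show "\<forall>x. ((\<lambda>x. Im (h (of_real x))) has_real_derivative 0) (at x)"
    proof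
      fix x :: real
      have "((\<lambda>x. h (of_real x)) has_vector_derivative D (of_real x)) (at x)"
      proof (rule h_along)
        show "(of_real has_vector_derivative (1 :: complex)) (at x)" for x
          by (auto intro!: derivative_eq_intros has_vector_derivative_real_field)
      qed (use psi_pos in \<open>auto simp: S_def\<close>)
      then have "((\<lambda>x. Im (h (of_real x))) has_vector_derivative Im (D (of_real x))) (at x)"
        by (rule bounded_linear.has_vector_derivative[OF bounded_linear_Im])
      then show "((\<lambda>x. Im (h (of_real x))) has_real_derivative 0) (at x)"
        by (simp add: real has_real_derivative_iff_has_vector_derivative)
    qed
  qed
  \<comment> \<open>As \<open>D\<close> is real on the real axis, \<open>Im h\<close> is constant
    there. Hence \<open>F x\<close> is the imaginary part of the increment of \<open>h\<close> along
    the vertical segment of length \<open>\<psi>\<close> at abscissa \<open>x\<close>, and it tends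
    to 0 wherever \<open>D\<close> is uniformly small on such segments.\<close>
  define F where "F x = Im (h (ray x)) - Im (h (of_real 0))" for x :: real
  have Fbound: "norm (F x) \<le> B * \<psi>" if "\<And>z. Re z = x \<Longrightarrow> z \<in> S \<Longrightarrow> cmod (D z) \<le> B" for x B
  proof -
    let ?T = "{z. Re z = x \<and> 0 \<le> Im z \<and> Im z \<le> \<psi>}"
    have "F x = Im (h (ray x) - h (of_real x))" by (simp add: F_def const)
    then have "norm (F x) \<le> norm (h (ray x) - h (of_real x))"
      using abs_Im_le_cmod[of "h (ray x) - h (of_real x)"] by simp
    also have "\<dots> \<le> B * norm (ray x - of_real x)"
    proof (rule field_differentiable_bound[OF convex_vertical_segment])
      show "(h has_field_derivative D z) (at z within ?T)" if "z \<in> ?T" for z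
        by (rule has_field_derivative_subset[OF h]) (use that in \<open>auto simp: S_def\<close>)
    qed (use that psi_pos in \<open>auto simp: S_def\<close>)
    also have "norm (ray x - of_real x) = \<psi>" using psi_pos by (simp add: ray_def norm_mult)
    finally show ?thesis .
  qed
  \<comment> \<open>\<open>M\<close> and \<open>L\<close> are lower bounds for the two denominators.
    They are both \<open>exp x / 2\<close> at the right end, and \<open>1 / 2\<close> and
    \<open>p / 2\<close> at the left end.\<close>
  have Dn: "cmod (D z) \<le> (cmod (G z) + \<bar>g0\<bar> * (p + 1) / M) * exp (Re z) / L"
    if "z \<in> S" "z \<noteq> z0" "0 < M" "M \<le> cmod (exp z + 1)" "0 < L" "L \<le> cmod (of_real p - exp z)" for z M L
  proof -
    have "cmod (D z) = cmod (G z - of_real g0 * (of_real (p + 1) / (exp z + 1))) * exp (Re z) / cmod (of_real p - exp z)"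
      using that by (simp add: Deq N_def E_def norm_mult norm_divide)
    also have "\<dots> \<le> (cmod (G z) + \<bar>g0\<bar> * (p + 1) / M) * exp (Re z) / L"
    proof (intro frac_le mult_right_mono)
      have "cmod (of_real g0 * (of_real (p + 1) / (exp z + 1))) = \<bar>g0\<bar> * (p + 1) / cmod (exp z + 1)"
        using p by (simp add: norm_mult norm_divide del: of_real_add)
      also have "\<dots> \<le> \<bar>g0\<bar> * (p + 1) / M"
        using that p by (intro frac_le) auto
      finally show "cmod (G z - of_real g0 * (of_real (p + 1) / (exp z + 1))) \<le> cmod (G z) + \<bar>g0\<bar> * (p + 1) / M"
        using norm_triangle_ineq4[of "G z" "of_real g0 * (of_real (p + 1) / (exp z + 1))"] by linarith
    qed (use that p in \<open>auto intro!: add_nonneg_nonneg\<close>)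
    finally show ?thesis .
  qed
  have F_top: "(F \<longlongrightarrow> 0) at_top"
  proof (rule Lim_null_comparison)
    let ?B = "\<lambda>x. (C * exp (- a * x) + \<bar>g0\<bar> * (p + 1) * 2 * exp (- x)) * 2"
    have "eventually (\<lambda>x. max (2 * p) 2 \<le> exp x) at_top"
      using filterlim_at_top[of "exp :: real \<Rightarrow> real" at_top] exp_at_top by blast
    then show "\<forall>\<^sub>F x in at_top. norm (F x) \<le> ?B x * \<psi>"
    proof eventually_elim
      case (elim x)
      show ?case
      proof (rule Fbound)
        fix z assume z: "Re z = x" "z \<in> S"
        have nz: "cmod (exp z) = exp x" using z by simp
        have 1: "exp x / 2 \<le> cmod (exp z + 1)"
          using norm_diff_ineq[of "exp z" 1] elim nz by simp
        have 2: "exp x / 2 \<le> cmod (of_real p - exp z)"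
          using norm_triangle_ineq2[of "exp z" "of_real p"] elim nz p by (simp add: norm_minus_commute)
        have "z \<noteq> z0" using 2 ez0 by auto
        from Dn[OF z(2) this _ 1 _ 2]
        have "cmod (D z) \<le> (cmod (G z) + \<bar>g0\<bar> * (p + 1) / (exp x / 2)) * exp x / (exp x / 2)"
          using z by simp
        also have "\<dots> = (cmod (G z) + \<bar>g0\<bar> * (p + 1) * 2 * exp (- x)) * 2"
          by (simp add: exp_minus field_simps)
        also have "\<dots> \<le> ?B x"
          using decay[of z] z by (simp add: S_def)
        finally show "cmod (D z) \<le> ?B x" .
      qed
    qed
    have l: "filterlim (\<lambda>x. - a * x) at_bot at_top"
      using a by (intro filterlim_tendsto_neg_mult_at_bot[OF tendsto_const _ filterlim_ident]) auto
    have "((\<lambda>x. ?B x * \<psi>) \<longlongrightarrow> (C * 0 + \<bar>g0\<bar> * (p + 1) * 2 * 0) * 2 * \<psi>) at_top"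
      by (intro tendsto_intros filterlim_compose[OF exp_at_bot l] filterlim_compose[OF exp_at_bot filterlim_uminus_at_bot_at_top])
    then show "((\<lambda>x. ?B x * \<psi>) \<longlongrightarrow> 0) at_top" by simp
  qed
  have F_bot: "(F \<longlongrightarrow> 0) at_bot"
  proof (rule Lim_null_comparison)
    let ?B = "\<lambda>x. (C + \<bar>g0\<bar> * (p + 1) * 2) * exp x / (p / 2)"
    have "eventually (\<lambda>x. exp x < min (p / 2) (1 / 2)) at_bot"
      using p by (intro order_tendstoD(2)[OF exp_at_bot]) auto
    then show "\<forall>\<^sub>F x in at_bot. norm (F x) \<le> ?B x * \<psi>"
    proof eventually_elim
      case (elim x)
      show ?case
      proof (rule Fbound)
        fix z assume z: "Re z = x" "z \<in> S"
        have nz: "cmod (exp z) = exp x" using z by simp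
        have 1: "1 / 2 \<le> cmod (exp z + 1)"
          using norm_diff_ineq[of 1 "exp z"] elim nz by (simp add: add.commute)
        have 2: "p / 2 \<le> cmod (of_real p - exp z)"
          using norm_triangle_ineq2[of "of_real p" "exp z"] elim nz p by simp
        have "z \<noteq> z0" using 2 ez0 p by auto
        from Dn[OF z(2) this _ 1 _ 2]
        have "cmod (D z) \<le> (cmod (G z) + \<bar>g0\<bar> * (p + 1) / (1 / 2)) * exp x / (p / 2)"
          using z p by simp
        also have "\<dots> \<le> ?B x"
          using bounded[of z] z p by (intro divide_right_mono mult_right_mono) (auto simp: S_def)
        finally show "cmod (D z) \<le> ?B x" .
      qed
    qed
    have "((\<lambda>x. ?B x * \<psi>) \<longlongrightarrow> (C + \<bar>g0\<bar> * (p + 1) * 2) * 0 / (p / 2) * \<psi>) at_bot"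
      using p by (intro tendsto_intros exp_at_bot) auto
    then show "((\<lambda>x. ?B x * \<psi>) \<longlongrightarrow> 0) at_bot" by simp
  qed
  have D_ray: "D (ray x) = G (ray x) * exp (ray x) / (of_real p - exp (ray x)) - of_real g0 * comparison p (ray x)" for x
  proof -
    have "ray x \<noteq> z0"
    proof
      assume "ray x = z0"
      then have "Im (ray x) = Im z0" by simp
      then show False using psi_pos by (simp add: z0_def)
    qed
    then have "D (ray x) = N (ray x) / E (ray x)" by (rule Deq)
    then show ?thesis
      by (simp add: N_def E_def comparison_def left_diff_distrib diff_divide_distrib)
  qed
  have D_int: "integrable lborel (\<lambda>x. D (ray x))"
    unfolding D_ray
    by (intro Bochner_Integration.integrable_diff integrable_mult_right resolvent_integrable comparison_integrable p)
  have "(LBINT x=-\<infinity>..\<infinity>. Im (D (ray x))) = 0 - 0"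
  proof (rule interval_integral_FTC_integrable[where F = F])
    show "(F has_vector_derivative Im (D (ray x))) (at x)" for x
    proof -
      have "((\<lambda>x. h (ray x)) has_vector_derivative D (ray x)) (at x)"
        by (rule h_along[OF ray_vector_derivative]) (use psi_pos in \<open>auto simp: S_def\<close>)
      then have "((\<lambda>x. Im (h (ray x))) has_vector_derivative Im (D (ray x))) (at x)"
        by (rule bounded_linear.has_vector_derivative[OF bounded_linear_Im])
      from has_vector_derivative_diff[OF this has_vector_derivative_const[of "Im (h (of_real 0))"]]
      show ?thesis unfolding F_def by simp
    qed
    have "continuous_on UNIV (\<lambda>x. Im (D (ray x)))"
      by (intro continuous_on_Im continuous_on_compose2[OF holomorphic_on_imp_continuous_on[OF holD] continuous_ray])
        (use psi_pos in \<open>auto simp: S_def\<close>)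
    then show "isCont (\<lambda>x. Im (D (ray x))) x" for x by (auto simp: continuous_on_eq_continuous_at)
    show "set_integrable lborel (einterval (- \<infinity>) \<infinity>) (\<lambda>x. Im (D (ray x)))"
      using D_int by (simp add: set_integrable_def)
  qed (use F_top F_bot in \<open>auto simp: ereal_tendsto_simps\<close>)
  then have "Im (\<integral>x. D (ray x) \<partial>lborel) = 0"
    using D_int by (simp add: interval_lebesgue_integral_def set_lebesgue_integral_def)
  moreover have "(\<integral>x. D (ray x) \<partial>lborel) = (\<integral>x. G (ray x) * exp (ray x) / (of_real p - exp (ray x)) \<partial>lborel)
      - of_real g0 * (\<integral>x. comparison p (ray x) \<partial>lborel)"
    unfolding D_ray
    by (simp add: Bochner_Integration.integral_diff resolvent_integrable comparison_integrable p)
  ultimately show ?thesis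
    using comparison_integral[OF p] by (simp add: g0_def z0_def mult.commute)
qed

end

section \<open>The kernel, its bounds at 0 and at infinity, and its Laplace transform\<close>

lemma has_bochner_integral_exp_decay:
  assumes w: "0 < Re w"
  shows "has_bochner_integral lborel (\<lambda>t. indicator {0<..} t *\<^sub>R exp (- (w * of_real t))) (1 / w)"
proof -
  have w0: "w \<noteq> 0" using w by auto
  have "integrable lborel (\<lambda>t. indicator {0<..} t * (t powr (1 - 1) * exp (- Re w * t)))"
    using has_bochner_integral_Gamma_scaled[of 1 "Re w"] w by (auto simp: has_bochner_integral_iff)
  then have int: "integrable lborel (\<lambda>t. indicator {0<..} t *\<^sub>R exp (- (w * of_real t)))"
    by (rule Bochner_Integration.integrable_bound) (auto simp: indicator_def intro!: borel_measurable_scaleR)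
  have e: "einterval 0 \<infinity> = {0<..}" by (auto simp: einterval_def zero_ereal_def)
  have "(LBINT t=0..\<infinity>. exp (- (w * of_real t))) = 0 - (- 1 / w)"
  proof (rule interval_integral_FTC_integrable[where F = "\<lambda>t. - exp (- (w * of_real t)) / w"])
    show "((\<lambda>t. - exp (- (w * of_real t)) / w) has_vector_derivative exp (- (w * of_real x))) (at x)" for x :: real
    proof -
      have "((\<lambda>t. - exp (- (w * t)) / w) has_field_derivative exp (- (w * of_real x))) (at (of_real x))"
        using w0 by (auto intro!: derivative_eq_intros)
      from has_vector_derivative_real_field[OF this] show ?thesis .
    qed
    show "set_integrable lborel (einterval 0 \<infinity>) (\<lambda>t. exp (- (w * of_real t)))"
      using int by (simp add: set_integrable_def e)
    have "((\<lambda>t. - exp (- (w * of_real t)) / w) \<longlongrightarrow> - 1 / w) (at_right (0 :: real))"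
      by (auto intro!: tendsto_eq_intros simp: w0)
    then show "(((\<lambda>t. - exp (- (w * of_real t)) / w) \<circ> real_of_ereal) \<longlongrightarrow> - 1 / w) (at_right 0)"
      by (simp add: ereal_tendsto_simps zero_ereal_def)
    have "((\<lambda>t. - exp (- (w * of_real t)) / w) \<longlongrightarrow> 0) at_top"
    proof (rule Lim_null_comparison)
      show "\<forall>\<^sub>F t in at_top. norm (- exp (- (w * of_real t)) / w) \<le> exp (- Re w * t) / norm w"
        by (simp add: norm_divide)
      have "filterlim (\<lambda>t. - Re w * t) at_bot at_top"
        using w by (intro filterlim_tendsto_neg_mult_at_bot[OF tendsto_const _ filterlim_ident]) auto
      then have "((\<lambda>t. exp (- Re w * t)) \<longlongrightarrow> 0) at_top" by (rule filterlim_compose[OF exp_at_bot])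
      then have "((\<lambda>t. exp (- Re w * t) / norm w) \<longlongrightarrow> 0 / norm w) at_top"
        using w0 by (intro tendsto_intros) auto
      then show "((\<lambda>t. exp (- Re w * t) / norm w) \<longlongrightarrow> 0) at_top" by simp
    qed
    then show "(((\<lambda>t. - exp (- (w * of_real t)) / w) \<circ> real_of_ereal) \<longlongrightarrow> 0) (at_left \<infinity>)"
      by (simp add: ereal_tendsto_simps)
  qed (auto intro!: continuous_intros)
  then show ?thesis
    using int by (simp add: has_bochner_integral_iff interval_lebesgue_integral_def set_lebesgue_integral_def e)
qed

context ray_kernel
begin

definition integrand :: "real \<Rightarrow> real \<Rightarrow> complex" where
  "integrand t x = exp (of_real t * exp (ray x)) * G (ray x) * exp (ray x)"

text \<open>The inverse Laplace integral over the contour that comes in along the conjugate ray and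
  goes out along the ray. The incoming part is minus the conjugate of the outgoing one, so
  \<open>1 / (2 * pi * \<i>)\<close> times the sum is \<open>1 / pi\<close> times an imaginary
  part.\<close>

definition kernel :: "real \<Rightarrow> real" where
  "kernel t = 1 / pi * Im (\<integral>x. integrand t x \<partial>lborel)"

text \<open>For \<open>\<beta> > 0\<close> this is
  \<open>Gamma \<beta> / (- cos \<psi>) powr \<beta>\<close>; the integral form is all that the
  estimates use.\<close>

definition moment :: "real \<Rightarrow> real" where
  "moment \<beta> = (\<integral>x. exp (\<beta> * x - (- cos \<psi>) * exp x) \<partial>lborel)"

lemma measurable_ray [measurable]: "ray \<in> borel_measurable borel"
  using continuous_ray[of UNIV] by (rule borel_measurable_continuous_onI)

lemma measurable_G_ray [measurable]: "(\<lambda>x. G (ray x)) \<in> borel_measurable borel"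
  using continuous_G_ray[of UNIV] by (rule borel_measurable_continuous_onI)

lemma measurable_integrand [measurable]: "case_prod integrand \<in> borel_measurable (borel \<Otimes>\<^sub>M borel)"
  unfolding integrand_def case_prod_beta by measurable

lemma measurable_kernel [measurable]: "kernel \<in> borel_measurable borel"
  unfolding kernel_def integrand_def by measurable

lemma norm_exp_t_ray: "norm (exp (of_real t * exp (ray x))) = exp (- ((- cos \<psi>) * t * exp x))"
  by (simp add: Re_exp_ray mult.commute mult.left_commute)

lemma norm_exp_t_ray_mult:
  "norm (exp (of_real t * exp (ray x)) * w * exp (ray x)) = norm w * exp (1 * x - (- cos \<psi>) * t * exp x)"
  unfolding norm_mult norm_exp_ray norm_exp_t_ray by (simp add: exp_add mult_ac)

lemma moment_pos: "0 \<le> moment \<beta>"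
  unfolding moment_def by (intro integral_nonneg_AE) auto

text \<open>On the ray \<open>\<bar>exp (t * s)\<bar> = exp (cos \<psi> * t * exp x)\<close> with
  \<open>cos \<psi> < 0\<close>, so scaling turns a weight \<open>O(s^\<beta>)\<close> into a power
  of \<open>t\<close>. It is applied with \<open>\<beta> = - a\<close> to \<open>G\<close> and with
  \<open>\<beta> = a\<close> to \<open>G - G0\<close>.\<close>

lemma integrand_bound:
  assumes w: "\<And>x. norm (w x) \<le> C * exp (\<beta> * x)" and b: "- 1 < \<beta>" and t: "0 < t"
    and meas: "w \<in> borel_measurable borel"
  shows "integrable lborel (\<lambda>x. exp (of_real t * exp (ray x)) * w x * exp (ray x))"
    and "(\<integral>x. norm (exp (of_real t * exp (ray x)) * w x * exp (ray x)) \<partial>lborel) \<le> C * moment (1 + \<beta>) * t powr (- 1 - \<beta>)"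
    and "norm (\<integral>x. exp (of_real t * exp (ray x)) * w x * exp (ray x) \<partial>lborel) \<le> C * moment (1 + \<beta>) * t powr (- 1 - \<beta>)"
proof -
  have b: "0 < 1 + \<beta>" using b by simp
  have c: "0 < - cos \<psi>" using cos_psi by simp
  note sc = exp_minus_exp_scaling[OF b c t]
  have le: "norm (exp (of_real t * exp (ray x)) * w x * exp (ray x)) \<le> C * exp ((1 + \<beta>) * x - (- cos \<psi>) * t * exp x)" for x
  proof -
    have "norm (exp (of_real t * exp (ray x)) * w x * exp (ray x)) \<le> (C * exp (\<beta> * x)) * exp (1 * x - (- cos \<psi>) * t * exp x)"
      unfolding norm_exp_t_ray_mult by (intro mult_right_mono w) auto
    also have "\<dots> = C * exp ((1 + \<beta>) * x - (- cos \<psi>) * t * exp x)"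
      by (simp add: exp_add[symmetric] algebra_simps)
    finally show ?thesis .
  qed
  have int: "integrable lborel (\<lambda>x. C * exp ((1 + \<beta>) * x - (- cos \<psi>) * t * exp x))"
    by (intro integrable_mult_right sc(1))
  show i: "integrable lborel (\<lambda>x. exp (of_real t * exp (ray x)) * w x * exp (ray x))"
  proof (rule Bochner_Integration.integrable_bound[OF int])
    show "(\<lambda>x. exp (of_real t * exp (ray x)) * w x * exp (ray x)) \<in> borel_measurable lborel"
      using meas by measurable
    show "AE x in lborel. norm (exp (of_real t * exp (ray x)) * w x * exp (ray x)) \<le> norm (C * exp ((1 + \<beta>) * x - (- cos \<psi>) * t * exp x))"
      using order_trans[OF le abs_ge_self] by (intro AE_I2) simp
  qed
  have "(\<integral>x. norm (exp (of_real t * exp (ray x)) * w x * exp (ray x)) \<partial>lborel) \<le> (\<integral>x. C * exp ((1 + \<beta>) * x - (- cos \<psi>) * t * exp x) \<partial>lborel)"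
    using i by (intro integral_mono int le) auto
  also have "\<dots> = C * moment (1 + \<beta>) * t powr (- 1 - \<beta>)"
  proof -
    have "- (1 + \<beta>) = - 1 - \<beta>" by simp
    then show ?thesis using sc(2) by (simp add: moment_def)
  qed
  finally show *: "(\<integral>x. norm (exp (of_real t * exp (ray x)) * w x * exp (ray x)) \<partial>lborel) \<le> C * moment (1 + \<beta>) * t powr (- 1 - \<beta>)" .
  show "norm (\<integral>x. exp (of_real t * exp (ray x)) * w x * exp (ray x) \<partial>lborel) \<le> C * moment (1 + \<beta>) * t powr (- 1 - \<beta>)"
    using integral_norm_bound[of lborel "\<lambda>x. exp (of_real t * exp (ray x)) * w x * exp (ray x)"] * by linarith
qed

lemma Im_strip_ray: "0 \<le> Im (ray x)" "Im (ray x) \<le> \<psi>"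
  using psi_pos by auto

lemma norm_G_ray: "norm (G (ray x)) \<le> C * exp (- a * x)"
  using decay[OF Im_strip_ray] by simp

lemma integrand_integrable:
  assumes "0 < t"
  shows "integrable lborel (integrand t)"
  unfolding integrand_def using integrand_bound(1)[OF norm_G_ray _ assms measurable_G_ray] a by simp

lemma kernel_bound_0:
  assumes t: "0 < t"
  shows "\<bar>kernel t\<bar> \<le> C / pi * moment (1 - a) * t powr (a - 1)"
proof -
  have "\<bar>kernel t\<bar> \<le> 1 / pi * norm (\<integral>x. integrand t x \<partial>lborel)"
    unfolding kernel_def abs_mult by (simp add: abs_Im_le_cmod divide_right_mono)
  also have "\<dots> \<le> 1 / pi * (C * moment (1 - a) * t powr (a - 1))"
    using integrand_bound(3)[OF norm_G_ray _ t measurable_G_ray] a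
    unfolding integrand_def by (intro mult_left_mono) auto
  finally show ?thesis by simp
qed

text \<open>
  This integral is real, so subtracting the constant \<open>G0\<close> from \<open>G\<close> does not change the kernel;
  since \<open>G - G0\<close> is small near \<open>s = 0\<close>, this gives the decay at infinity.
\<close>

lemma integral_exp_t_ray:
  assumes t: "0 < t"
  shows "(\<integral>x. exp (of_real t * exp (ray x)) * 1 * exp (ray x) \<partial>lborel) = - 1 / of_real t"
proof -
  let ?F = "\<lambda>x. exp (of_real t * exp (ray x)) / of_real t"
  have d: "(?F has_vector_derivative exp (of_real t * exp (ray x)) * exp (ray x)) (at x)" for x
  proof -
    have "((\<lambda>z. exp (of_real t * exp z) / of_real t) has_field_derivative exp (of_real t * exp (ray x)) * exp (ray x)) (at (ray x))"
      using t by (auto intro!: derivative_eq_intros)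
    from field_vector_diff_chain_at[OF ray_vector_derivative this] show ?thesis by (simp add: o_def)
  qed
  have "((\<lambda>x. ?F x) \<longlongrightarrow> exp (of_real t * 0) / of_real t) at_bot"
    using t by (intro tendsto_intros exp_ray_at_bot) auto
  moreover have "(?F \<longlongrightarrow> 0) at_top"
  proof (rule Lim_null_comparison)
    show "\<forall>\<^sub>F x in at_top. norm (?F x) \<le> exp ((cos \<psi> * t) * exp x) / t"
      using t by (simp add: norm_divide Re_exp_ray mult.commute mult.left_commute)
    have "filterlim (\<lambda>x. (cos \<psi> * t) * exp x) at_bot at_top"
      using t cos_psi by (intro filterlim_tendsto_neg_mult_at_bot[OF tendsto_const _ exp_at_top]) (auto simp: mult_neg_pos)
    then have "((\<lambda>x. exp ((cos \<psi> * t) * exp x)) \<longlongrightarrow> 0) at_top" by (rule filterlim_compose[OF exp_at_bot])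
    then have "((\<lambda>x. exp ((cos \<psi> * t) * exp x) / t) \<longlongrightarrow> 0 / t) at_top"
      using t by (intro tendsto_intros) auto
    then show "((\<lambda>x. exp ((cos \<psi> * t) * exp x) / t) \<longlongrightarrow> 0) at_top" by simp
  qed
  moreover have "integrable lborel (\<lambda>x. exp (of_real t * exp (ray x)) * exp (ray x))"
  proof (rule Bochner_Integration.integrable_bound[OF exp_minus_exp_scaling(1)[of 1 "- cos \<psi>" t]])
    show "AE x in lborel. norm (exp (of_real t * exp (ray x)) * exp (ray x)) \<le> norm (exp (1 * x - - cos \<psi> * t * exp x))"
      using norm_exp_t_ray_mult[of t _ 1] by (intro AE_I2) (simp only: norm_one mult_1 mult_1_right real_norm_def abs_exp_cancel order_refl)
  qed (use t cos_psi in auto)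
  moreover have "continuous_on UNIV (\<lambda>x. exp (of_real t * exp (ray x)) * exp (ray x))"
    by (intro continuous_intros)
  ultimately have "(LBINT x=-\<infinity>..\<infinity>. exp (of_real t * exp (ray x)) * exp (ray x)) = 0 - 1 / of_real t"
    by (intro interval_integral_FTC_integrable[where F = ?F])
      (use d in \<open>auto simp: ereal_tendsto_simps set_integrable_def continuous_on_eq_continuous_at\<close>)
  then show ?thesis by (simp add: interval_lebesgue_integral_def set_lebesgue_integral_def)
qed

lemma kernel_bound_infinity:
  assumes t: "0 < t"
  shows "\<bar>kernel t\<bar> \<le> C / pi * moment (1 + a) * t powr (- 1 - a)"
proof -
  let ?w = "\<lambda>x. G (ray x) - of_real G0"
  have w: "norm (?w x) \<le> C * exp (a * x)" for x
    using origin[OF Im_strip_ray] by simp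
  have meas: "?w \<in> borel_measurable borel" by measurable
  note b = integrand_bound[OF w _ t meas]
  let ?I = "\<integral>x. exp (of_real t * exp (ray x)) * ?w x * exp (ray x) \<partial>lborel"
  have i: "integrable lborel (\<lambda>x. exp (of_real t * exp (ray x)) * ?w x * exp (ray x))" using b(1) a by simp
  have "?I = (\<integral>x. integrand t x \<partial>lborel) - of_real G0 * (\<integral>x. exp (of_real t * exp (ray x)) * 1 * exp (ray x) \<partial>lborel)"
  proof -
    have "integrable lborel (\<lambda>x. integrand t x - exp (of_real t * exp (ray x)) * ?w x * exp (ray x))"
      by (intro Bochner_Integration.integrable_diff i integrand_integrable t)
    moreover have "integrand t x - exp (of_real t * exp (ray x)) * ?w x * exp (ray x)
      = of_real G0 * (exp (of_real t * exp (ray x)) * 1 * exp (ray x))" for x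
      by (simp add: integrand_def algebra_simps)
    ultimately have j: "integrable lborel (\<lambda>x. of_real G0 * (exp (of_real t * exp (ray x)) * 1 * exp (ray x)))" by simp
    have "?I = (\<integral>x. integrand t x - of_real G0 * (exp (of_real t * exp (ray x)) * 1 * exp (ray x)) \<partial>lborel)"
      by (simp add: integrand_def algebra_simps)
    also have "\<dots> = (\<integral>x. integrand t x \<partial>lborel) - (\<integral>x. of_real G0 * (exp (of_real t * exp (ray x)) * 1 * exp (ray x)) \<partial>lborel)"
      by (rule Bochner_Integration.integral_diff[OF integrand_integrable[OF t] j])
    finally show ?thesis by (simp only: integral_mult_right_zero)
  qed
  then have "Im ?I = Im (\<integral>x. integrand t x \<partial>lborel)"
    unfolding integral_exp_t_ray[OF t] using Im_complex_of_real[of "G0 * (- 1 / t)"] by (simp del: Im_complex_of_real)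
  then have "\<bar>kernel t\<bar> \<le> 1 / pi * norm ?I"
    unfolding kernel_def abs_mult using abs_Im_le_cmod[of ?I] by (simp add: divide_right_mono)
  also have "\<dots> \<le> 1 / pi * (C * moment (1 + a) * t powr (- 1 - a))"
    using b(3) a by (intro mult_left_mono) auto
  finally show ?thesis by simp
qed

lemma kernel_integrable: "set_integrable lborel {0<..} kernel"
proof -
  let ?c1 = "C / pi * moment (1 - a)" and ?c2 = "C / pi * moment (1 + a)"
  have c: "0 \<le> ?c1" "0 \<le> ?c2" "0 \<le> C / pi" "\<And>\<beta>. 0 \<le> moment \<beta>" using C_nonneg moment_pos by auto
  have g1: "integrable lborel (\<lambda>t. indicator {0<..} t * (t powr (a - 1) * exp (- 1 * t)))"
    using has_bochner_integral_Gamma_scaled[of a 1] a by (auto simp: has_bochner_integral_iff)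
  have g2: "integrable lborel (\<lambda>t. indicator {1<..} t * t powr (- 1 - a))"
    using set_integrable_powr_tail(1)[of a 1] a by (simp add: set_integrable_def)
  \<comment> \<open>On \<open>{0<..1}\<close> the factor \<open>exp 1 * exp (- t)\<close> is at
    least 1, so the integrable Gamma density dominates \<open>t powr (a - 1)\<close> there. The
    power tail takes over beyond 1.\<close>
  have "integrable lborel (\<lambda>t. ?c1 * exp 1 * (indicator {0<..} t * (t powr (a - 1) * exp (- 1 * t)))
      + ?c2 * (indicator {1<..} t * t powr (- 1 - a)))"
    by (intro Bochner_Integration.integrable_add integrable_mult_right g1 g2)
  then show ?thesis
    unfolding set_integrable_def
  proof (rule Bochner_Integration.integrable_bound)
    show "(\<lambda>t. indicator {0<..} t *\<^sub>R kernel t) \<in> borel_measurable lborel" by measurable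
    show "AE t in lborel. norm (indicator {0<..} t *\<^sub>R kernel t) \<le> norm (?c1 * exp 1 * (indicator {0<..} t * (t powr (a - 1) * exp (- 1 * t)))
      + ?c2 * (indicator {1<..} t * t powr (- 1 - a)))"
    proof (intro AE_I2)
      fix t :: real
      have "norm (indicator {0<..} t *\<^sub>R kernel t) \<le> ?c1 * exp 1 * (indicator {0<..} t * (t powr (a - 1) * exp (- 1 * t)))
        + ?c2 * (indicator {1<..} t * t powr (- 1 - a))"
      proof (cases "0 < t")
        case True
        show ?thesis
        proof (cases "1 < t")
          case True
          have "0 \<le> ?c1 * exp 1 * (t powr (a - 1) * exp (- 1 * t))" using c by (intro mult_nonneg_nonneg) auto
          then show ?thesis using kernel_bound_infinity[of t] True by simp
        next
          case False
          have "?c1 * t powr (a - 1) * 1 \<le> ?c1 * t powr (a - 1) * exp (1 + (- 1 * t))"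
            using c False by (intro mult_left_mono mult_nonneg_nonneg) auto
          also have "\<dots> = ?c1 * exp 1 * (t powr (a - 1) * exp (- 1 * t))" by (simp only: exp_add mult_ac)
          finally show ?thesis using kernel_bound_0[of t] True False by simp
        qed
      qed simp
      then show "norm (indicator {0<..} t *\<^sub>R kernel t) \<le> norm (?c1 * exp 1 * (indicator {0<..} t * (t powr (a - 1) * exp (- 1 * t)))
        + ?c2 * (indicator {1<..} t * t powr (- 1 - a)))" by simp
    qed
  qed
qed

text \<open>Fubini lets the integral over \<open>t\<close> come first. It equals
  \<open>1 / (p - s)\<close>, because \<open>Re s < 0 < p\<close> on the ray, and the remaining
  integral along the ray is \<open>resolvent_integral\<close>. The bound
  \<open>t powr (a - 1)\<close> makes the double integral absolutely convergent.\<close>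

lemma kernel_Laplace:
  assumes p: "0 < p"
  shows "(LINT t:{0<..}|lborel. exp (- p * t) * kernel t) = Re (G (of_real (ln p)))"
proof -
  define H where "H = (\<lambda>t x. indicator {0<..} t *\<^sub>R (exp (- (of_real p * of_real t)) * integrand t x))"
  have meas [measurable]: "case_prod H \<in> borel_measurable (lborel \<Otimes>\<^sub>M lborel)"
    unfolding H_def integrand_def case_prod_beta by measurable
  have nH: "norm (H t x) = indicator {0<..} t * exp (- p * t) * norm (integrand t x)" for t x
    by (simp add: H_def norm_mult)
  have HI: "integrable (lborel \<Otimes>\<^sub>M lborel) (case_prod H)"
  proof (rule lborel_pair.Fubini_integrable[OF meas])
    have "integrable lborel (\<lambda>t. C * moment (1 - a) * (indicator {0<..} t * (t powr (a - 1) * exp (- p * t))))"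
      using has_bochner_integral_Gamma_scaled[of a p] a p by (auto simp: has_bochner_integral_iff)
    then show "integrable lborel (\<lambda>t. \<integral>x. norm (case_prod H (t, x)) \<partial>lborel)"
    proof (rule Bochner_Integration.integrable_bound)
      show "(\<lambda>t. \<integral>x. norm (case_prod H (t, x)) \<partial>lborel) \<in> borel_measurable lborel" by measurable
      show "AE t in lborel. norm (\<integral>x. norm (case_prod H (t, x)) \<partial>lborel)
        \<le> norm (C * moment (1 - a) * (indicator {0<..} t * (t powr (a - 1) * exp (- p * t))))"
      proof (intro AE_I2)
        fix t :: real
        show "norm (\<integral>x. norm (case_prod H (t, x)) \<partial>lborel)
          \<le> norm (C * moment (1 - a) * (indicator {0<..} t * (t powr (a - 1) * exp (- p * t))))"
        proof (cases "0 < t")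
          case True
          have "(\<integral>x. norm (case_prod H (t, x)) \<partial>lborel) = exp (- p * t) * (\<integral>x. norm (integrand t x) \<partial>lborel)"
            using True by (simp add: nH)
          also have "\<dots> \<le> exp (- p * t) * (C * moment (1 - a) * t powr (a - 1))"
            using integrand_bound(2)[OF norm_G_ray _ True measurable_G_ray] a
            unfolding integrand_def by (intro mult_left_mono) auto
          finally have "(\<integral>x. norm (case_prod H (t, x)) \<partial>lborel) \<le> C * moment (1 - a) * (indicator {0<..} t * (t powr (a - 1) * exp (- p * t)))"
            using True by (simp add: mult_ac)
          moreover have "0 \<le> (\<integral>x. norm (case_prod H (t, x)) \<partial>lborel)" by (intro integral_nonneg_AE) auto
          ultimately show ?thesis by simp
        qed (simp add: nH)
      qed
    qed
    show "AE t in lborel. integrable lborel (\<lambda>x. case_prod H (t, x))"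
    proof (intro AE_I2)
      fix t :: real
      show "integrable lborel (\<lambda>x. case_prod H (t, x))"
        using integrand_integrable[of t] by (cases "0 < t") (auto simp: H_def)
    qed
  qed
  have inner: "(\<integral>t. H t x \<partial>lborel) = G (ray x) * exp (ray x) / (of_real p - exp (ray x))" for x
  proof -
    have "0 < Re (of_real p - exp (ray x))"
      using p cos_psi by (simp add: Re_exp_ray) (smt (verit) exp_gt_zero mult_pos_neg)
    from has_bochner_integral_mult_left[OF has_bochner_integral_exp_decay[OF this], of "G (ray x) * exp (ray x)"]
    have "(\<integral>t. indicator {0<..} t *\<^sub>R exp (- ((of_real p - exp (ray x)) * of_real t)) * (G (ray x) * exp (ray x)) \<partial>lborel)
      = 1 / (of_real p - exp (ray x)) * (G (ray x) * exp (ray x))"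
      by (simp add: has_bochner_integral_iff)
    moreover have "indicator {0<..} t *\<^sub>R exp (- ((of_real p - exp (ray x)) * of_real t)) * (G (ray x) * exp (ray x)) = H t x" for t
    proof -
      have "exp (- ((of_real p - exp (ray x)) * of_real t)) = exp (- (of_real p * of_real t)) * exp (of_real t * exp (ray x))"
        by (simp add: exp_add[symmetric] algebra_simps)
      then show ?thesis by (simp add: H_def integrand_def mult_ac)
    qed
    ultimately show ?thesis by simp
  qed
  have "(LINT t:{0<..}|lborel. exp (- p * t) * kernel t) = (\<integral>t. 1 / pi * Im (\<integral>x. H t x \<partial>lborel) \<partial>lborel)"
    unfolding set_lebesgue_integral_def
  proof (intro Bochner_Integration.integral_cong refl)
    fix t :: real
    have "(\<integral>x. H t x \<partial>lborel) = of_real (indicator {0<..} t * exp (- p * t)) * (\<integral>x. integrand t x \<partial>lborel)"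
    proof -
      have "H t x = of_real (indicator {0<..} t * exp (- p * t)) * integrand t x" for x
        by (simp add: H_def scaleR_conv_of_real exp_of_real[symmetric])
      then show ?thesis by (simp only: integral_mult_right_zero)
    qed
    then show "indicator {0<..} t *\<^sub>R (exp (- p * t) * kernel t) = 1 / pi * Im (\<integral>x. H t x \<partial>lborel)"
      by (simp add: kernel_def mult.assoc)
  qed
  also have "\<dots> = 1 / pi * Im (\<integral>t. (\<integral>x. H t x \<partial>lborel) \<partial>lborel)"
    using lborel_pair.integrable_fst[OF HI] by simp
  also have "(\<integral>t. (\<integral>x. H t x \<partial>lborel) \<partial>lborel) = (\<integral>x. (\<integral>t. H t x \<partial>lborel) \<partial>lborel)"
    by (rule lborel_pair.Fubini_integral[OF HI, symmetric])
  also have "1 / pi * Im \<dots> = Re (G (of_real (ln p)))"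
    unfolding inner resolvent_integral[OF p] by simp
  finally show ?thesis .
qed

text \<open>Let \<open>p\<close> tend to 0 in \<open>kernel_Laplace\<close>: dominated convergence
  on the left, the expansion of \<open>G\<close> at the origin on the right.\<close>

lemma kernel_total: "(LINT t:{0<..}|lborel. kernel t) = G0"
proof (rule LIMSEQ_unique)
  let ?p = "\<lambda>n. inverse (real (Suc n))"
  show "(\<lambda>n. LINT t:{0<..}|lborel. exp (- ?p n * t) * kernel t) \<longlonglongrightarrow> (LINT t:{0<..}|lborel. kernel t)"
    unfolding set_lebesgue_integral_def
  proof (rule integral_dominated_convergence)
    show "integrable lborel (\<lambda>t. norm (indicator {0<..} t *\<^sub>R kernel t))"
      using kernel_integrable by (simp add: set_integrable_def)
    show "AE t in lborel. (\<lambda>n. indicator {0<..} t *\<^sub>R (exp (- ?p n * t) * kernel t)) \<longlonglongrightarrow> indicator {0<..} t *\<^sub>R kernel t"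
    proof (intro AE_I2)
      fix t :: real
      have "(\<lambda>n. indicator {0<..} t *\<^sub>R (exp (- ?p n * t) * kernel t)) \<longlonglongrightarrow> indicator {0<..} t *\<^sub>R (exp (- 0 * t) * kernel t)"
        by (intro tendsto_intros LIMSEQ_inverse_real_of_nat)
      then show "(\<lambda>n. indicator {0<..} t *\<^sub>R (exp (- ?p n * t) * kernel t)) \<longlonglongrightarrow> indicator {0<..} t *\<^sub>R kernel t" by simp
    qed
    show "AE t in lborel. norm (indicator {0<..} t *\<^sub>R (exp (- ?p n * t) * kernel t)) \<le> norm (indicator {0<..} t *\<^sub>R kernel t)" for n
      by (intro AE_I2) (auto simp: indicator_def abs_mult intro!: mult_left_le_one_le)
  qed measurable
  have "(\<lambda>n. Re (G (of_real (ln (?p n))))) \<longlonglongrightarrow> G0"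
  proof (rule LIM_zero_cancel, rule Lim_null_comparison)
    show "\<forall>\<^sub>F n in sequentially. norm (Re (G (of_real (ln (?p n)))) - G0) \<le> C * ?p n powr a"
    proof (intro always_eventually allI)
      fix n
      have "norm (Re (G (of_real (ln (?p n)))) - G0) \<le> cmod (G (of_real (ln (?p n))) - of_real G0)"
        using abs_Re_le_cmod[of "G (of_real (ln (?p n))) - of_real G0"] by simp
      also have "\<dots> \<le> C * exp (a * ln (?p n))"
        using origin[of "of_real (ln (?p n))"] psi_pos by simp
      also have "\<dots> = C * ?p n powr a" by (simp add: powr_def)
      finally show "norm (Re (G (of_real (ln (?p n)))) - G0) \<le> C * ?p n powr a" .
    qed
    have "(\<lambda>n. C * ?p n powr a) \<longlonglongrightarrow> C * 0"
      using a by (intro tendsto_intros tendsto_zero_powrI[OF LIMSEQ_inverse_real_of_nat tendsto_const]) auto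
    then show "(\<lambda>n. C * ?p n powr a) \<longlonglongrightarrow> 0" by simp
  qed
  then show "(\<lambda>n. LINT t:{0<..}|lborel. exp (- ?p n * t) * kernel t) \<longlonglongrightarrow> G0"
    by (subst kernel_Laplace) auto
qed

end

section \<open>Kernels of the linear system\<close>

lemma ray_kernel_exists:
  assumes "ray_kernel G U \<psi> a C G0"
  obtains K M where "set_integrable lborel {0<..} K" "\<And>t. 0 < t \<Longrightarrow> \<bar>K t\<bar> \<le> M * t powr (- 1 - a)"
    "\<And>p. 0 < p \<Longrightarrow> (LINT t:{0<..}|lborel. exp (- p * t) * K t) = Re (G (of_real (ln p)))"
    "(LINT t:{0<..}|lborel. K t) = G0"
proof -
  interpret ray_kernel G U \<psi> a C G0 by fact
  show ?thesis
    using that[of kernel] kernel_integrable kernel_bound_infinity kernel_Laplace kernel_total by blast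
qed

text \<open>The three coefficients cover all entries of the adjugate of
  \<open>diag(s^a, s^b) - A\<close>, so one statement yields the four kernels. The numerator is
  \<open>O(1 + s^b)\<close> against a denominator of size \<open>1 + s^(a + b)\<close>, which is the
  required decay \<open>s^(-a)\<close>.\<close>

lemma system_kernel_exists:
  fixes a b a11 a22 d c0 c1 c2 :: real
  assumes ab: "0 < a" "a < b" "b \<le> 1"
    and q: "q1 = sin (a * pi / 2) / sin ((a + b) * pi / 2)"
      "q2 = sin (b * pi / 2) / sin ((a + b) * pi / 2)"
    and cond: "stability_condition a b q1 q2 a11 a22 d"
  obtains K M where "set_integrable lborel {0<..} K" "\<And>t. 0 < t \<Longrightarrow> \<bar>K t\<bar> \<le> M * t powr (- 1 - a)"
    "\<And>p. 0 < p \<Longrightarrow> (LINT t:{0<..}|lborel. exp (- p * t) * K t) =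
      (c0 + c1 * p powr a + c2 * p powr b) / (p powr (a + b) - a11 * p powr b - a22 * p powr a + d)"
    "(LINT t:{0<..}|lborel. K t) = c0 / d"
proof -
  have d: "d > 0" using cond by (simp add: stability_condition_def)
  obtain \<psi> c where psi: "pi / 2 < \<psi>" "\<psi> < pi" and c: "0 < c" and
    low: "\<And>z. 0 \<le> Im z \<Longrightarrow> Im z \<le> \<psi> \<Longrightarrow> c * (1 + exp ((a + b) * Re z)) \<le> cmod (char_fun a b a11 a22 d z)"
    using char_fun_lower_bound[OF ab q cond] by blast
  define Q where "Q = char_fun a b a11 a22 d"
  define n where "n z = of_real c0 + of_real c1 * exp (of_real a * z) + of_real c2 * exp (of_real b * z)" for z :: complex
  define G where "G z = n z / Q z" for z
  define S where "S = \<bar>c0\<bar> + \<bar>c1\<bar> + \<bar>c2\<bar>"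
  \<comment> \<open>The coefficients of \<open>n z * d - c0 * Q z\<close>, the numerator of
    \<open>G z - c0 / d\<close>. The constant terms cancel, and the lowest power left is
    \<open>s^a\<close>.\<close>
  define S2 where "S2 = \<bar>c1 * d + c0 * a22\<bar> + \<bar>c2 * d + c0 * a11\<bar> + \<bar>c0\<bar>"
  define C where "C = max (2 * S / c) (2 * S2 / (d * c))"
  have ne: "cmod (exp (of_real \<beta> * z)) = exp (\<beta> * Re z)" for \<beta> z by simp
  have S: "0 \<le> S" "0 \<le> S2" by (simp_all add: S_def S2_def)
  have e0: "1 + u \<le> 2 * (1 + v)" if "u \<le> 1 \<or> u \<le> v" "0 < v" for u v :: real
    using that by auto
  have e1: "1 + exp (b * x) \<le> 2 * (1 + exp ((a + b) * x))" for x
  proof (rule e0)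
    show "exp (b * x) \<le> 1 \<or> exp (b * x) \<le> exp ((a + b) * x)"
    proof (cases "0 \<le> x")
      case True
      then have "b * x \<le> (a + b) * x" using ab by (intro mult_right_mono) auto
      then show ?thesis by simp
    next
      case False
      then show ?thesis using ab by (simp add: mult_nonneg_nonpos)
    qed
  qed simp
  have cancel: "A * (2 * N) / (B * N) = 2 * A / B" if "0 < N" for A B N :: real
    using that by simp
  have N: "0 < 1 + exp y" for y :: real by (simp add: add_pos_pos)
  have e2: "exp (a * x) * (1 + exp (b * x)) \<le> 2 * (1 + exp ((a + b) * x))" for x
  proof -
    have "exp (a * x) \<le> 1 + exp ((a + b) * x)"
    proof (cases "0 \<le> x")
      case True
      then have "a * x \<le> (a + b) * x" using ab by (intro mult_right_mono) auto
      then show ?thesis using exp_le_cancel_iff[of "a * x" "(a + b) * x"] by linarith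
    next
      case False
      then have "exp (a * x) \<le> 1" using ab by (simp add: mult_nonneg_nonpos)
      then show ?thesis using exp_gt_zero[of "(a + b) * x"] by linarith
    qed
    moreover have "exp (a * x) * exp (b * x) = exp ((a + b) * x)" by (simp add: exp_add[symmetric] distrib_right)
    ultimately show ?thesis by (simp add: distrib_left)
  qed
  have e3: "exp (a * x) \<le> 1 + exp (b * x)" for x
  proof (cases "0 \<le> x")
    case True
    then have "a * x \<le> b * x" using ab by (intro mult_right_mono) auto
    then show ?thesis using exp_le_cancel_iff[of "a * x" "b * x"] by linarith
  next
    case False
    then have "exp (a * x) \<le> 1" using ab by (simp add: mult_nonneg_nonpos)
    then show ?thesis using exp_gt_zero[of "b * x"] by linarith
  qed
  have e4: "exp (b * x) \<le> exp (a * x) * (1 + exp (b * x))" for x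
  proof -
    have "exp ((b - a) * x) \<le> 1 + exp (b * x)"
    proof (cases "0 \<le> x")
      case True
      then have "(b - a) * x \<le> b * x" using ab by (intro mult_right_mono) auto
      then show ?thesis using exp_le_cancel_iff[of "(b - a) * x" "b * x"] by linarith
    next
      case False
      then have "exp ((b - a) * x) \<le> 1" using ab by (simp add: mult_nonneg_nonpos)
      then show ?thesis using exp_gt_zero[of "b * x"] by linarith
    qed
    then have "exp (a * x) * exp ((b - a) * x) \<le> exp (a * x) * (1 + exp (b * x))" by (intro mult_left_mono) auto
    moreover have "exp (a * x) * exp ((b - a) * x) = exp (b * x)" by (simp add: exp_add[symmetric] algebra_simps)
    ultimately show ?thesis by simp
  qed
  have num: "cmod (n z) \<le> S * (1 + exp (b * Re z))" for z
  proof -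
    have "cmod (n z) \<le> \<bar>c0\<bar> * 1 + \<bar>c1\<bar> * exp (a * Re z) + \<bar>c2\<bar> * exp (b * Re z)"
      unfolding n_def by (intro order_trans[OF norm_triangle_ineq] add_mono) (auto simp: norm_mult)
    also have "\<dots> \<le> \<bar>c0\<bar> * (1 + exp (b * Re z)) + \<bar>c1\<bar> * (1 + exp (b * Re z)) + \<bar>c2\<bar> * (1 + exp (b * Re z))"
      by (intro add_mono mult_left_mono e3) auto
    finally show ?thesis by (simp add: S_def distrib_right)
  qed
  have Qpos: "0 < cmod (Q z)" if "0 \<le> Im z" "Im z \<le> \<psi>" for z
    using low[OF that] mult_pos_pos[OF c, of "1 + exp ((a + b) * Re z)"] by (simp add: Q_def add_pos_pos del: zero_less_norm_iff)
  have holQ: "Q holomorphic_on UNIV"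
    unfolding Q_def char_fun_def by (intro holomorphic_intros)
  have rk: "ray_kernel G (Q -` (- {0})) \<psi> a C (c0 / d)"
  proof
    show "0 < a" "a < 1" "pi / 2 < \<psi>" "\<psi> < pi" using ab psi by auto
    show "open (Q -` (- {0}))"
      using holomorphic_on_imp_continuous_on[OF holQ]
      by (intro continuous_open_vimage) (auto simp: continuous_on_eq_continuous_at)
    show "z \<in> Q -` (- {0})" if "0 \<le> Im z" "Im z \<le> \<psi>" for z using Qpos[OF that] by auto
    show "G holomorphic_on Q -` (- {0})"
      unfolding G_def n_def by (intro holomorphic_intros holomorphic_on_subset[OF holQ]) auto
    show "cmod (G z) \<le> C" if z: "0 \<le> Im z" "Im z \<le> \<psi>" for z
    proof -
      have "cmod (G z) \<le> (S * (2 * (1 + exp ((a + b) * Re z)))) / (c * (1 + exp ((a + b) * Re z)))"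
        unfolding G_def norm_divide using c S low[OF z] num[of z] mult_left_mono[OF e1 S(1)]
        by (intro frac_le mult_pos_pos) (auto simp: Q_def add_pos_pos intro: order_trans)
      also have "\<dots> = 2 * S / c" by (rule cancel[OF N])
      finally show ?thesis by (simp add: C_def)
    qed
    show "cmod (G z) \<le> C * exp (- a * Re z)" if z: "0 \<le> Im z" "Im z \<le> \<psi>" for z
    proof -
      have "exp (a * Re z) * cmod (n z) \<le> exp (a * Re z) * (S * (1 + exp (b * Re z)))"
        by (intro mult_left_mono num) auto
      also have "\<dots> \<le> S * (2 * (1 + exp ((a + b) * Re z)))"
        using mult_left_mono[OF e2[of "Re z"] S(1)] by (simp only: mult_ac)
      finally have "(exp (a * Re z) * cmod (n z)) / cmod (Q z) \<le> (S * (2 * (1 + exp ((a + b) * Re z)))) / (c * (1 + exp ((a + b) * Re z)))"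
        using c S low[OF z] by (intro frac_le mult_pos_pos) (auto simp: Q_def add_pos_pos)
      also have "\<dots> = 2 * S / c" by (rule cancel[OF N])
      also have "\<dots> \<le> C" by (simp add: C_def)
      finally have "exp (a * Re z) * cmod (G z) \<le> C" by (simp add: G_def norm_divide)
      then show ?thesis by (simp add: exp_minus field_simps)
    qed
    show "cmod (G z - complex_of_real (c0 / d)) \<le> C * exp (a * Re z)" if z: "0 \<le> Im z" "Im z \<le> \<psi>" for z
    proof -
      define m where "m = of_real (c1 * d + c0 * a22) * exp (of_real a * z) + of_real (c2 * d + c0 * a11) * exp (of_real b * z)
        - of_real c0 * exp (of_real (a + b) * z)"
      have Qz: "Q z \<noteq> 0" using Qpos[OF z] by auto
      have "G z - complex_of_real (c0 / d) = (n z * of_real d - of_real c0 * Q z) / (of_real d * Q z)"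
        using d Qz by (simp add: G_def field_simps)
      also have "n z * of_real d - of_real c0 * Q z = m"
        by (simp add: n_def Q_def char_fun_def m_def algebra_simps)
      finally have eq: "cmod (G z - complex_of_real (c0 / d)) = cmod m / (d * cmod (Q z))"
        using d by (simp add: norm_divide norm_mult)
      let ?W = "exp (a * Re z) * (1 + exp (b * Re z))"
      have "cmod m \<le> \<bar>c1 * d + c0 * a22\<bar> * exp (a * Re z) + \<bar>c2 * d + c0 * a11\<bar> * exp (b * Re z) + \<bar>c0\<bar> * exp ((a + b) * Re z)"
        unfolding m_def
        by (intro order_trans[OF norm_triangle_ineq4] order_trans[OF norm_triangle_ineq] add_mono)
          (simp_all add: norm_mult del: of_real_add of_real_mult)
      also have "\<dots> \<le> \<bar>c1 * d + c0 * a22\<bar> * ?W + \<bar>c2 * d + c0 * a11\<bar> * ?W + \<bar>c0\<bar> * ?W"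
      proof (intro add_mono mult_left_mono e4)
        show "exp (a * Re z) \<le> ?W" by simp
        show "exp ((a + b) * Re z) \<le> ?W" by (simp add: distrib_left distrib_right exp_add)
      qed auto
      finally have m: "cmod m \<le> S2 * ?W" by (simp only: S2_def distrib_right)
      have "cmod (G z - complex_of_real (c0 / d)) \<le> (S2 * ?W) / (d * (c * (1 + exp ((a + b) * Re z))))"
        unfolding eq using c d low[OF z] S
        by (intro frac_le m mult_pos_pos mult_left_mono mult_nonneg_nonneg) (auto simp: Q_def add_pos_pos add_nonneg_nonneg)
      also have "\<dots> \<le> exp (a * Re z) * (S2 * (2 * (1 + exp ((a + b) * Re z)))) / (d * (c * (1 + exp ((a + b) * Re z))))"
      proof (rule divide_right_mono)
        have "S2 * exp (a * Re z) * (1 + exp (b * Re z)) \<le> S2 * exp (a * Re z) * (2 * (1 + exp ((a + b) * Re z)))"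
          using S by (intro mult_left_mono e1) auto
        then show "S2 * ?W \<le> exp (a * Re z) * (S2 * (2 * (1 + exp ((a + b) * Re z))))" by (simp add: mult_ac)
      qed (use c d in \<open>auto simp: add_nonneg_nonneg\<close>)
      also have "\<dots> = 2 * S2 / (d * c) * exp (a * Re z)"
        using cancel[OF N[of "(a + b) * Re z"], of "exp (a * Re z) * S2" "d * c"] by (simp add: mult_ac)
      also have "\<dots> \<le> C * exp (a * Re z)" by (intro mult_right_mono) (auto simp: C_def)
      finally show ?thesis .
    qed
    show "Im (G (complex_of_real x)) = 0" for x
    proof -
      have e: "exp (of_real \<beta> * of_real x) = complex_of_real (exp (\<beta> * x))" for \<beta>
        by (simp add: exp_of_real[symmetric])
      have "G (of_real x) = of_real ((c0 + c1 * exp (a * x) + c2 * exp (b * x)) /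
          (exp ((a + b) * x) - a11 * exp (b * x) - a22 * exp (a * x) + d))"
        unfolding G_def n_def Q_def char_fun_def e by simp
      then show ?thesis by (simp only: Im_complex_of_real)
    qed
  qed
  have G_real: "Re (G (of_real (ln p))) = (c0 + c1 * p powr a + c2 * p powr b) / (p powr (a + b) - a11 * p powr b - a22 * p powr a + d)"
    if "0 < p" for p
  proof -
    have e: "exp (of_real \<beta> * of_real (ln p)) = complex_of_real (p powr \<beta>)" for \<beta>
      using that by (simp add: powr_def exp_of_real[symmetric])
    have "G (of_real (ln p)) = of_real ((c0 + c1 * p powr a + c2 * p powr b) / (p powr (a + b) - a11 * p powr b - a22 * p powr a + d))"
      unfolding G_def n_def Q_def char_fun_def e by simp
    then show ?thesis by (simp only: Re_complex_of_real)
  qed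
  show ?thesis
  proof (rule ray_kernel_exists[OF rk])
    fix K M
    assume K: "set_integrable lborel {0<..} K" "\<And>t. 0 < t \<Longrightarrow> \<bar>K t\<bar> \<le> M * t powr (- 1 - a)"
      "\<And>p. 0 < p \<Longrightarrow> (LINT t:{0<..}|lborel. exp (- p * t) * K t) = Re (G (of_real (ln p)))"
      "(LINT t:{0<..}|lborel. K t) = c0 / d"
    show ?thesis
      by (rule that[OF K(1,2) _ K(4)]) (use K(3) G_real in auto)
  qed
qed

section \<open>Convolution and the Laplace transform\<close>

text \<open>A common class for integrable kernels, bounded continuous functions and the fractional
  kernels, which are not integrable at infinity. It is closed under convolution, and Laplace
  transforms exist for \<open>p \<ge> 1\<close>.\<close>

definition damped :: "(real \<Rightarrow> real) \<Rightarrow> bool" where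
  "damped K \<longleftrightarrow> set_integrable lborel {0<..} (\<lambda>s. exp (- s) * K s)"

definition conv :: "(real \<Rightarrow> real) \<Rightarrow> (real \<Rightarrow> real) \<Rightarrow> real \<Rightarrow> real" where
  "conv K h t = (LINT s:{0<..t}|lborel. K s * h (t - s))"

definition laplace :: "(real \<Rightarrow> real) \<Rightarrow> real \<Rightarrow> real" where
  "laplace K p = (LINT s:{0<..}|lborel. exp (- p * s) * K s)"

lemma damped_measurable:
  assumes "damped K"
  shows "(\<lambda>s. indicator {0<..} s * K s) \<in> borel_measurable borel"
proof -
  have "(\<lambda>s. indicator {0<..} s *\<^sub>R (exp (- s) * K s)) \<in> borel_measurable borel"
    using assms borel_measurable_integrable unfolding damped_def set_integrable_def by fastforce
  then have "(\<lambda>s. exp s * (indicator {0<..} s *\<^sub>R (exp (- s) * K s))) \<in> borel_measurable borel" by measurable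
  moreover have "exp s * (indicator {0<..} s *\<^sub>R (exp (- s) * K s)) = indicator {0<..} s * K s" for s
    by (simp add: exp_minus)
  ultimately show ?thesis by (simp only:)
qed

lemma damped_integrable:
  assumes K: "damped K" and p: "1 \<le> p"
  shows "set_integrable lborel {0<..} (\<lambda>s. exp (- p * s) * K s)"
  unfolding set_integrable_def
proof (rule Bochner_Integration.integrable_bound[OF K[unfolded damped_def set_integrable_def]])
  have "(\<lambda>s. exp (- p * s) * (indicator {0<..} s * K s)) \<in> borel_measurable borel"
    using damped_measurable[OF K] by measurable
  then show "(\<lambda>s. indicator {0<..} s *\<^sub>R (exp (- p * s) * K s)) \<in> borel_measurable lborel" by (simp add: mult_ac)
  show "AE s in lborel. norm (indicator {0<..} s *\<^sub>R (exp (- p * s) * K s)) \<le> norm (indicator {0<..} s *\<^sub>R (exp (- s) * K s))"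
  proof (intro AE_I2)
    fix s :: real
    show "norm (indicator {0<..} s *\<^sub>R (exp (- p * s) * K s)) \<le> norm (indicator {0<..} s *\<^sub>R (exp (- s) * K s))"
    proof (cases "0 < s")
      case True
      then have "s \<le> p * s" using p by simp
      then show ?thesis using True by (simp add: abs_mult mult_right_mono)
    qed simp
  qed
qed

lemma damped_norm_integrable:
  assumes K: "damped K"
  shows "set_integrable lborel {0<..} (\<lambda>s. exp (- s) * \<bar>K s\<bar>)"
proof -
  have "set_integrable lborel {0<..} (\<lambda>s. norm (exp (- s) * K s))"
    using set_integrable_norm[OF K[unfolded damped_def]] .
  then show ?thesis by (simp add: abs_mult)
qed

lemma damped_local:
  assumes K: "damped K"
  shows "set_integrable lborel {0<..t} K"
    and "(LINT s:{0<..t}|lborel. \<bar>K s\<bar>) \<le> exp t * (LINT s:{0<..}|lborel. exp (- s) * \<bar>K s\<bar>)"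
proof -
  let ?g = "\<lambda>s. exp t * (indicator {0<..} s *\<^sub>R (exp (- s) * \<bar>K s\<bar>))"
  have g: "integrable lborel ?g"
    using damped_norm_integrable[OF K] by (auto simp: set_integrable_def)
  have le: "norm (indicator {0<..t} s *\<^sub>R K s) \<le> ?g s" for s
  proof (cases "0 < s \<and> s \<le> t")
    case True
    then have "1 \<le> exp t * exp (- s)" by (simp add: exp_add[symmetric])
    then have "1 * \<bar>K s\<bar> \<le> exp t * exp (- s) * \<bar>K s\<bar>" by (intro mult_right_mono) auto
    then show ?thesis using True by (simp add: mult_ac)
  qed (auto simp: indicator_def)
  show *: "set_integrable lborel {0<..t} K"
    unfolding set_integrable_def
  proof (rule Bochner_Integration.integrable_bound[OF g])
    have "(\<lambda>s. indicator {0<..t} s * (indicator {0<..} s * K s)) \<in> borel_measurable borel"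
      using damped_measurable[OF K] by measurable
    moreover have "indicator {0<..t} s * (indicator {0<..} s * K s) = indicator {0<..t} s *\<^sub>R K s" for s
      by (simp add: indicator_def)
    ultimately show "(\<lambda>s. indicator {0<..t} s *\<^sub>R K s) \<in> borel_measurable lborel" by simp
    show "AE s in lborel. norm (indicator {0<..t} s *\<^sub>R K s) \<le> norm (?g s)"
      using order_trans[OF le abs_ge_self] by (intro AE_I2) simp
  qed
  have "(LINT s:{0<..t}|lborel. \<bar>K s\<bar>) = (\<integral>s. norm (indicator {0<..t} s *\<^sub>R K s) \<partial>lborel)"
    by (simp add: set_lebesgue_integral_def abs_mult)
  also have "\<dots> \<le> (\<integral>s. ?g s \<partial>lborel)"
    using * le by (intro integral_mono g) (auto simp: set_integrable_def)
  finally show "(LINT s:{0<..t}|lborel. \<bar>K s\<bar>) \<le> exp t * (LINT s:{0<..}|lborel. exp (- s) * \<bar>K s\<bar>)"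
    by (simp add: set_lebesgue_integral_def)
qed

lemma exp_minus_set_integrable: "set_integrable lborel {0<..} (\<lambda>t::real. exp (- t))"
proof -
  have "integrable lborel (\<lambda>t::real. indicator {0<..} t * (t powr (1 - 1) * exp (- 1 * t)))"
    using has_bochner_integral_Gamma_scaled[of 1 1] by (auto simp: has_bochner_integral_iff)
  moreover have "indicator {0<..} t * (t powr (1 - 1) * exp (- 1 * t)) = indicator {0<..} t *\<^sub>R exp (- t)" for t :: real
    by (simp add: indicator_def)
  ultimately show ?thesis unfolding set_integrable_def by (simp only:)
qed

lemma continuous_on_indicator_measurable:
  assumes "continuous_on {0..} (h :: real \<Rightarrow> real)"
  shows "(\<lambda>s. indicator {0<..} s * h s) \<in> borel_measurable borel"
proof -
  have "continuous_on UNIV (\<lambda>s. h (max 0 s))"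
    by (intro continuous_on_compose2[OF assms] continuous_intros) auto
  then have [measurable]: "(\<lambda>s. h (max 0 s)) \<in> borel_measurable borel" by (rule borel_measurable_continuous_onI)
  have "(\<lambda>s. indicator {0<..} s * h (max 0 s)) \<in> borel_measurable borel" by measurable
  moreover have "indicator {0<..} s * h (max 0 s) = indicator {0<..} s * h s" for s by (simp add: indicator_def)
  ultimately show ?thesis by simp
qed

lemma damped_bounded:
  assumes h: "continuous_on {0..} h" and H: "\<And>t. 0 \<le> t \<Longrightarrow> \<bar>h t\<bar> \<le> H"
  shows "damped h"
  unfolding damped_def set_integrable_def
proof (rule Bochner_Integration.integrable_bound)
  show "integrable lborel (\<lambda>t. H * (indicator {0<..} t *\<^sub>R exp (- t)))"
    using exp_minus_set_integrable by (auto simp: set_integrable_def)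
  have "(\<lambda>s. exp (- s) * (indicator {0<..} s * h s)) \<in> borel_measurable borel"
    using continuous_on_indicator_measurable[OF h] by measurable
  then show "(\<lambda>s. indicator {0<..} s *\<^sub>R (exp (- s) * h s)) \<in> borel_measurable lborel" by (simp add: mult_ac)
  show "AE t in lborel. norm (indicator {0<..} t *\<^sub>R (exp (- t) * h t)) \<le> norm (H * (indicator {0<..} t *\<^sub>R exp (- t)))"
  proof (intro AE_I2)
    fix t :: real
    show "norm (indicator {0<..} t *\<^sub>R (exp (- t) * h t)) \<le> norm (H * (indicator {0<..} t *\<^sub>R exp (- t)))"
      using H[of t] by (cases "0 < t") (auto simp: abs_mult)
  qed
qed

lemma continuous_on_Icc_bounded:
  fixes h :: "real \<Rightarrow> real"
  assumes "continuous_on {a..b} h"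
  shows "\<exists>B. \<forall>s\<in>{a..b}. \<bar>h s\<bar> \<le> B"
  using compact_imp_bounded[OF compact_continuous_image[OF assms compact_Icc]]
  by (auto simp: bounded_iff)

lemma conv_cong:
  assumes "\<And>s. 0 \<le> s \<Longrightarrow> s < t \<Longrightarrow> h s = g s"
  shows "conv K h t = conv K g t"
  unfolding conv_def set_lebesgue_integral_def
  by (intro Bochner_Integration.integral_cong refl) (use assms in \<open>auto simp: indicator_def\<close>)

lemma conv_set_integrable:
  assumes K: "damped K" and h: "continuous_on {0..t} h"
  shows "set_integrable lborel {0<..t} (\<lambda>s. K s * h (t - s))"
proof -
  obtain B where B: "\<And>s. s \<in> {0..t} \<Longrightarrow> \<bar>h s\<bar> \<le> B"
    using continuous_on_Icc_bounded[OF h] by blast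
  \<comment> \<open>Clamping the argument to \<open>{0..t}\<close> makes the function continuous on
    the whole line without changing it where it is integrated.\<close>
  have meas: "(\<lambda>s. h (max 0 (min t (t - s)))) \<in> borel_measurable borel" if "0 \<le> t"
    using that by (intro borel_measurable_continuous_onI continuous_on_compose2[OF h] continuous_intros) auto
  have eq: "indicator {0<..t} s *\<^sub>R (K s * h (t - s)) = (indicator {0<..t} s *\<^sub>R K s) * h (max 0 (min t (t - s)))" for s
    by (auto simp: indicator_def min_def max_def)
  show ?thesis
  proof (cases "0 \<le> t")
    case True
    note meas[OF True, measurable]
    have "integrable lborel (\<lambda>s. B * (indicator {0<..t} s *\<^sub>R K s))"
      using damped_local(1)[OF K] by (auto simp: set_integrable_def)
    then show ?thesis
      unfolding set_integrable_def
    proof (rule Bochner_Integration.integrable_bound)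
      have [measurable]: "(\<lambda>s. indicator {0<..t} s *\<^sub>R K s) \<in> borel_measurable borel"
        using damped_local(1)[OF K, of t] borel_measurable_integrable unfolding set_integrable_def by fastforce
      show "(\<lambda>s. indicator {0<..t} s *\<^sub>R (K s * h (t - s))) \<in> borel_measurable lborel"
        unfolding eq by measurable
      show "AE s in lborel. norm (indicator {0<..t} s *\<^sub>R (K s * h (t - s))) \<le> norm (B * (indicator {0<..t} s *\<^sub>R K s))"
      proof (intro AE_I2)
        fix s :: real
        show "norm (indicator {0<..t} s *\<^sub>R (K s * h (t - s))) \<le> norm (B * (indicator {0<..t} s *\<^sub>R K s))"
        proof (cases "0 < s \<and> s \<le> t")
          case True
          then have "\<bar>h (t - s)\<bar> \<le> \<bar>B\<bar>" using B[of "t - s"] by auto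
          then show ?thesis using True by (simp add: abs_mult mult.commute[of "\<bar>B\<bar>"] mult_left_mono)
        qed (auto simp: indicator_def)
      qed
    qed
  qed (simp add: set_integrable_def)
qed

lemma conv_bound:
  assumes K: "damped K" and h: "continuous_on {0..t} h" and H: "\<And>s. 0 \<le> s \<Longrightarrow> s \<le> t \<Longrightarrow> \<bar>h s\<bar> \<le> H"
  shows "\<bar>conv K h t\<bar> \<le> H * (LINT s:{0<..t}|lborel. \<bar>K s\<bar>)"
proof -
  have "\<bar>conv K h t\<bar> \<le> (\<integral>s. norm (indicator {0<..t} s *\<^sub>R (K s * h (t - s))) \<partial>lborel)"
    unfolding conv_def set_lebesgue_integral_def using integral_norm_bound by fastforce
  also have "\<dots> \<le> (\<integral>s. H * (indicator {0<..t} s *\<^sub>R \<bar>K s\<bar>) \<partial>lborel)"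
  proof (rule integral_mono)
    show "integrable lborel (\<lambda>s. norm (indicator {0<..t} s *\<^sub>R (K s * h (t - s))))"
      using conv_set_integrable[OF K h] by (intro integrable_norm) (simp add: set_integrable_def)
    show "integrable lborel (\<lambda>s. H * (indicator {0<..t} s *\<^sub>R \<bar>K s\<bar>))"
      using set_integrable_norm[OF damped_local(1)[OF K, of t]] by (auto simp: set_integrable_def)
    fix s :: real
    show "norm (indicator {0<..t} s *\<^sub>R (K s * h (t - s))) \<le> H * (indicator {0<..t} s *\<^sub>R \<bar>K s\<bar>)"
      using H[of "t - s"] by (auto simp: indicator_def abs_mult mult.commute[of H] intro!: mult_left_mono)
  qed
  finally show ?thesis by (simp add: set_lebesgue_integral_def)
qed

lemma conv_exp_bound:
  assumes K: "damped K" and h: "continuous_on {0..t} h" and H: "\<And>s. 0 \<le> s \<Longrightarrow> s \<le> t \<Longrightarrow> \<bar>h s\<bar> \<le> H"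
    and "0 \<le> H"
  shows "\<bar>conv K h t\<bar> \<le> H * exp t * (LINT s:{0<..}|lborel. exp (- s) * \<bar>K s\<bar>)"
  using order_trans[OF conv_bound[OF K h H] mult_left_mono[OF damped_local(2)[OF K] \<open>0 \<le> H\<close>]]
  by (simp add: mult.assoc)

lemma conv_continuous:
  assumes K: "damped K" and h: "continuous_on {0..T} h"
  shows "continuous_on {0..T} (conv K h)"
proof (cases "0 \<le> T")
  case True
  define h' where "h' u = h (max 0 (min T u))" for u
  have h': "continuous_on UNIV h'"
    unfolding h'_def using True by (intro continuous_on_compose2[OF h] continuous_intros) auto
  have [measurable]: "h' \<in> borel_measurable borel" using h' by (rule borel_measurable_continuous_onI)
  obtain B where B: "\<And>s. s \<in> {0..T} \<Longrightarrow> \<bar>h s\<bar> \<le> B"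
    using continuous_on_Icc_bounded[OF h] by blast
  then have B': "\<bar>h' u\<bar> \<le> B" for u using True by (auto simp: h'_def)
  have [measurable]: "(\<lambda>s. indicator {0<..T} s *\<^sub>R K s) \<in> borel_measurable borel"
    using damped_local(1)[OF K, of T] borel_measurable_integrable unfolding set_integrable_def by fastforce
  have conv': "conv K h t = (\<integral>s. indicator {0<..t} s * ((indicator {0<..T} s *\<^sub>R K s) * h' (t - s)) \<partial>lborel)" if "t \<in> {0..T}" for t
    unfolding conv_def set_lebesgue_integral_def
    by (intro Bochner_Integration.integral_cong refl) (use that in \<open>auto simp: h'_def indicator_def\<close>)
  show ?thesis
    unfolding continuous_on_sequentially
  proof (intro ballI allI impI, elim conjE)
    fix u t assume t: "t \<in> {0..T}" and u: "\<forall>n. u n \<in> {0..T}" "u \<longlonglongrightarrow> t"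
    have "(\<lambda>n. \<integral>s. indicator {0<..u n} s * ((indicator {0<..T} s *\<^sub>R K s) * h' (u n - s)) \<partial>lborel)
      \<longlonglongrightarrow> (\<integral>s. indicator {0<..t} s * ((indicator {0<..T} s *\<^sub>R K s) * h' (t - s)) \<partial>lborel)"
    proof (rule integral_dominated_convergence)
      show "integrable lborel (\<lambda>s. B * norm (indicator {0<..T} s *\<^sub>R K s))"
        using damped_local(1)[OF K, of T] by (intro integrable_mult_right integrable_norm) (simp add: set_integrable_def)
      show "AE s in lborel. (\<lambda>n. indicator {0<..u n} s * ((indicator {0<..T} s *\<^sub>R K s) * h' (u n - s)))
        \<longlonglongrightarrow> indicator {0<..t} s * ((indicator {0<..T} s *\<^sub>R K s) * h' (t - s))"
        using AE_lborel_singleton[of t]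
      proof eventually_elim
        case (elim s)
        have "(\<lambda>n. indicator {0<..u n} s :: real) \<longlonglongrightarrow> indicator {0<..t} s"
        proof (cases "s < t")
          case True
          then have "\<forall>\<^sub>F n in sequentially. s < u n" using u(2) by (simp add: order_tendstoD)
          then show ?thesis using True
            by (intro tendsto_eventually) (auto elim!: eventually_mono simp: indicator_def)
        next
          case False
          with elim have "t < s" by simp
          then have "\<forall>\<^sub>F n in sequentially. u n < s" using u(2) by (simp add: order_tendstoD)
          then show ?thesis using \<open>t < s\<close>
            by (intro tendsto_eventually) (auto elim!: eventually_mono simp: indicator_def)
        qed
        moreover have "(\<lambda>n. h' (u n - s)) \<longlonglongrightarrow> h' (t - s)"
          using h' u(2) by (intro continuous_on_tendsto_compose[OF h'] tendsto_intros) auto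
        ultimately show ?case by (intro tendsto_intros)
      qed
      show "AE s in lborel. norm (indicator {0<..u n} s * ((indicator {0<..T} s *\<^sub>R K s) * h' (u n - s)))
          \<le> B * norm (indicator {0<..T} s *\<^sub>R K s)" for n
        using B' order_trans[OF abs_ge_zero B']
        by (intro AE_I2) (auto simp: indicator_def abs_mult mult.commute[of B] intro!: mult_left_mono)
    qed measurable
    then show "(conv K h \<circ> u) \<longlonglongrightarrow> conv K h t"
      using u(1) t by (simp add: o_def conv')
  qed
qed simp

lemma conv_continuous_atLeast:
  assumes K: "damped K" and h: "continuous_on {0..} h"
  shows "continuous_on {0..} (conv K h)"
proof (rule continuous_on_eq_continuous_within[THEN iffD2], intro ballI)
  fix t :: real assume t: "t \<in> {0..}"
  have "continuous_on {0..t + 1} (conv K h)"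
    by (intro conv_continuous K continuous_on_subset[OF h]) auto
  then have "continuous (at t within {0..t + 1}) (conv K h)"
    using t by (simp add: continuous_on_eq_continuous_within)
  moreover have "at t within {0..t + 1} = at t within {0..}"
    by (rule at_within_nhd[of _ "{..<t + 1}"]) auto
  ultimately show "continuous (at t within {0..}) (conv K h)" by simp
qed

lemma conv_add:
  assumes K: "damped K" and "continuous_on {0..t} h" "continuous_on {0..t} g"
  shows "conv K (\<lambda>s. h s + g s) t = conv K h t + conv K g t"
  unfolding conv_def distrib_left
  by (rule set_integral_add(2)) (use assms in \<open>auto intro: conv_set_integrable\<close>)

lemma conv_diff:
  assumes K: "damped K" and "continuous_on {0..t} h" "continuous_on {0..t} g"
  shows "conv K (\<lambda>s. h s - g s) t = conv K h t - conv K g t"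
  unfolding conv_def right_diff_distrib
  by (rule set_integral_diff(2)) (use assms in \<open>auto intro: conv_set_integrable\<close>)

lemma conv_cmult: "conv K (\<lambda>s. c * h s) t = c * conv K h t"
  unfolding conv_def set_lebesgue_integral_def
  by (simp add: mult.left_commute[of _ c] flip: integral_mult_right_zero)

text \<open>After weighting by the exponential and cutting off to the positive half line,
  \<open>conv\<close> becomes a convolution of integrable functions on the whole line, and Fubini
  with translation invariance gives the product.\<close>

lemma laplace_conv:
  assumes K: "damped K" and h: "damped h" and p: "1 \<le> p"
  shows "laplace (conv K h) p = laplace K p * laplace h p"
    and "set_integrable lborel {0<..} (\<lambda>t. exp (- p * t) * conv K h t)"
proof -
  define k where "k s = indicator {0<..} s * (exp (- p * s) * K s)" for s
  define l where "l s = indicator {0<..} s * (exp (- p * s) * h s)" for s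
  have k: "integrable lborel k" and l: "integrable lborel l"
    using damped_integrable[OF K p] damped_integrable[OF h p]
    unfolding k_def l_def by (auto simp: set_integrable_def)
  have [measurable]: "k \<in> borel_measurable borel" "l \<in> borel_measurable borel"
    using k l borel_measurable_integrable by fastforce+
  have ls: "integrable lborel (\<lambda>t. l (t - s))" for s
    using lborel_integrable_real_affine[OF l, of 1 "- s"] by simp
  have li: "(\<integral>t. f (t - s) \<partial>lborel) = (\<integral>t. f t \<partial>lborel)" for s and f :: "real \<Rightarrow> real"
    using lborel_integral_real_affine[of 1 f "- s"] by simp
  have F: "integrable (lborel \<Otimes>\<^sub>M lborel) (\<lambda>(s, t). k s * l (t - s))"
  proof (rule lborel_pair.Fubini_integrable)
    show "(\<lambda>(s, t). k s * l (t - s)) \<in> borel_measurable (lborel \<Otimes>\<^sub>M lborel)" by measurable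
    show "integrable lborel (\<lambda>s. \<integral>t. norm (case (s, t) of (s, t) \<Rightarrow> k s * l (t - s)) \<partial>lborel)"
      using k by (simp add: abs_mult li[of "\<lambda>t. \<bar>l t\<bar>"])
    show "AE s in lborel. integrable lborel (\<lambda>t. case (s, t) of (s, t) \<Rightarrow> k s * l (t - s))"
      using ls by simp
  qed
  have eq: "(\<integral>s. k s * l (t - s) \<partial>lborel) = indicator {0<..} t * (exp (- p * t) * conv K h t)" for t
  proof -
    have "(\<integral>s. k s * l (t - s) \<partial>lborel) = (\<integral>s. indicator {0<..} t * exp (- p * t) * (indicator {0<..t} s *\<^sub>R (K s * h (t - s))) \<partial>lborel)"
    proof (rule integral_cong_AE)
      have "set_borel_measurable borel {0<..t} (\<lambda>s. K s * h (t - s))"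
      proof -
        \<comment> \<open>\<open>l\<close> is cut off to positive arguments, so
          \<open>k s * l (t - s)\<close> vanishes at \<open>s = t\<close>, whereas
          \<open>conv\<close> includes this endpoint. The second summand restores the value
          there.\<close>
        have "(\<lambda>s. exp (p * t) * (k s * l (t - s)) + indicator {t} s * (K t * h 0) * indicator {0<..} t) \<in> borel_measurable borel"
          by measurable
        moreover have "exp (p * t) * (k s * l (t - s)) + indicator {t} s * (K t * h 0) * indicator {0<..} t = indicator {0<..t} s *\<^sub>R (K s * h (t - s))" for s
        proof -
          have "exp (p * t) * (exp (- p * s) * exp (- p * (t - s))) = 1" by (simp add: exp_add[symmetric] algebra_simps)
          then have "exp (p * t) * ((exp (- p * s) * x) * (exp (- p * (t - s)) * y)) = x * y" for x y
            by (metis mult.assoc mult.left_commute mult_1)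
          then show ?thesis by (auto simp: k_def l_def indicator_def)
        qed
        ultimately show ?thesis by (simp add: set_borel_measurable_def)
      qed
      then show "(\<lambda>s. indicator {0<..} t * exp (- p * t) * (indicator {0<..t} s *\<^sub>R (K s * h (t - s)))) \<in> borel_measurable lborel"
        unfolding set_borel_measurable_def by measurable
      show "AE s in lborel. k s * l (t - s) = indicator {0<..} t * exp (- p * t) * (indicator {0<..t} s *\<^sub>R (K s * h (t - s)))"
        using AE_lborel_singleton[of t]
      proof eventually_elim
        case (elim s)
        have "exp (- p * s) * exp (- p * (t - s)) = exp (- p * t)" by (simp add: exp_add[symmetric] algebra_simps)
        then have "(exp (- p * s) * x) * (exp (- p * (t - s)) * y) = exp (- p * t) * (x * y)" for x y
          by (metis mult.assoc mult.left_commute)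
        then show ?case using elim by (auto simp: k_def l_def indicator_def)
      qed
    qed measurable
    also have "\<dots> = indicator {0<..} t * exp (- p * t) * conv K h t"
      unfolding conv_def set_lebesgue_integral_def by (rule integral_mult_right_zero)
    finally show ?thesis by (simp add: mult.assoc)
  qed
  show "set_integrable lborel {0<..} (\<lambda>t. exp (- p * t) * conv K h t)"
    using lborel_pair.integrable_snd[OF F] by (simp add: eq set_integrable_def)
  have "laplace (conv K h) p = (\<integral>t. (\<integral>s. k s * l (t - s) \<partial>lborel) \<partial>lborel)"
    by (simp add: eq laplace_def set_lebesgue_integral_def)
  also have "\<dots> = (\<integral>s. (\<integral>t. k s * l (t - s) \<partial>lborel) \<partial>lborel)"
    by (rule lborel_pair.Fubini_integral[OF F])
  also have "\<dots> = (\<integral>s. k s * (\<integral>t. l t \<partial>lborel) \<partial>lborel)" by (simp add: li)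
  also have "\<dots> = laplace K p * laplace h p"
    by (simp add: k_def l_def laplace_def set_lebesgue_integral_def)
  finally show "laplace (conv K h) p = laplace K p * laplace h p" .
qed

lemma damped_conv:
  assumes "damped K" "damped h"
  shows "damped (conv K h)"
  using laplace_conv(2)[OF assms, of 1] by (simp add: damped_def)

section \<open>Uniqueness for the Laplace transform and fractional integrals\<close>

text \<open>Lerch's theorem from the positive integers. Put \<open>y = exp (- t)\<close>: vanishing
  transforms mean that \<open>f\<close> is orthogonal to every polynomial in \<open>y\<close> with
  respect to \<open>exp (- t) dt\<close>. Approximating \<open>exp (- t) * f t\<close> uniformly by
  such polynomials makes the integral of \<open>exp (- 2 * t) * (f t)\<^sup>2\<close>
  vanish.\<close>

lemma laplace_unique_bounded:
  fixes f :: "real \<Rightarrow> real"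
  assumes f: "continuous_on {0..} f" and B: "\<And>t. 0 \<le> t \<Longrightarrow> \<bar>f t\<bar> \<le> B"
    and L: "\<And>n::nat. 1 \<le> n \<Longrightarrow> laplace f (real n) = 0" and t: "0 \<le> t"
  shows "f t = 0"
proof -
  have dam: "damped f" by (rule damped_bounded[OF f B])
  have B0: "0 \<le> B" using order_trans[OF abs_ge_zero B[of 0]] by simp
  have int: "set_integrable lborel {0<..} (\<lambda>t. exp (- real n * t) * f t)" if "1 \<le> n" for n
    by (rule damped_integrable[OF dam]) (use that in simp)
  \<comment> \<open>A bounded \<open>f\<close> need not have a limit at infinity, that is, at
    \<open>y = 0\<close>. The extra factor \<open>y\<close> enforces continuity there, as
    Weierstrass approximation requires.\<close>
  define W where "W y = (if y = 0 then 0 else y * f (- ln y))" for y :: real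
  have We: "W (exp (- t)) = exp (- t) * f t" for t by (simp add: W_def)
  have contW: "continuous_on {0..1} W"
    unfolding continuous_on_def
  proof
    fix y :: real assume y: "y \<in> {0..1}"
    show "(W \<longlongrightarrow> W y) (at y within {0..1})"
    proof (cases "y = 0")
      case True
      have "(W \<longlongrightarrow> 0) (at 0 within {0..1})"
      proof (rule Lim_null_comparison)
        show "\<forall>\<^sub>F x in at 0 within {0..1}. norm (W x) \<le> B * x"
        proof (rule eventually_at_topological[THEN iffD2], intro exI[of _ UNIV] conjI ballI impI)
          fix x :: real assume x: "x \<noteq> 0" "x \<in> {0..1}"
          then have "x * \<bar>f (- ln x)\<bar> \<le> x * B" by (intro mult_left_mono B) auto
          then show "norm (W x) \<le> B * x" using x by (simp add: W_def abs_mult mult.commute)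
        qed auto
        have "((\<lambda>x. B * x) \<longlongrightarrow> B * 0) (at 0 within {0..1})" by (intro tendsto_intros)
        then show "((\<lambda>x. B * x) \<longlongrightarrow> 0) (at 0 within {0..1})" by simp
      qed
      then show ?thesis using True by (simp add: W_def)
    next
      case False
      have "continuous_on {0<..1} (\<lambda>y. y * f (- ln y))"
        by (intro continuous_intros continuous_on_compose2[OF f]) auto
      then have "((\<lambda>y. y * f (- ln y)) \<longlongrightarrow> y * f (- ln y)) (at y within {0<..1})"
        using y False by (simp add: continuous_on_def)
      moreover have "at y within {0<..1} = at y within {0..1}"
        by (rule at_within_nhd[of _ "{0<..}"]) (use y False in auto)
      ultimately have "((\<lambda>y. y * f (- ln y)) \<longlongrightarrow> W y) (at y within {0..1})"
        using False by (simp add: W_def)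
      then show ?thesis
      proof (rule Lim_transform_eventually)
        show "\<forall>\<^sub>F x in at y within {0..1}. x * f (- ln x) = W x"
          unfolding eventually_at_topological
          by (rule exI[of _ "{0<..}"]) (use y False in \<open>auto simp: W_def\<close>)
      qed
    qed
  qed
  define J where "J = (LINT t:{0<..}|lborel. exp (- 2 * t) * (f t)\<^sup>2)"
  define A where "A = (LINT t:{0<..}|lborel. exp (- t) * \<bar>f t\<bar>)"
  have ee: "exp (- t) * exp (- t) = exp (- 2 * t)" for t :: real by (simp add: mult_exp_exp)
  have sq: "set_integrable lborel {0<..} (\<lambda>t. exp (- 2 * t) * (f t)\<^sup>2)"
  proof -
    have "damped (\<lambda>t. exp (- t) * (f t)\<^sup>2)"
    proof (rule damped_bounded)
      show "continuous_on {0..} (\<lambda>t. exp (- t) * (f t)\<^sup>2)" by (intro continuous_intros f)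
      fix t :: real assume t: "0 \<le> t"
      have "exp (- t) * (f t)\<^sup>2 \<le> 1 * B\<^sup>2"
        using t power_mono[OF B[OF t] abs_ge_zero, of 2] by (intro mult_mono) auto
      then show "\<bar>exp (- t) * (f t)\<^sup>2\<bar> \<le> B\<^sup>2" by simp
    qed
    moreover have "exp (- t) * (exp (- t) * (f t)\<^sup>2) = exp (- 2 * t) * (f t)\<^sup>2" for t
      using ee[of t] by (simp only: mult.assoc[symmetric])
    ultimately show ?thesis unfolding damped_def by (simp only:)
  qed
  have J: "\<bar>J\<bar> \<le> e * A" if e: "0 < e" for e
  proof -
    obtain g where g: "real_polynomial_function g" "\<And>x. x \<in> {0..1} \<Longrightarrow> \<bar>W x - g x\<bar> < e"
      using Stone_Weierstrass_real_polynomial_function[OF compact_Icc contW e] by blast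
    obtain c n where gs: "g = (\<lambda>x. \<Sum>i\<le>n. c i * x ^ i)"
      using g(1) real_polynomial_function_iff_sum by auto
    have pw: "exp (- t) * (c i * exp (- t) ^ i * f t) = c i * (exp (- real (Suc i) * t) * f t)" for i t
    proof -
      have "exp (- t) * exp (- t) ^ i = exp (- real (Suc i) * t)"
        by (simp add: exp_of_nat_mult[symmetric] exp_add[symmetric] algebra_simps)
      then show ?thesis by (simp only: mult_ac)
    qed
    have gi: "set_integrable lborel {0<..} (\<lambda>t. exp (- t) * (g (exp (- t)) * f t))"
      and g0: "(LINT t:{0<..}|lborel. exp (- t) * (g (exp (- t)) * f t)) = 0"
    proof -
      have int': "integrable lborel (\<lambda>t. indicator {0<..} t *\<^sub>R (exp (- real (Suc i) * t) * f t))" for i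
        using int[of "Suc i"] unfolding set_integrable_def by simp
      have L': "laplace f (real (Suc i)) = 0" for i using L[of "Suc i"] by simp
      have ge: "exp (- t) * (g (exp (- t)) * f t) = (\<Sum>i\<le>n. c i * (exp (- real (Suc i) * t) * f t))" for t
        unfolding gs sum_distrib_right sum_distrib_left pw ..
      have 1: "integrable lborel (\<lambda>t. \<Sum>i\<le>n. c i * (indicator {0<..} t *\<^sub>R (exp (- real (Suc i) * t) * f t)))"
        by (intro Bochner_Integration.integrable_sum integrable_mult_right int')
      have 2: "indicator {0<..} t *\<^sub>R (exp (- t) * (g (exp (- t)) * f t)) = (\<Sum>i\<le>n. c i * (indicator {0<..} t *\<^sub>R (exp (- real (Suc i) * t) * f t)))" for t
        unfolding ge by (simp add: sum_distrib_left mult_ac)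
      show "set_integrable lborel {0<..} (\<lambda>t. exp (- t) * (g (exp (- t)) * f t))"
        using 1 unfolding set_integrable_def 2 .
      have "(LINT t:{0<..}|lborel. exp (- t) * (g (exp (- t)) * f t)) = (\<Sum>i\<le>n. c i * laplace f (real (Suc i)))"
        unfolding set_lebesgue_integral_def 2 laplace_def
        by (simp only: Bochner_Integration.integral_sum[OF integrable_mult_right[OF int']] integral_mult_right_zero)
      then show "(LINT t:{0<..}|lborel. exp (- t) * (g (exp (- t)) * f t)) = 0"
        by (simp only: L' mult_zero_right sum.neutral_const)
    qed
    have We2: "exp (- t) * (W (exp (- t)) * f t) = exp (- 2 * t) * (f t)\<^sup>2" for t
      unfolding We power2_eq_square using ee[of t] by (simp only: mult_ac)
    have "J = (LINT t:{0<..}|lborel. exp (- t) * (W (exp (- t)) * f t)) - (LINT t:{0<..}|lborel. exp (- t) * (g (exp (- t)) * f t))"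
      unfolding J_def g0 We2 by simp
    also have "\<dots> = (LINT t:{0<..}|lborel. exp (- t) * (W (exp (- t)) * f t) - exp (- t) * (g (exp (- t)) * f t))"
      using sq gi unfolding We2 by (intro set_integral_diff(2)[symmetric])
    finally have "\<bar>J\<bar> \<le> (\<integral>t. norm (indicator {0<..} t *\<^sub>R (exp (- t) * (W (exp (- t)) * f t) - exp (- t) * (g (exp (- t)) * f t))) \<partial>lborel)"
      unfolding set_lebesgue_integral_def using integral_norm_bound by fastforce
    also have "\<dots> \<le> (\<integral>t. e * (indicator {0<..} t *\<^sub>R (exp (- t) * \<bar>f t\<bar>)) \<partial>lborel)"
    proof (rule integral_mono)
      show "integrable lborel (\<lambda>t. norm (indicator {0<..} t *\<^sub>R (exp (- t) * (W (exp (- t)) * f t) - exp (- t) * (g (exp (- t)) * f t))))"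
        using set_integral_diff(1)[OF sq gi] unfolding We2 set_integrable_def by (rule integrable_norm)
      show "integrable lborel (\<lambda>t. e * (indicator {0<..} t *\<^sub>R (exp (- t) * \<bar>f t\<bar>)))"
        using damped_norm_integrable[OF dam] unfolding set_integrable_def by (intro integrable_mult_right)
      fix t :: real
      show "norm (indicator {0<..} t *\<^sub>R (exp (- t) * (W (exp (- t)) * f t) - exp (- t) * (g (exp (- t)) * f t)))
        \<le> e * (indicator {0<..} t *\<^sub>R (exp (- t) * \<bar>f t\<bar>))"
      proof (cases "0 < t")
        case True
        then have "\<bar>W (exp (- t)) - g (exp (- t))\<bar> \<le> e" by (intro less_imp_le g(2)) auto
        then have "\<bar>W (exp (- t)) - g (exp (- t))\<bar> * (exp (- t) * \<bar>f t\<bar>) \<le> e * (exp (- t) * \<bar>f t\<bar>)"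
          by (intro mult_right_mono) auto
        moreover have "\<bar>exp (- t) * (W (exp (- t)) * f t) - exp (- t) * (g (exp (- t)) * f t)\<bar> = \<bar>W (exp (- t)) - g (exp (- t))\<bar> * (exp (- t) * \<bar>f t\<bar>)"
        proof -
          have "exp (- t) * (W (exp (- t)) * f t) - exp (- t) * (g (exp (- t)) * f t) = (W (exp (- t)) - g (exp (- t))) * (exp (- t) * f t)"
            by (simp add: algebra_simps)
          then show ?thesis by (simp only: abs_mult abs_exp_cancel)
        qed
        ultimately show ?thesis using True by simp
      qed simp
    qed
    also have "\<dots> = e * A" by (simp add: A_def set_lebesgue_integral_def)
    finally show ?thesis .
  qed
  have A0: "0 \<le> A" unfolding A_def set_lebesgue_integral_def by (intro integral_nonneg_AE) auto
  have J0: "J = 0"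
  proof (rule ccontr)
    assume "J \<noteq> 0"
    \<comment> \<open>The accuracy is chosen such that the bound is at most
      \<open>\<bar>J\<bar> / 2\<close>; \<open>A + 1\<close> avoids division by zero.\<close>
    then have "\<bar>J\<bar> \<le> \<bar>J\<bar> / (2 * (A + 1)) * A" using A0 by (intro J) auto
    also have "\<dots> = \<bar>J\<bar> * (A / (2 * (A + 1)))" by simp
    also have "\<dots> \<le> \<bar>J\<bar> * (1 / 2)" using A0 by (intro mult_left_mono) (auto simp: field_simps)
    finally show False using \<open>J \<noteq> 0\<close> by simp
  qed
  \<comment> \<open>An interval of positive length is needed even for \<open>t = 0\<close>, because
    a continuous nonnegative integrand is inferred to vanish from its integral over it.\<close>
  define T where "T = t + 1"
  have T: "0 < T" "t \<in> {0..T}" using t by (auto simp: T_def)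
  let ?F = "\<lambda>s. exp (- 2 * s) * (f s)\<^sup>2"
  have cF: "continuous_on {0..T} ?F" by (intro continuous_intros continuous_on_subset[OF f]) auto
  have sub: "set_integrable lborel {0<..T} ?F" by (rule set_integrable_subset[OF sq]) auto
  have "(LINT s:{0<..T}|lborel. ?F s) \<le> J"
    unfolding J_def set_lebesgue_integral_def
    using sub[unfolded set_integrable_def] sq[unfolded set_integrable_def]
    by (rule integral_mono) (simp add: indicator_def)
  moreover have "(LINT s:{0<..T}|lborel. ?F s) = integral {0<..T} ?F"
    using set_borel_integral_eq_integral(2)[OF sub] .
  moreover have "integral {0<..T} ?F = integral {0..T} ?F"
    by (rule integral_spike_set; rule negligible_subset[OF negligible_sing[of 0]]; force)
  moreover have "0 \<le> integral {0..T} ?F"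
    by (intro integral_nonneg integrable_continuous_real cF) auto
  ultimately have "integral {0..T} ?F = 0" using J0 by simp
  then have "(?F has_integral 0) (cbox 0 T)"
    using integrable_integral[OF integrable_continuous_real[OF cF]] by simp
  then have "?F t = 0"
    by (rule has_integral_0_cbox_imp_0[rotated 2]) (use T cF in auto)
  then show ?thesis by simp
qed

text \<open>Multiplication by \<open>exp (- m * t)\<close> shifts the transform by \<open>m\<close>
  and reduces exponential growth to the bounded case.\<close>

lemma laplace_unique:
  fixes f :: "real \<Rightarrow> real"
  assumes f: "continuous_on {0..} f" and B: "\<And>t. 0 \<le> t \<Longrightarrow> \<bar>f t\<bar> \<le> B * exp (real m * t)"
    and L: "\<And>n::nat. 1 \<le> n \<Longrightarrow> laplace f (real (n + m)) = 0" and t: "0 \<le> t"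
  shows "f t = 0"
proof -
  have "exp (- real m * t) * f t = 0"
  proof (rule laplace_unique_bounded[OF _ _ _ t])
    show "continuous_on {0..} (\<lambda>t. exp (- real m * t) * f t)" by (intro continuous_intros f)
    show "\<bar>exp (- real m * t) * f t\<bar> \<le> B" if "0 \<le> t" for t
    proof -
      have "\<bar>exp (- real m * t) * f t\<bar> \<le> exp (- real m * t) * (B * exp (real m * t))"
        using B[OF that] by (simp add: abs_mult mult_left_mono)
      also have "\<dots> = B" by (simp add: mult.left_commute[of _ B] mult_exp_exp)
      finally show ?thesis .
    qed
    show "laplace (\<lambda>t. exp (- real m * t) * f t) (real n) = 0" if "1 \<le> n" for n
    proof -
      have "exp (- real n * s) * exp (- real m * s) = exp (- real (n + m) * s)" for s
        by (simp add: mult_exp_exp algebra_simps)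
      then have "exp (- real n * s) * (exp (- real m * s) * f s) = exp (- real (n + m) * s) * f s" for s
        by (simp only: mult.assoc[symmetric])
      then show ?thesis using L[OF that] unfolding laplace_def by (simp only:)
    qed
  qed
  then show ?thesis by simp
qed

section \<open>Fractional integrals as convolutions\<close>

definition frac_kernel :: "real \<Rightarrow> real \<Rightarrow> real" where
  "frac_kernel \<kappa> s = s powr (\<kappa> - 1) / Gamma \<kappa>"

lemma frac_kernel_laplace:
  assumes "0 < \<kappa>" "0 < p"
  shows "laplace (frac_kernel \<kappa>) p = p powr (- \<kappa>)"
proof -
  have "laplace (frac_kernel \<kappa>) p = (\<integral>t. (indicator {0<..} t * (t powr (\<kappa> - 1) * exp (- p * t))) / Gamma \<kappa> \<partial>lborel)"
    unfolding laplace_def set_lebesgue_integral_def frac_kernel_def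
    by (intro Bochner_Integration.integral_cong refl) (simp add: mult_ac)
  also have "\<dots> = Gamma \<kappa> / p powr \<kappa> / Gamma \<kappa>"
    using has_bochner_integral_Gamma_scaled[OF assms] by (simp add: has_bochner_integral_iff)
  finally show ?thesis using less_imp_neq[OF Gamma_real_pos[OF assms(1)]] by (simp add: powr_minus_divide)
qed

lemma frac_kernel_damped:
  assumes "0 < \<kappa>"
  shows "damped (frac_kernel \<kappa>)"
proof -
  have "integrable lborel (\<lambda>t. (indicator {0<..} t * (t powr (\<kappa> - 1) * exp (- 1 * t))) / Gamma \<kappa>)"
    using has_bochner_integral_Gamma_scaled[OF assms, of 1] by (intro integrable_divide) (auto simp: has_bochner_integral_iff)
  moreover have "(indicator {0<..} t * (t powr (\<kappa> - 1) * exp (- 1 * t))) / Gamma \<kappa> = indicator {0<..} t *\<^sub>R (exp (- t) * frac_kernel \<kappa> t)" for t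
    by (simp add: frac_kernel_def mult_ac)
  ultimately show ?thesis unfolding damped_def set_integrable_def by (simp only:)
qed

text \<open>The reflection of \<open>s\<close> to \<open>t - s\<close>, together with the passage
  from the Henstock-Kurzweil integral of the definition to the Lebesgue integral, for which Fubini
  and dominated convergence have been set up.\<close>

lemma RL_integral_eq_conv:
  assumes k: "0 < \<kappa>" and h: "continuous_on {0..t} h"
  shows "RL_integral \<kappa> h t = conv (frac_kernel \<kappa>) h t"
proof -
  let ?f = "\<lambda>s. indicator {0<..t} s *\<^sub>R (frac_kernel \<kappa> s * h (t - s))"
  have int: "integrable lborel ?f"
    using conv_set_integrable[OF frac_kernel_damped[OF k] h] by (simp add: set_integrable_def)
  have eq: "?f (t + (-1) * s) = indicator {0..t} s *\<^sub>R ((t - s) powr (\<kappa> - 1) * h s / Gamma \<kappa>)" for s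
    by (auto simp: indicator_def frac_kernel_def)
  have "integrable lborel (\<lambda>s. ?f (t + (-1) * s))"
    by (rule lborel_integrable_real_affine[OF int]) simp
  then have si: "set_integrable lborel {0..t} (\<lambda>s. (t - s) powr (\<kappa> - 1) * h s / Gamma \<kappa>)"
    unfolding eq by (simp add: set_integrable_def)
  have "conv (frac_kernel \<kappa>) h t = (\<integral>s. ?f (t + (-1) * s) \<partial>lborel)"
    unfolding conv_def set_lebesgue_integral_def by (subst lborel_integral_real_affine[of "-1" ?f t]) simp_all
  also have "\<dots> = integral {0..t} (\<lambda>s. (t - s) powr (\<kappa> - 1) * h s / Gamma \<kappa>)"
    unfolding eq using set_borel_integral_eq_integral(2)[OF si] by (simp add: set_lebesgue_integral_def)
  also have "\<dots> = RL_integral \<kappa> h t"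
    unfolding RL_integral_def by (simp add: integral_divide)
  finally show ?thesis by simp
qed

lemma RL_integral_1:
  "RL_integral 1 h t = integral {0..t} h"
proof -
  have "integral {0..t} (\<lambda>s. (t - s) powr (1 - 1) * h s) = integral {0..t} h"
    by (rule integral_spike[of "{t}"]) auto
  then show ?thesis by (simp add: RL_integral_def)
qed

lemma RL_integral_cong:
  assumes "\<And>s. 0 \<le> s \<Longrightarrow> s \<le> t \<Longrightarrow> h s = g s"
  shows "RL_integral \<kappa> h t = RL_integral \<kappa> g t"
  unfolding RL_integral_def using assms by (auto intro!: arg_cong2[where f = "(*)"] integral_cong)

lemma RL_integral_continuous:
  assumes k: "0 < \<kappa>" and h: "continuous_on {0..T} h"
  shows "continuous_on {0..T} (RL_integral \<kappa> h)"
  using conv_continuous[OF frac_kernel_damped[OF k] h]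
  by (rule continuous_on_eq) (use h in \<open>auto intro!: RL_integral_eq_conv[OF k, symmetric] continuous_on_subset[OF h]\<close>)

text \<open>
  Both sides have the Laplace transform of \<open>h\<close> divided by \<open>p\<close>, where \<open>h\<close> is continued
  beyond \<open>T\<close> by its last value.
\<close>

lemma RL_integral_complementary:
  assumes k: "0 < \<kappa>" "\<kappa> < 1" and h: "continuous_on {0..T} h" and t: "0 \<le> t" "t \<le> T"
  shows "RL_integral (1 - \<kappa>) (RL_integral \<kappa> h) t = integral {0..t} h"
proof -
  define h' where "h' u = h (max 0 (min T u))" for u
  have h': "continuous_on S h'" for S
    unfolding h'_def using t by (intro continuous_on_compose2[OF h] continuous_intros) auto
  obtain B where B: "\<And>s. s \<in> {0..T} \<Longrightarrow> \<bar>h s\<bar> \<le> B" using continuous_on_Icc_bounded[OF h] by blast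
  then have B': "\<bar>h' u\<bar> \<le> B" for u using t by (auto simp: h'_def)
  have B0: "0 \<le> B" using order_trans[OF abs_ge_zero B'] .
  have hh: "h' s = h s" if "0 \<le> s" "s \<le> T" for s using that by (simp add: h'_def)
  let ?k = "frac_kernel \<kappa>" and ?l = "frac_kernel (1 - \<kappa>)" and ?j = "frac_kernel 1"
  have dk: "damped ?k" "damped ?l" "damped ?j" using k by (auto intro: frac_kernel_damped)
  have dh: "damped h'" by (rule damped_bounded[OF h' B'])
  define N where "N K = (LINT s:{0<..}|lborel. exp (- s) * \<bar>K s\<bar>)" for K :: "real \<Rightarrow> real"
  have N0: "0 \<le> N K" for K unfolding N_def set_lebesgue_integral_def by (intro integral_nonneg_AE) auto
  have cb: "\<bar>conv K h' s\<bar> \<le> B * exp s * N K" if "damped K" "0 \<le> s" for K s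
    unfolding N_def by (rule conv_exp_bound[OF that(1) h' B' B0])
  have ck: "continuous_on {0..} (conv K h')" if "damped K" for K
    by (rule conv_continuous_atLeast[OF that h'])
  have "conv ?l (conv ?k h') t - conv ?j h' t = 0"
  \<comment> \<open>Each application of \<open>conv_exp_bound\<close> costs one factor
    \<open>exp t\<close>; two nested convolutions explain \<open>m = 2\<close>.\<close>
  proof (rule laplace_unique[where m = 2 and B = "B * N ?k * N ?l + B * N ?j", OF _ _ _ t(1)])
    show "continuous_on {0..} (\<lambda>t. conv ?l (conv ?k h') t - conv ?j h' t)"
      by (intro continuous_on_diff conv_continuous_atLeast ck dk h')
    show "\<bar>conv ?l (conv ?k h') s - conv ?j h' s\<bar> \<le> (B * N ?k * N ?l + B * N ?j) * exp (real 2 * s)" if s: "0 \<le> s" for s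
    proof -
      have "\<bar>conv ?l (conv ?k h') s\<bar> \<le> (B * exp s * N ?k) * exp s * N ?l"
        unfolding N_def[of ?l]
      proof (rule conv_exp_bound[OF dk(2) continuous_on_subset[OF ck[OF dk(1)]]])
        fix r assume r: "0 \<le> r" "r \<le> s"
        have "\<bar>conv ?k h' r\<bar> \<le> B * exp r * N ?k" by (rule cb[OF dk(1) r(1)])
        also have "\<dots> \<le> B * exp s * N ?k" using r B0 N0 by (intro mult_right_mono mult_left_mono) auto
        finally show "\<bar>conv ?k h' r\<bar> \<le> B * exp s * N ?k" .
      qed (use B0 N0 in auto)
      also have "\<dots> = B * N ?k * N ?l * exp (real 2 * s)"
        by (simp add: mult_ac mult_exp_exp)
      finally have 1: "\<bar>conv ?l (conv ?k h') s\<bar> \<le> B * N ?k * N ?l * exp (real 2 * s)" .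
      have "\<bar>conv ?j h' s\<bar> \<le> B * exp s * N ?j" by (rule cb[OF dk(3) s])
      also have "\<dots> \<le> B * exp (real 2 * s) * N ?j" using s B0 N0 by (intro mult_right_mono mult_left_mono) auto
      also have "\<dots> = B * N ?j * exp (real 2 * s)" by (simp only: mult_ac)
      finally show ?thesis
        using 1 abs_triangle_ineq4[of "conv ?l (conv ?k h') s" "conv ?j h' s"] unfolding distrib_right by linarith
    qed
    fix n :: nat assume n: "1 \<le> n"
    let ?p = "real (n + 2)"
    have p: "1 \<le> ?p" "0 < ?p" by auto
    have "laplace (\<lambda>t. conv ?l (conv ?k h') t - conv ?j h' t) ?p = laplace (conv ?l (conv ?k h')) ?p - laplace (conv ?j h') ?p"
      unfolding laplace_def right_diff_distrib
      by (intro set_integral_diff(2) laplace_conv(2) dk dh damped_conv p)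
    also have "\<dots> = (?p powr - (1 - \<kappa>) * ?p powr - \<kappa> - ?p powr - 1) * laplace h' ?p"
    proof -
      have "laplace (conv ?l (conv ?k h')) ?p = laplace ?l ?p * (laplace ?k ?p * laplace h' ?p)"
        by (simp only: laplace_conv(1)[OF dk(2) damped_conv[OF dk(1) dh] p(1)] laplace_conv(1)[OF dk(1) dh p(1)])
      moreover have "laplace (conv ?j h') ?p = laplace ?j ?p * laplace h' ?p"
        by (rule laplace_conv(1)[OF dk(3) dh p(1)])
      moreover have "laplace ?l ?p = ?p powr - (1 - \<kappa>)" by (rule frac_kernel_laplace) (use k p in auto)
      moreover have "laplace ?k ?p = ?p powr - \<kappa>" by (rule frac_kernel_laplace) (use k p in auto)
      moreover have "laplace ?j ?p = ?p powr - 1" by (rule frac_kernel_laplace) (use k p in auto)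
      ultimately show ?thesis by (simp only: left_diff_distrib mult.assoc)
    qed
    also have "?p powr - (1 - \<kappa>) * ?p powr - \<kappa> = ?p powr - 1"
      by (simp add: powr_add[symmetric] del: of_nat_add)
    finally show "laplace (\<lambda>t. conv ?l (conv ?k h') t - conv ?j h' t) ?p = 0" by simp
  qed
  then have "conv ?l (conv ?k h') t = conv ?j h' t" by simp
  also have "conv ?j h' t = integral {0..t} h"
  proof -
    have "conv ?j h' t = RL_integral 1 h' t" by (rule RL_integral_eq_conv[symmetric, OF _ h']) simp
    also have "\<dots> = RL_integral 1 h t" using t by (intro RL_integral_cong hh) auto
    finally show ?thesis by (simp add: RL_integral_1)
  qed
  also have "conv ?l (conv ?k h') t = RL_integral (1 - \<kappa>) (conv ?k h') t"
    using k by (intro RL_integral_eq_conv[symmetric] continuous_on_subset[OF ck[OF dk(1)]]) auto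
  also have "\<dots> = RL_integral (1 - \<kappa>) (RL_integral \<kappa> h) t"
  proof (rule RL_integral_cong)
    fix s assume s: "0 \<le> s" "s \<le> t"
    have "conv ?k h' s = RL_integral \<kappa> h' s" by (rule RL_integral_eq_conv[symmetric, OF k(1) h'])
    also have "\<dots> = RL_integral \<kappa> h s" using s t by (intro RL_integral_cong hh) auto
    finally show "conv ?k h' s = RL_integral \<kappa> h s" .
  qed
  finally show ?thesis .
qed

section \<open>The linear system\<close>

lemma damped_if_integrable:
  assumes "set_integrable lborel {0<..} K"
  shows "damped K"
  unfolding damped_def
proof (rule set_integrable_bound[OF assms])
  have "(\<lambda>s. exp (- s) * (indicator {0<..} s *\<^sub>R K s)) \<in> borel_measurable lborel"
    using borel_measurable_integrable[OF assms[unfolded set_integrable_def]] by measurable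
  then show "set_borel_measurable lborel {0<..} (\<lambda>s. exp (- s) * K s)"
    by (simp add: set_borel_measurable_def mult_ac)
  show "AE s in lborel. s \<in> {0<..} \<longrightarrow> norm (exp (- s) * K s) \<le> norm (K s)"
    by (intro AE_I2) (auto simp: abs_mult intro!: mult_left_le_one_le)
qed

lemma damped_add: "damped u \<Longrightarrow> damped v \<Longrightarrow> damped (\<lambda>t. u t + v t)"
  unfolding damped_def distrib_left by (rule set_integral_add(1))

lemma damped_cmult: "damped u \<Longrightarrow> damped (\<lambda>t. c * u t)"
  unfolding damped_def using set_integrable_mult_right[of c lborel "{0<..}" "\<lambda>s. exp (- s) * u s"]
  by (simp add: mult.left_commute)

lemma laplace_add: "damped u \<Longrightarrow> damped v \<Longrightarrow> 1 \<le> p \<Longrightarrow> laplace (\<lambda>t. u t + v t) p = laplace u p + laplace v p"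
  unfolding laplace_def distrib_left by (intro set_integral_add(2) damped_integrable)

lemma laplace_diff: "damped u \<Longrightarrow> damped v \<Longrightarrow> 1 \<le> p \<Longrightarrow> laplace (\<lambda>t. u t - v t) p = laplace u p - laplace v p"
  unfolding laplace_def right_diff_distrib by (intro set_integral_diff(2) damped_integrable)

lemma laplace_cmult: "laplace (\<lambda>t. c * u t) p = c * laplace u p"
  unfolding laplace_def by (simp add: mult.left_commute[of _ c])

text \<open>Turns an algebraic identity between transforms into an integral equation. No term for an
  initial value occurs, since it will be applied to the deviation of the solution from its initial
  value.\<close>

lemma fractional_equation_by_laplace:
  assumes k: "0 < \<kappa>"
    and y: "continuous_on {0..} y" "\<And>t. 0 \<le> t \<Longrightarrow> \<bar>y t\<bar> \<le> Y"
    and v: "continuous_on {0..} v" "\<And>t. 0 \<le> t \<Longrightarrow> \<bar>v t\<bar> \<le> V"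
    and L: "\<And>p. 1 \<le> p \<Longrightarrow> p powr \<kappa> * laplace y p = laplace v p"
    and t: "0 \<le> t"
  shows "y t = conv (frac_kernel \<kappa>) v t"
proof -
  let ?k = "frac_kernel \<kappa>"
  define N where "N = (LINT s:{0<..}|lborel. exp (- s) * \<bar>?k s\<bar>)"
  have dk: "damped ?k" by (rule frac_kernel_damped[OF k])
  have dy: "damped y" by (rule damped_bounded[OF y])
  have dv: "damped v" by (rule damped_bounded[OF v])
  have Y0: "0 \<le> Y" and V0: "0 \<le> V"
    using order_trans[OF abs_ge_zero y(2)[of 0]] order_trans[OF abs_ge_zero v(2)[of 0]] by auto
  have "y t - conv ?k v t = 0"
  proof (rule laplace_unique[where m = 1 and B = "Y + V * N", OF _ _ _ t])
    show "continuous_on {0..} (\<lambda>t. y t - conv ?k v t)"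
      by (intro continuous_on_diff y conv_continuous_atLeast dk v)
    show "\<bar>y s - conv ?k v s\<bar> \<le> (Y + V * N) * exp (real 1 * s)" if s: "0 \<le> s" for s
    proof -
      have "\<bar>conv ?k v s\<bar> \<le> V * exp s * N"
        unfolding N_def by (rule conv_exp_bound[OF dk continuous_on_subset[OF v(1)]]) (use v(2) V0 in auto)
      moreover have "\<bar>y s\<bar> \<le> Y * exp s"
        using y(2)[OF s] mult_left_mono[of 1 "exp s" Y] Y0 s by simp
      ultimately show ?thesis
        using abs_triangle_ineq4[of "y s" "conv ?k v s"]
        by (simp only: distrib_right mult_1 of_nat_1 mult.assoc mult.commute[of N])
    qed
    fix n :: nat assume "1 \<le> n"
    let ?p = "real (n + 1)"
    have p: "1 \<le> ?p" by simp
    have "laplace (\<lambda>t. y t - conv ?k v t) ?p = laplace y ?p - ?p powr - \<kappa> * laplace v ?p"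
      using frac_kernel_laplace[OF k, of ?p] laplace_conv(1)[OF dk dv p] laplace_diff[OF dy damped_conv[OF dk dv] p] p
      by (simp del: of_nat_add)
    also have "\<dots> = laplace y ?p - (?p powr - \<kappa> * ?p powr \<kappa>) * laplace y ?p"
      by (simp only: L[OF p, symmetric] mult.assoc)
    also have "?p powr - \<kappa> * ?p powr \<kappa> = 1" by (simp add: powr_add[symmetric] del: of_nat_add)
    finally show "laplace (\<lambda>t. y t - conv ?k v t) ?p = 0" by simp
  qed
  then show ?thesis by simp
qed

text \<open>All three follow from one comparison: \<open>(1 + t) / 4\<close> is below
  \<open>1 + t / 2\<close>, below 1 if \<open>t < 1\<close>, and below \<open>t / 2\<close> if
  \<open>t \<ge> 1\<close>. This is the origin of the factor \<open>4 powr a\<close>.\<close>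

lemma weight_half:
  fixes a t :: real
  assumes "0 < a" "0 \<le> t"
  shows "(1 + t / 2) powr (- a) \<le> 4 powr a * (1 + t) powr (- a)"
    and "t < 1 \<Longrightarrow> 1 \<le> 4 powr a * (1 + t) powr (- a)"
    and "1 \<le> t \<Longrightarrow> (t / 2) powr (- a) \<le> 4 powr a * (1 + t) powr (- a)"
proof -
  have e: "4 powr a * (1 + t) powr (- a) = ((1 + t) / 4) powr (- a)"
    using assms by (simp add: powr_divide powr_minus field_simps)
  show "(1 + t / 2) powr (- a) \<le> 4 powr a * (1 + t) powr (- a)"
    unfolding e using assms by (intro powr_mono2') auto
  show "t < 1 \<Longrightarrow> 1 \<le> 4 powr a * (1 + t) powr (- a)"
    using powr_mono2'[of "- a" "(1 + t) / 4" 1] assms unfolding e by simp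
  show "1 \<le> t \<Longrightarrow> (t / 2) powr (- a) \<le> 4 powr a * (1 + t) powr (- a)"
    unfolding e using assms by (intro powr_mono2') auto
qed

locale decaying_kernel =
  fixes K :: "real \<Rightarrow> real" and M a :: real
  assumes int: "set_integrable lborel {0<..} K"
    and tail: "\<And>t. 0 < t \<Longrightarrow> \<bar>K t\<bar> \<le> M * t powr (- 1 - a)"
    and a: "0 < a"
begin

text \<open>The mass pays for the part of a convolution near \<open>s = 0\<close>,
  \<open>M / a\<close> for the tail of the kernel, and \<open>4 powr a\<close> for comparing the
  weights at \<open>t / 2\<close> and \<open>t\<close>.\<close>

definition C_decay :: real where
  "C_decay = 4 powr a * ((LINT s:{0<..}|lborel. \<bar>K s\<bar>) + M / a)"

lemma M_nonneg: "0 \<le> M"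
  using order_trans[OF abs_ge_zero tail[of 1]] by simp

lemma abs_int: "set_integrable lborel {0<..} (\<lambda>s. \<bar>K s\<bar>)"
  using set_integrable_norm[OF int] by simp

lemma mass_nonneg: "0 \<le> (LINT s:{0<..}|lborel. \<bar>K s\<bar>)"
  unfolding set_lebesgue_integral_def by (intro integral_nonneg_AE) auto

lemma C_decay_nonneg: "0 \<le> C_decay"
  using a M_nonneg mass_nonneg by (simp add: C_decay_def)

lemma damped: "damped K"
  by (rule damped_if_integrable[OF int])

lemma local_mass: "(LINT s:{0<..t}|lborel. \<bar>K s\<bar>) \<le> (LINT s:{0<..}|lborel. \<bar>K s\<bar>)"
  unfolding set_lebesgue_integral_def
  using set_integrable_norm[OF damped_local(1)[OF damped]] abs_int
  by (intro integral_mono) (auto simp: set_integrable_def indicator_def)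

lemma tail_mass:
  assumes T: "0 < T"
  shows "(LINT s:{T<..}|lborel. \<bar>K s\<bar>) \<le> M / a * T powr (- a)"
proof -
  have i: "set_integrable lborel {T<..} (\<lambda>s. \<bar>K s\<bar>)"
    by (rule set_integrable_subset[OF abs_int]) (use T in auto)
  have "(LINT s:{T<..}|lborel. \<bar>K s\<bar>) \<le> (LINT s:{T<..}|lborel. M * s powr (- 1 - a))"
    using i set_integrable_mult_right[OF set_integrable_powr_tail(1)[OF a T], of M] tail T
    by (intro set_integral_mono) auto
  also have "\<dots> = M * (T powr (- a) / a)"
    by (simp only: set_integral_mult_right set_integrable_powr_tail(2)[OF a T])
  finally show ?thesis by simp
qed

text \<open>Split at \<open>s = t / 2\<close>. Below it, \<open>h (t - s)\<close> already has the
  weight of \<open>t / 2\<close> and the kernel contributes its mass; above it, \<open>h\<close> is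
  only bounded but the mass of the kernel there is \<open>O(t^(-a))\<close>. For
  \<open>t < 1\<close> the weight is bounded below and the mass alone suffices.\<close>

lemma conv_decay:
  assumes h: "continuous_on {0..} h" and H: "\<And>s. 0 \<le> s \<Longrightarrow> \<bar>h s\<bar> \<le> H * (1 + s) powr (- a)" and t: "0 \<le> t"
  shows "\<bar>conv K h t\<bar> \<le> C_decay * H * (1 + t) powr (- a)"
proof -
  let ?N = "LINT s:{0<..}|lborel. \<bar>K s\<bar>"
  let ?W = "4 powr a * (1 + t) powr (- a)"
  have H0: "0 \<le> H" using order_trans[OF abs_ge_zero H[of 0]] by simp
  have h1: "\<bar>h s\<bar> \<le> H" if "0 \<le> s" for s
  proof -
    have "(1 + s) powr (- a) \<le> 1 powr (- a)" using that a by (intro powr_mono2') auto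
    then have "H * (1 + s) powr (- a) \<le> H * 1" using H0 by (intro mult_left_mono) auto
    then show ?thesis using H[OF that] by simp
  qed
  have ht: "continuous_on {0..t} h" using h by (rule continuous_on_subset) auto
  show ?thesis
  proof (cases "t < 1")
    case True
    have "\<bar>conv K h t\<bar> \<le> H * (LINT s:{0<..t}|lborel. \<bar>K s\<bar>)"
      by (rule conv_bound[OF damped ht]) (use h1 in auto)
    also have "\<dots> \<le> H * ?N" by (intro mult_left_mono local_mass H0)
    also have "\<dots> \<le> H * (?N + M / a)" using H0 M_nonneg a by (intro mult_left_mono) auto
    also have "\<dots> \<le> H * (?N + M / a) * ?W"
      using weight_half(2)[OF a t True] mult_left_mono[of 1 ?W "H * (?N + M / a)"] H0 mass_nonneg M_nonneg a by simp
    also have "\<dots> = C_decay * H * (1 + t) powr (- a)" by (simp only: C_decay_def mult_ac)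
    finally show ?thesis .
  next
    case False
    then have t2: "0 < t / 2" by simp
    let ?g = "\<lambda>s. H * ?W * (indicator {0<..} s *\<^sub>R \<bar>K s\<bar>) + H * (indicator {t / 2<..} s *\<^sub>R \<bar>K s\<bar>)"
    have i: "set_integrable lborel {t / 2<..} (\<lambda>s. \<bar>K s\<bar>)"
      by (rule set_integrable_subset[OF abs_int]) (use t2 in auto)
    have "\<bar>conv K h t\<bar> \<le> (\<integral>s. norm (indicator {0<..t} s *\<^sub>R (K s * h (t - s))) \<partial>lborel)"
      unfolding conv_def set_lebesgue_integral_def using integral_norm_bound by fastforce
    also have "\<dots> \<le> (\<integral>s. ?g s \<partial>lborel)"
    proof (rule integral_mono)
      show "integrable lborel (\<lambda>s. norm (indicator {0<..t} s *\<^sub>R (K s * h (t - s))))"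
        using conv_set_integrable[OF damped ht] unfolding set_integrable_def by (rule integrable_norm)
      show "integrable lborel ?g"
        using abs_int i unfolding set_integrable_def
        by (intro Bochner_Integration.integrable_add integrable_mult_right)
      fix s :: real
      have W0: "0 \<le> ?W" by simp
      show "norm (indicator {0<..t} s *\<^sub>R (K s * h (t - s))) \<le> ?g s"
      proof (cases "0 < s \<and> s \<le> t")
        case True
        show ?thesis
        proof (cases "t / 2 < s")
          case s: True
          have "\<bar>K s\<bar> * \<bar>h (t - s)\<bar> \<le> \<bar>K s\<bar> * H" using True by (intro mult_left_mono h1) auto
          moreover have "0 \<le> H * ?W * \<bar>K s\<bar>" using H0 W0 by (intro mult_nonneg_nonneg) auto
          moreover have "\<bar>K s\<bar> * H = H * \<bar>K s\<bar>" by simp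
          ultimately have "\<bar>K s\<bar> * \<bar>h (t - s)\<bar> \<le> H * ?W * \<bar>K s\<bar> + H * \<bar>K s\<bar>" by linarith
          then show ?thesis using True s by (simp add: abs_mult)
        next
          case s: False
          have "\<bar>h (t - s)\<bar> \<le> H * (1 + (t - s)) powr (- a)" using True by (intro H) auto
          also have "\<dots> \<le> H * (1 + t / 2) powr (- a)"
            using s t a H0 by (intro mult_left_mono powr_mono2') auto
          also have "\<dots> \<le> H * ?W" by (intro mult_left_mono weight_half(1) a t H0)
          finally have "\<bar>K s\<bar> * \<bar>h (t - s)\<bar> \<le> \<bar>K s\<bar> * (H * ?W)" by (intro mult_left_mono) auto
          then show ?thesis using True s by (simp add: abs_mult mult_ac)
        qed
      next
        case False
        have "0 \<le> ?g s" using H0 W0 by (intro add_nonneg_nonneg mult_nonneg_nonneg) auto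
        then show ?thesis using False by (auto simp: indicator_def)
      qed
    qed
    also have "\<dots> = H * ?W * ?N + H * (LINT s:{t / 2<..}|lborel. \<bar>K s\<bar>)"
      using abs_int i unfolding set_integrable_def set_lebesgue_integral_def
      by (simp only: Bochner_Integration.integral_add integrable_mult_right integral_mult_right_zero)
    also have "\<dots> \<le> H * ?W * ?N + H * (M / a * ?W)"
    proof (intro add_left_mono mult_left_mono H0)
      have "M / a * (t / 2) powr (- a) \<le> M / a * ?W"
        using False M_nonneg a t by (intro mult_left_mono weight_half(3)) auto
      then show "(LINT s:{t / 2<..}|lborel. \<bar>K s\<bar>) \<le> M / a * ?W" using tail_mass[OF t2] by linarith
    qed
    also have "\<dots> = C_decay * H * (1 + t) powr (- a)" by (simp only: C_decay_def distrib_left distrib_right mult_ac)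
    finally show ?thesis .
  qed
qed

text \<open>The difference is, up to sign, the integral of the kernel beyond \<open>t\<close>. A
  constant input therefore converges to the total mass instead of decaying.\<close>

lemma conv_const_decay:
  assumes t: "0 \<le> t"
  shows "\<bar>conv K (\<lambda>_. 1) t - (LINT s:{0<..}|lborel. K s)\<bar> \<le> C_decay * (1 + t) powr (- a)"
proof -
  let ?N = "LINT s:{0<..}|lborel. \<bar>K s\<bar>"
  let ?W = "4 powr a * (1 + t) powr (- a)"
  have i1: "set_integrable lborel {0<..t} K" by (rule damped_local(1)[OF damped])
  have i2: "set_integrable lborel {t<..} K" by (rule set_integrable_subset[OF int]) (use t in auto)
  have "(LINT s:{0<..}|lborel. K s) = (LINT s:{0<..t} \<union> {t<..}|lborel. K s)"
    by (rule arg_cong[where f = "\<lambda>A. LINT s:A|lborel. K s"]) (use t in auto)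
  also have "\<dots> = (LINT s:{0<..t}|lborel. K s) + (LINT s:{t<..}|lborel. K s)"
    by (rule set_integral_Un[OF _ i1 i2]) auto
  finally have "\<bar>conv K (\<lambda>_. 1) t - (LINT s:{0<..}|lborel. K s)\<bar> = \<bar>LINT s:{t<..}|lborel. K s\<bar>"
    by (simp add: conv_def)
  also have "\<dots> \<le> (LINT s:{t<..}|lborel. \<bar>K s\<bar>)"
    using set_integral_norm_bound[OF i2] by simp
  also have "\<dots> \<le> (?N + M / a) * ?W"
  proof (cases "t < 1")
    case True
    have "(LINT s:{t<..}|lborel. \<bar>K s\<bar>) \<le> ?N"
      unfolding set_lebesgue_integral_def
      using set_integrable_norm[OF i2] abs_int t
      by (intro integral_mono) (auto simp: set_integrable_def indicator_def)
    also have "\<dots> \<le> (?N + M / a) * 1" using M_nonneg a by simp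
    also have "\<dots> \<le> (?N + M / a) * ?W"
      using weight_half(2)[OF a t True] mass_nonneg M_nonneg a by (intro mult_left_mono) auto
    finally show ?thesis .
  next
    case False
    have "(LINT s:{t<..}|lborel. \<bar>K s\<bar>) \<le> M / a * t powr (- a)" by (rule tail_mass) (use False in auto)
    also have "\<dots> \<le> M / a * (t / 2) powr (- a)"
      using False a M_nonneg by (intro mult_left_mono powr_mono2') auto
    also have "\<dots> \<le> M / a * ?W" using False M_nonneg a t by (intro mult_left_mono weight_half(3)) auto
    also have "\<dots> \<le> (?N + M / a) * ?W" using mass_nonneg by (intro mult_right_mono) auto
    finally show ?thesis .
  qed
  also have "\<dots> = C_decay * (1 + t) powr (- a)" by (simp only: C_decay_def mult_ac)
  finally show ?thesis .
qed

end

text \<open>The constant parts \<open>g1\<close>, \<open>g2\<close> of the input contribute their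
  multiples of the masses in the limit. The balance condition says that these cancel
  \<open>x\<close>, so only tails and decaying inputs remain.\<close>

lemma row_decay:
  assumes P: "decaying_kernel P MP a" and Q: "decaying_kernel Q MQ a"
    and h: "continuous_on {0..} h1" "continuous_on {0..} h2"
      "\<And>s. 0 \<le> s \<Longrightarrow> \<bar>h1 s\<bar> \<le> H * (1 + s) powr (- a)" "\<And>s. 0 \<le> s \<Longrightarrow> \<bar>h2 s\<bar> \<le> H * (1 + s) powr (- a)"
    and bal: "x + g1 * (LINT s:{0<..}|lborel. P s) + g2 * (LINT s:{0<..}|lborel. Q s) = 0"
    and t: "0 \<le> t"
  shows "\<bar>x + conv P (\<lambda>s. g1 + h1 s) t + conv Q (\<lambda>s. g2 + h2 s) t\<bar>
    \<le> ((\<bar>g1\<bar> + H) * decaying_kernel.C_decay P MP a + (\<bar>g2\<bar> + H) * decaying_kernel.C_decay Q MQ a) * (1 + t) powr (- a)"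
proof -
  interpret P: decaying_kernel P MP a by fact
  interpret Q: decaying_kernel Q MQ a by fact
  let ?w = "(1 + t) powr (- a)"
  have ht: "continuous_on {0..t} h1" "continuous_on {0..t} h2"
    using h(1,2) by (auto intro: continuous_on_subset)
  have eP: "conv P (\<lambda>s. g1 + h1 s) t = g1 * conv P (\<lambda>_. 1) t + conv P h1 t"
    using conv_add[OF P.damped, of t "\<lambda>_. g1 * 1" h1] conv_cmult[of P g1 "\<lambda>_. 1" t] ht by simp
  have eQ: "conv Q (\<lambda>s. g2 + h2 s) t = g2 * conv Q (\<lambda>_. 1) t + conv Q h2 t"
    using conv_add[OF Q.damped, of t "\<lambda>_. g2 * 1" h2] conv_cmult[of Q g2 "\<lambda>_. 1" t] ht by simp
  let ?dP = "conv P (\<lambda>_. 1) t - (LINT s:{0<..}|lborel. P s)"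
  let ?dQ = "conv Q (\<lambda>_. 1) t - (LINT s:{0<..}|lborel. Q s)"
  have eq: "x + conv P (\<lambda>s. g1 + h1 s) t + conv Q (\<lambda>s. g2 + h2 s) t = g1 * ?dP + g2 * ?dQ + conv P h1 t + conv Q h2 t"
    unfolding eP eQ using bal by (simp add: algebra_simps)
  have b1: "\<bar>g1 * ?dP\<bar> \<le> \<bar>g1\<bar> * (P.C_decay * ?w)"
    unfolding abs_mult by (intro mult_left_mono P.conv_const_decay t) auto
  have b2: "\<bar>g2 * ?dQ\<bar> \<le> \<bar>g2\<bar> * (Q.C_decay * ?w)"
    unfolding abs_mult by (intro mult_left_mono Q.conv_const_decay t) auto
  have b3: "\<bar>conv P h1 t\<bar> \<le> P.C_decay * H * ?w" by (rule P.conv_decay[OF h(1,3) t])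
  have b4: "\<bar>conv Q h2 t\<bar> \<le> Q.C_decay * H * ?w" by (rule Q.conv_decay[OF h(2,4) t])
  have "((\<bar>g1\<bar> + H) * P.C_decay + (\<bar>g2\<bar> + H) * Q.C_decay) * ?w
    = \<bar>g1\<bar> * (P.C_decay * ?w) + \<bar>g2\<bar> * (Q.C_decay * ?w) + P.C_decay * H * ?w + Q.C_decay * H * ?w"
    by (simp add: algebra_simps)
  then show ?thesis unfolding eq using b1 b2 b3 b4 by linarith
qed

text \<open>\<open>S1\<close>, \<open>S2\<close> are the components of
  \<open>x0 + R * (A x0 + h)\<close> with \<open>*\<close> as convolution, where \<open>R\<close>
  has the transform \<open>(diag(p^a, p^b) - A)^(-1)\<close>. The deviation from \<open>x0\<close>
  starts at 0 and has the forcing \<open>A x0 + h\<close>, so the same kernels carry the initial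
  value. Affinity in \<open>h\<close> is stated separately because it reduces the contraction
  estimate to the bound with zero initial value.\<close>

lemma linear_system_solution:
  fixes a b a11 a12 a21 a22 d :: real
  assumes ab: "0 < a" "a < b" "b \<le> 1"
    and q: "q1 = sin (a * pi / 2) / sin ((a + b) * pi / 2)"
      "q2 = sin (b * pi / 2) / sin ((a + b) * pi / 2)"
    and cond: "stability_condition a b q1 q2 a11 a22 d"
    and d: "d = a11 * a22 - a12 * a21"
  obtains C :: real and S1 S2 :: "real \<Rightarrow> real \<Rightarrow> (real \<Rightarrow> real) \<Rightarrow> (real \<Rightarrow> real) \<Rightarrow> real \<Rightarrow> real"
  where "0 < C"
    "\<And>x1 x2 h1 h2. continuous_on {0..} h1 \<Longrightarrow> continuous_on {0..} h2 \<Longrightarrow>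
      continuous_on {0..} (S1 x1 x2 h1 h2) \<and> continuous_on {0..} (S2 x1 x2 h1 h2)"
    "\<And>x1 x2 h1 h2 H t. continuous_on {0..} h1 \<Longrightarrow> continuous_on {0..} h2 \<Longrightarrow>
      (\<And>s. 0 \<le> s \<Longrightarrow> \<bar>h1 s\<bar> \<le> H * (1 + s) powr (- a)) \<Longrightarrow> (\<And>s. 0 \<le> s \<Longrightarrow> \<bar>h2 s\<bar> \<le> H * (1 + s) powr (- a)) \<Longrightarrow> 0 \<le> t \<Longrightarrow>
      \<bar>S1 x1 x2 h1 h2 t\<bar> \<le> C * (\<bar>x1\<bar> + \<bar>x2\<bar> + H) * (1 + t) powr (- a) \<and>
      \<bar>S2 x1 x2 h1 h2 t\<bar> \<le> C * (\<bar>x1\<bar> + \<bar>x2\<bar> + H) * (1 + t) powr (- a) \<and>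
      S1 x1 x2 h1 h2 t = x1 + conv (frac_kernel a) (\<lambda>s. a11 * S1 x1 x2 h1 h2 s + a12 * S2 x1 x2 h1 h2 s + h1 s) t \<and>
      S2 x1 x2 h1 h2 t = x2 + conv (frac_kernel b) (\<lambda>s. a21 * S1 x1 x2 h1 h2 s + a22 * S2 x1 x2 h1 h2 s + h2 s) t"
    "\<And>x1 x2 h1 h2 k1 k2 t. continuous_on {0..} h1 \<Longrightarrow> continuous_on {0..} h2 \<Longrightarrow>
      continuous_on {0..} k1 \<Longrightarrow> continuous_on {0..} k2 \<Longrightarrow> 0 \<le> t \<Longrightarrow>
      S1 x1 x2 h1 h2 t - S1 x1 x2 k1 k2 t = S1 0 0 (\<lambda>s. h1 s - k1 s) (\<lambda>s. h2 s - k2 s) t \<and>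
      S2 x1 x2 h1 h2 t - S2 x1 x2 k1 k2 t = S2 0 0 (\<lambda>s. h1 s - k1 s) (\<lambda>s. h2 s - k2 s) t"
proof -
  have dpos: "d > 0" using cond by (simp add: stability_condition_def)
  define D where "D p = p powr (a + b) - a11 * p powr b - a22 * p powr a + d" for p
  have D0: "D p \<noteq> 0" if "1 \<le> p" for p
  proof -
    have "char_fun a b a11 a22 d (Complex (ln p) 0) = of_real (D p)"
      unfolding char_fun_def exp_of_real_mult_Complex using that by (simp add: D_def)
    then show ?thesis using char_fun_nonzero[OF ab q cond, of 0 "ln p"] by auto
  qed
  have ker: "\<exists>K M. decaying_kernel K M a \<and> (\<forall>p\<ge>1. laplace K p = (c0 + c1 * p powr a + c2 * p powr b) / D p)
    \<and> (LINT s:{0<..}|lborel. K s) = c0 / d" for c0 c1 c2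
  proof -
    obtain K M where K: "set_integrable lborel {0<..} K" "\<And>t. 0 < t \<Longrightarrow> \<bar>K t\<bar> \<le> M * t powr (- 1 - a)"
      "\<And>p. 0 < p \<Longrightarrow> (LINT t:{0<..}|lborel. exp (- p * t) * K t) =
        (c0 + c1 * p powr a + c2 * p powr b) / (p powr (a + b) - a11 * p powr b - a22 * p powr a + d)"
      "(LINT t:{0<..}|lborel. K t) = c0 / d"
      by (rule system_kernel_exists[OF ab q cond, of c0 c1 c2]) blast
    have "decaying_kernel K M a" by standard (use K(1,2) ab in auto)
    moreover have "laplace K p = (c0 + c1 * p powr a + c2 * p powr b) / D p" if "1 \<le> p" for p
      using K(3)[of p] that by (simp add: laplace_def D_def)
    ultimately show ?thesis using K(4) by blast
  qed
  \<comment> \<open>The four numerators are the entries of the adjugate of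
    \<open>diag(p^a, p^b) - A\<close>; setting the powers to zero shows that the masses are the
    entries of \<open>- A^(-1)\<close>.\<close>
  obtain R11 M11 where R11: "decaying_kernel R11 M11 a" "\<And>p. 1 \<le> p \<Longrightarrow> laplace R11 p = (- a22 + 0 * p powr a + 1 * p powr b) / D p"
    "(LINT s:{0<..}|lborel. R11 s) = - a22 / d" using ker[of "- a22" 0 1] by blast
  obtain R12 M12 where R12: "decaying_kernel R12 M12 a" "\<And>p. 1 \<le> p \<Longrightarrow> laplace R12 p = (a12 + 0 * p powr a + 0 * p powr b) / D p"
    "(LINT s:{0<..}|lborel. R12 s) = a12 / d" using ker[of a12 0 0] by blast
  obtain R21 M21 where R21: "decaying_kernel R21 M21 a" "\<And>p. 1 \<le> p \<Longrightarrow> laplace R21 p = (a21 + 0 * p powr a + 0 * p powr b) / D p"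
    "(LINT s:{0<..}|lborel. R21 s) = a21 / d" using ker[of a21 0 0] by blast
  obtain R22 M22 where R22: "decaying_kernel R22 M22 a" "\<And>p. 1 \<le> p \<Longrightarrow> laplace R22 p = (- a11 + 1 * p powr a + 0 * p powr b) / D p"
    "(LINT s:{0<..}|lborel. R22 s) = - a11 / d" using ker[of "- a11" 1 0] by blast
  have dam: "damped R11" "damped R12" "damped R21" "damped R22"
    using R11(1) R12(1) R21(1) R22(1) by (auto intro: decaying_kernel.damped)
  define c11 where "c11 = decaying_kernel.C_decay R11 M11 a"
  define c12 where "c12 = decaying_kernel.C_decay R12 M12 a"
  define c21 where "c21 = decaying_kernel.C_decay R21 M21 a"
  define c22 where "c22 = decaying_kernel.C_decay R22 M22 a"
  have c: "0 \<le> c11" "0 \<le> c12" "0 \<le> c21" "0 \<le> c22"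
    unfolding c11_def c12_def c21_def c22_def
    using R11(1) R12(1) R21(1) R22(1) by (auto intro: decaying_kernel.C_decay_nonneg)
  define s where "s = \<bar>a11\<bar> + \<bar>a12\<bar> + \<bar>a21\<bar> + \<bar>a22\<bar>"
  \<comment> \<open>\<open>s\<close> bounds the components of \<open>A x0\<close> by
    \<open>s * (\<bar>x1\<bar> + \<bar>x2\<bar>)\<close>, the remaining 1 in \<open>s + 1\<close>
    accounts for \<open>H\<close>, and the last summand makes \<open>C\<close> positive.\<close>
  define C where "C = (s + 1) * (c11 + c12 + c21 + c22) + 1"
  define G1 where "G1 x1 x2 = a11 * x1 + a12 * x2" for x1 x2
  define G2 where "G2 x1 x2 = a21 * x1 + a22 * x2" for x1 x2
  define S1 where "S1 x1 x2 h1 h2 t = x1 + conv R11 (\<lambda>s. G1 x1 x2 + h1 s) t + conv R12 (\<lambda>s. G2 x1 x2 + h2 s) t" for x1 x2 h1 h2 t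
  define S2 where "S2 x1 x2 h1 h2 t = x2 + conv R21 (\<lambda>s. G1 x1 x2 + h1 s) t + conv R22 (\<lambda>s. G2 x1 x2 + h2 s) t" for x1 x2 h1 h2 t
  have Cpos: "0 < C" using c by (simp add: C_def s_def add_nonneg_pos)
  have cont: "continuous_on {0..} (S1 x1 x2 h1 h2) \<and> continuous_on {0..} (S2 x1 x2 h1 h2)"
    if "continuous_on {0..} h1" "continuous_on {0..} h2" for x1 x2 h1 h2
    unfolding S1_def S2_def
    by (intro conjI continuous_on_add continuous_on_const conv_continuous_atLeast dam that)
  have diff: "S1 x1 x2 h1 h2 t - S1 x1 x2 k1 k2 t = S1 0 0 (\<lambda>s. h1 s - k1 s) (\<lambda>s. h2 s - k2 s) t \<and>
      S2 x1 x2 h1 h2 t - S2 x1 x2 k1 k2 t = S2 0 0 (\<lambda>s. h1 s - k1 s) (\<lambda>s. h2 s - k2 s) t"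
    if h: "continuous_on {0..} h1" "continuous_on {0..} h2" "continuous_on {0..} k1" "continuous_on {0..} k2" "0 \<le> t"
    for x1 x2 h1 h2 k1 k2 t
  proof -
    have "conv R (\<lambda>s. g + h s) t - conv R (\<lambda>s. g + k s) t = conv R (\<lambda>s. 0 + (h s - k s)) t"
      if "damped R" "continuous_on {0..} h" "continuous_on {0..} k" for R h k g
    proof -
      have "continuous_on {0..t} (\<lambda>s. g + h s)" "continuous_on {0..t} (\<lambda>s. g + k s)"
        using that by (auto intro!: continuous_intros intro: continuous_on_subset)
      from conv_diff[OF that(1) this] show ?thesis by simp
    qed
    note e = this[OF dam(1) h(1,3), of "G1 x1 x2"] this[OF dam(2) h(2,4), of "G2 x1 x2"]
      this[OF dam(3) h(1,3), of "G1 x1 x2"] this[OF dam(4) h(2,4), of "G2 x1 x2"]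
    have "G1 0 0 = 0" "G2 0 0 = 0" by (simp_all add: G1_def G2_def)
    then show ?thesis unfolding S1_def S2_def using e by simp
  qed
  have main: "\<bar>S1 x1 x2 h1 h2 t\<bar> \<le> C * (\<bar>x1\<bar> + \<bar>x2\<bar> + H) * (1 + t) powr (- a) \<and>
      \<bar>S2 x1 x2 h1 h2 t\<bar> \<le> C * (\<bar>x1\<bar> + \<bar>x2\<bar> + H) * (1 + t) powr (- a) \<and>
      S1 x1 x2 h1 h2 t = x1 + conv (frac_kernel a) (\<lambda>s. a11 * S1 x1 x2 h1 h2 s + a12 * S2 x1 x2 h1 h2 s + h1 s) t \<and>
      S2 x1 x2 h1 h2 t = x2 + conv (frac_kernel b) (\<lambda>s. a21 * S1 x1 x2 h1 h2 s + a22 * S2 x1 x2 h1 h2 s + h2 s) t"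
    if h: "continuous_on {0..} h1" "continuous_on {0..} h2"
      "\<And>s. 0 \<le> s \<Longrightarrow> \<bar>h1 s\<bar> \<le> H * (1 + s) powr (- a)" "\<And>s. 0 \<le> s \<Longrightarrow> \<bar>h2 s\<bar> \<le> H * (1 + s) powr (- a)"
      and t: "0 \<le> t" for x1 x2 h1 h2 H t
  proof -
    have H0: "0 \<le> H" using order_trans[OF abs_ge_zero h(3)[of 0]] by simp
    let ?X = "\<bar>x1\<bar> + \<bar>x2\<bar>"
    have s0: "0 \<le> s" by (simp add: s_def)
    have g1: "\<bar>G1 x1 x2\<bar> \<le> s * ?X" and g2: "\<bar>G2 x1 x2\<bar> \<le> s * ?X"
    proof -
      have 1: "\<bar>u\<bar> * \<bar>x\<bar> \<le> \<bar>u\<bar> * ?X" if "x = x1 \<or> x = x2" for u x :: real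
        using that by (intro mult_left_mono) auto
      have 2: "0 \<le> \<bar>u\<bar> * ?X" for u :: real by simp
      have sX: "s * ?X = \<bar>a11\<bar> * ?X + \<bar>a12\<bar> * ?X + \<bar>a21\<bar> * ?X + \<bar>a22\<bar> * ?X" by (simp add: s_def algebra_simps)
      show "\<bar>G1 x1 x2\<bar> \<le> s * ?X"
        using abs_triangle_ineq[of "a11 * x1" "a12 * x2"] 1[of x1 a11] 1[of x2 a12] 2[of a21] 2[of a22]
        unfolding G1_def sX abs_mult by linarith
      show "\<bar>G2 x1 x2\<bar> \<le> s * ?X"
        using abs_triangle_ineq[of "a21 * x1" "a22 * x2"] 1[of x1 a21] 1[of x2 a22] 2[of a11] 2[of a12]
        unfolding G2_def sX abs_mult by linarith
    qed
    have gH: "\<bar>g\<bar> + H \<le> (s + 1) * (?X + H)" if "\<bar>g\<bar> \<le> s * ?X" for g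
    proof -
      have "(s + 1) * (?X + H) = s * ?X + s * H + \<bar>x1\<bar> + \<bar>x2\<bar> + H" by (simp add: algebra_simps)
      then show ?thesis using that mult_nonneg_nonneg[OF s0 H0] abs_ge_zero[of x1] abs_ge_zero[of x2] by linarith
    qed
    have fin: "((\<bar>u\<bar> + H) * c + (\<bar>v\<bar> + H) * c') * w \<le> C * (?X + H) * w"
      if "\<bar>u\<bar> \<le> s * ?X" "\<bar>v\<bar> \<le> s * ?X" "0 \<le> c" "0 \<le> c'" "c + c' \<le> c11 + c12 + c21 + c22" "0 \<le> w" for u v c c' w
    proof (rule mult_right_mono[OF _ that(6)])
      have "(\<bar>u\<bar> + H) * c + (\<bar>v\<bar> + H) * c' \<le> (s + 1) * (?X + H) * c + (s + 1) * (?X + H) * c'"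
        by (intro add_mono mult_right_mono gH that)
      also have "\<dots> = (s + 1) * (?X + H) * (c + c')" by (simp only: distrib_left)
      also have "\<dots> \<le> (s + 1) * (?X + H) * (c11 + c12 + c21 + c22)"
        using s0 H0 by (intro mult_left_mono that) auto
      also have "\<dots> \<le> C * (?X + H)" using H0 by (simp add: C_def algebra_simps)
      finally show "(\<bar>u\<bar> + H) * c + (\<bar>v\<bar> + H) * c' \<le> C * (?X + H)" .
    qed
    have bal1: "x1 + G1 x1 x2 * (LINT s:{0<..}|lborel. R11 s) + G2 x1 x2 * (LINT s:{0<..}|lborel. R12 s) = 0"
    proof -
      \<comment> \<open>The first row of \<open>x0 - A^(-1) A x0 = 0\<close>, multiplied by the
        determinant.\<close>
      have "x1 * d + G1 x1 x2 * (- a22) + G2 x1 x2 * a12 = 0" by (simp add: G1_def G2_def d algebra_simps)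
      then show ?thesis unfolding R11(3) R12(3) using dpos by (simp add: field_simps)
    qed
    have bal2: "x2 + G1 x1 x2 * (LINT s:{0<..}|lborel. R21 s) + G2 x1 x2 * (LINT s:{0<..}|lborel. R22 s) = 0"
    proof -
      have "x2 * d + G1 x1 x2 * a21 + G2 x1 x2 * (- a11) = 0" by (simp add: G1_def G2_def d algebra_simps)
      then show ?thesis unfolding R21(3) R22(3) using dpos by (simp add: field_simps)
    qed
    have B1: "\<bar>S1 x1 x2 h1 h2 t\<bar> \<le> C * (?X + H) * (1 + t) powr (- a)" if "0 \<le> t" for t
    proof -
      have "\<bar>S1 x1 x2 h1 h2 t\<bar> \<le> ((\<bar>G1 x1 x2\<bar> + H) * c11 + (\<bar>G2 x1 x2\<bar> + H) * c12) * (1 + t) powr (- a)"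
        unfolding S1_def c11_def c12_def by (rule row_decay[OF R11(1) R12(1) h bal1 that])
      also have "\<dots> \<le> C * (?X + H) * (1 + t) powr (- a)" by (rule fin[OF g1 g2]) (use c in auto)
      finally show ?thesis .
    qed
    have B2: "\<bar>S2 x1 x2 h1 h2 t\<bar> \<le> C * (?X + H) * (1 + t) powr (- a)" if "0 \<le> t" for t
    proof -
      have "\<bar>S2 x1 x2 h1 h2 t\<bar> \<le> ((\<bar>G1 x1 x2\<bar> + H) * c21 + (\<bar>G2 x1 x2\<bar> + H) * c22) * (1 + t) powr (- a)"
        unfolding S2_def c21_def c22_def by (rule row_decay[OF R21(1) R22(1) h bal2 that])
      also have "\<dots> \<le> C * (?X + H) * (1 + t) powr (- a)" by (rule fin[OF g1 g2]) (use c in auto)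
      finally show ?thesis .
    qed
    have w1: "(1 + t) powr (- a) \<le> 1" if "0 \<le> t" for t
      using powr_mono2'[of "- a" 1 "1 + t"] that ab by simp
    define B where "B = C * (?X + H)"
    have B0: "0 \<le> B" using Cpos H0 by (simp add: B_def)
    have Bw: "B * (1 + t) powr (- a) \<le> B" if "0 \<le> t" for t
      using mult_left_mono[OF w1[OF that] B0] by simp
    have Hw: "H * (1 + t) powr (- a) \<le> H" if "0 \<le> t" for t
      using mult_left_mono[OF w1[OF that] H0] by simp
    define y1 where "y1 t = conv R11 (\<lambda>s. G1 x1 x2 + h1 s) t + conv R12 (\<lambda>s. G2 x1 x2 + h2 s) t" for t
    define y2 where "y2 t = conv R21 (\<lambda>s. G1 x1 x2 + h1 s) t + conv R22 (\<lambda>s. G2 x1 x2 + h2 s) t" for t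
    have Sy: "S1 x1 x2 h1 h2 t = x1 + y1 t" "S2 x1 x2 h1 h2 t = x2 + y2 t" for t
      by (simp_all add: S1_def S2_def y1_def y2_def)
    have cy: "continuous_on {0..} y1" "continuous_on {0..} y2"
      unfolding y1_def y2_def by (intro continuous_on_add continuous_on_const conv_continuous_atLeast dam h)+
    have by1: "\<bar>y1 t\<bar> \<le> B + \<bar>x1\<bar>" if "0 \<le> t" for t
      using B1[OF that] Bw[OF that] unfolding Sy B_def by linarith
    have by2: "\<bar>y2 t\<bar> \<le> B + \<bar>x2\<bar>" if "0 \<le> t" for t
      using B2[OF that] Bw[OF that] unfolding Sy B_def by linarith
    let ?F1 = "\<lambda>s. G1 x1 x2 + h1 s" and ?F2 = "\<lambda>s. G2 x1 x2 + h2 s"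
    have cF: "continuous_on {0..} ?F1" "continuous_on {0..} ?F2" by (intro continuous_intros h)+
    have bF1: "\<bar>?F1 t\<bar> \<le> \<bar>G1 x1 x2\<bar> + H" if "0 \<le> t" for t
      using h(3)[OF that] Hw[OF that] by linarith
    have bF2: "\<bar>?F2 t\<bar> \<le> \<bar>G2 x1 x2\<bar> + H" if "0 \<le> t" for t
      using h(4)[OF that] Hw[OF that] by linarith
    have dF: "damped ?F1" "damped ?F2" by (rule damped_bounded[OF cF(1) bF1], assumption, rule damped_bounded[OF cF(2) bF2])
    have dy: "damped y1" "damped y2" by (rule damped_bounded[OF cy(1) by1], assumption, rule damped_bounded[OF cy(2) by2])
    have Ly: "laplace y1 p = ((p powr b - a22) * laplace ?F1 p + a12 * laplace ?F2 p) / D p"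
      "laplace y2 p = (a21 * laplace ?F1 p + (p powr a - a11) * laplace ?F2 p) / D p" if p: "1 \<le> p" for p
    proof -
      have "laplace y1 p = laplace R11 p * laplace ?F1 p + laplace R12 p * laplace ?F2 p"
        unfolding y1_def using dam dF p by (simp add: laplace_add damped_conv laplace_conv(1))
      then show "laplace y1 p = ((p powr b - a22) * laplace ?F1 p + a12 * laplace ?F2 p) / D p"
        unfolding R11(2)[OF p] R12(2)[OF p] by (simp add: add_divide_distrib[symmetric] diff_divide_distrib[symmetric])
      have "laplace y2 p = laplace R21 p * laplace ?F1 p + laplace R22 p * laplace ?F2 p"
        unfolding y2_def using dam dF p by (simp add: laplace_add damped_conv laplace_conv(1))
      then show "laplace y2 p = (a21 * laplace ?F1 p + (p powr a - a11) * laplace ?F2 p) / D p"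
        unfolding R21(2)[OF p] R22(2)[OF p] by (simp add: add_divide_distrib[symmetric] diff_divide_distrib[symmetric])
    qed
    \<comment> \<open>\<open>D p\<close> is the determinant of \<open>diag(p^a, p^b) - A\<close>, so
      multiplying by the matrix undoes its adjugate quotient; this is how both equations below are
      checked on the transform side.\<close>
    have Deq: "D p = (p powr a - a11) * (p powr b - a22) - a12 * a21" for p
      by (simp add: D_def d powr_add algebra_simps)
    have E1: "y1 t = conv (frac_kernel a) (\<lambda>s. a11 * y1 s + a12 * y2 s + ?F1 s) t"
    proof (rule fractional_equation_by_laplace[OF ab(1) cy(1) by1 _ _ _ t])
      show "continuous_on {0..} (\<lambda>s. a11 * y1 s + a12 * y2 s + ?F1 s)"
        by (intro continuous_intros cy h)
      show "\<bar>a11 * y1 t + a12 * y2 t + ?F1 t\<bar> \<le> \<bar>a11\<bar> * (B + \<bar>x1\<bar>) + \<bar>a12\<bar> * (B + \<bar>x2\<bar>) + (\<bar>G1 x1 x2\<bar> + H)"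
        if "0 \<le> t" for t
        using mult_left_mono[OF by1[OF that] abs_ge_zero, of a11] mult_left_mono[OF by2[OF that] abs_ge_zero, of a12]
          bF1[OF that] abs_triangle_ineq[of "a11 * y1 t + a12 * y2 t" "?F1 t"] abs_triangle_ineq[of "a11 * y1 t" "a12 * y2 t"]
        unfolding abs_mult by linarith
      show "p powr a * laplace y1 p = laplace (\<lambda>s. a11 * y1 s + a12 * y2 s + ?F1 s) p" if p: "1 \<le> p" for p
      proof -
        have "laplace (\<lambda>s. a11 * y1 s + a12 * y2 s + ?F1 s) p = a11 * laplace y1 p + a12 * laplace y2 p + laplace ?F1 p"
          using dy dF p by (simp add: laplace_add laplace_cmult damped_add damped_cmult)
        moreover have "(p powr a - a11) * laplace y1 p - a12 * laplace y2 p = laplace ?F1 p * D p / D p"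
          unfolding Ly[OF p] Deq by (simp add: diff_divide_distrib[symmetric] algebra_simps)
        ultimately show ?thesis using D0[OF p] by (simp add: algebra_simps)
      qed
    qed
    have E2: "y2 t = conv (frac_kernel b) (\<lambda>s. a21 * y1 s + a22 * y2 s + ?F2 s) t"
    proof (rule fractional_equation_by_laplace[OF _ cy(2) by2 _ _ _ t])
      show "0 < b" using ab by simp
      show "continuous_on {0..} (\<lambda>s. a21 * y1 s + a22 * y2 s + ?F2 s)"
        by (intro continuous_intros cy h)
      show "\<bar>a21 * y1 t + a22 * y2 t + ?F2 t\<bar> \<le> \<bar>a21\<bar> * (B + \<bar>x1\<bar>) + \<bar>a22\<bar> * (B + \<bar>x2\<bar>) + (\<bar>G2 x1 x2\<bar> + H)"
        if "0 \<le> t" for t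
        using mult_left_mono[OF by1[OF that] abs_ge_zero, of a21] mult_left_mono[OF by2[OF that] abs_ge_zero, of a22]
          bF2[OF that] abs_triangle_ineq[of "a21 * y1 t + a22 * y2 t" "?F2 t"] abs_triangle_ineq[of "a21 * y1 t" "a22 * y2 t"]
        unfolding abs_mult by linarith
      show "p powr b * laplace y2 p = laplace (\<lambda>s. a21 * y1 s + a22 * y2 s + ?F2 s) p" if p: "1 \<le> p" for p
      proof -
        have "laplace (\<lambda>s. a21 * y1 s + a22 * y2 s + ?F2 s) p = a21 * laplace y1 p + a22 * laplace y2 p + laplace ?F2 p"
          using dy dF p by (simp add: laplace_add laplace_cmult damped_add damped_cmult)
        moreover have "(p powr b - a22) * laplace y2 p - a21 * laplace y1 p = laplace ?F2 p * D p / D p"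
          unfolding Ly[OF p] Deq by (simp add: diff_divide_distrib[symmetric] algebra_simps)
        ultimately show ?thesis using D0[OF p] by (simp add: algebra_simps)
      qed
    qed
    have e: "a11 * S1 x1 x2 h1 h2 s + a12 * S2 x1 x2 h1 h2 s + h1 s = a11 * y1 s + a12 * y2 s + ?F1 s"
      "a21 * S1 x1 x2 h1 h2 s + a22 * S2 x1 x2 h1 h2 s + h2 s = a21 * y1 s + a22 * y2 s + ?F2 s" for s
      unfolding Sy G1_def G2_def by (simp_all add: algebra_simps)
    show ?thesis
      unfolding e using B1[OF t] B2[OF t] E1 E2 Sy(1)[of t] Sy(2)[of t] by linarith
  qed
  show ?thesis by (rule that[OF Cpos cont main diff])
qed

section \<open>Caputo equations as Volterra equations\<close>

text \<open>By \<open>RL_integral_complementary\<close>, the integral of order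
  \<open>1 - \<kappa>\<close> of \<open>y - y 0\<close> is the ordinary integral of
  \<open>v\<close>, whose derivative is \<open>v t\<close>. Order 1 is separate because the Caputo
  derivative is defined differently there.\<close>

lemma has_caputo_derivative_of_RL_integral:
  assumes k: "0 < \<kappa>" "\<kappa> \<le> 1" and v: "continuous_on {0..} v"
    and y: "\<And>s. 0 \<le> s \<Longrightarrow> y s = y0 + RL_integral \<kappa> v s" and t: "0 < t"
  shows "has_caputo_derivative \<kappa> y (v t) t"
proof -
  have vT: "continuous_on {0..T} v" for T by (rule continuous_on_subset[OF v]) auto
  have I: "((\<lambda>s. integral {0..s} v) has_real_derivative v t) (at t)"
  proof -
    have "((\<lambda>s. integral {0..s} v) has_real_derivative v t) (at t within {0..t + 1})"
      by (rule integral_has_real_derivative[OF vT]) (use t in auto)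
    moreover have "at t within {0..t + 1} = at t" by (rule at_within_interior) (use t in auto)
    ultimately show ?thesis by simp
  qed
  have y00: "y 0 = y0" using y[of 0] by (simp add: RL_integral_def)
  show ?thesis
  proof (cases "\<kappa> = 1")
    case True
    have "((\<lambda>s. y0 + integral {0..s} v) has_real_derivative v t) (at t)"
      using I by (auto intro!: derivative_eq_intros)
    then have "(y has_real_derivative v t) (at t)"
      by (rule has_field_derivative_transform_within_open[of _ _ _ "{0<..}"])
        (use t y True in \<open>auto simp: RL_integral_1\<close>)
    then show ?thesis using True by (simp add: has_caputo_derivative_def)
  next
    case False
    have "(RL_integral (1 - \<kappa>) (\<lambda>s. y s - y 0) has_real_derivative v t) (at t)"
    proof (rule has_field_derivative_transform_within_open[OF I, of "{0<..}"])
      fix s :: real assume s: "s \<in> {0<..}"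
      have "RL_integral (1 - \<kappa>) (\<lambda>s. y s - y 0) s = RL_integral (1 - \<kappa>) (RL_integral \<kappa> v) s"
        by (rule RL_integral_cong) (use y y00 in auto)
      also have "\<dots> = integral {0..s} v"
        by (rule RL_integral_complementary[OF _ _ vT]) (use s k False in auto)
      finally show "integral {0..s} v = RL_integral (1 - \<kappa>) (\<lambda>s. y s - y 0) s" ..
    qed (use t in auto)
    then show ?thesis using False by (simp add: has_caputo_derivative_def)
  qed
qed

lemma continuous_eq_if_integrals_eq:
  fixes f g :: "real \<Rightarrow> real"
  assumes "continuous_on {0..T} f" "continuous_on {0..T} g"
    and eq: "\<And>t. 0 \<le> t \<Longrightarrow> t \<le> T \<Longrightarrow> integral {0..t} f = integral {0..t} g"
    and T: "0 < T" and t: "0 \<le> t" "t \<le> T"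
  shows "f t = g t"
proof -
  have "((\<lambda>s. integral {0..s} f) has_real_derivative f t) (at t within {0..T})"
    and g: "((\<lambda>s. integral {0..s} g) has_real_derivative g t) (at t within {0..T})"
    using assms by (auto intro: integral_has_real_derivative)
  then have "((\<lambda>s. integral {0..s} g) has_real_derivative f t) (at t within {0..T})"
    by (elim has_field_derivative_transform_within[of _ _ _ _ 1]) (use eq t in auto)
  then show ?thesis
    using g vector_derivative_unique_within_closed_interval[OF T, of t "\<lambda>s. integral {0..s} g" "f t" "g t"] t
    by (simp add: has_real_derivative_iff_has_vector_derivative)
qed

text \<open>Abel inversion. The integral of order \<open>1 - \<kappa>\<close> of
  \<open>y - y 0\<close> has derivative \<open>v\<close> and vanishes at 0, so it agrees with the
  one of \<open>RL_integral \<kappa> v\<close>. Integrating both to order \<open>\<kappa>\<close>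
  leaves ordinary integrals, and continuous functions with equal integrals agree.\<close>

lemma RL_integral_of_has_caputo_derivative:
  assumes k: "0 < \<kappa>" "\<kappa> \<le> 1" and T: "0 < T"
    and y: "continuous_on {0..T} y" and v: "continuous_on {0..T} v"
    and D: "\<And>s. 0 < s \<Longrightarrow> s < T \<Longrightarrow> has_caputo_derivative \<kappa> y (v s) s"
    and t: "0 \<le> t" "t \<le> T"
  shows "y t = y 0 + RL_integral \<kappa> v t"
proof (cases "\<kappa> = 1")
  case True
  have "(v has_integral (y t - y 0)) {0..t}"
  proof (rule fundamental_theorem_of_calculus_interior)
    show "continuous_on {0..t} y" using y by (rule continuous_on_subset) (use t in auto)
    show "(y has_vector_derivative v s) (at s)" if "s \<in> {0<..<t}" for s
      using D[of s] that t True by (simp add: has_caputo_derivative_def has_real_derivative_iff_has_vector_derivative)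
  qed (use t in auto)
  then show ?thesis using True by (simp add: RL_integral_1 integral_unique)
next
  case False
  then have k: "0 < \<kappa>" "\<kappa> < 1" "0 < 1 - \<kappa>" "1 - \<kappa> < 1" using k by auto
  define z where "z s = y s - y 0" for s
  have z: "continuous_on {0..T} z" unfolding z_def by (intro continuous_intros y)
  define U where "U = RL_integral (1 - \<kappa>) z"
  have U: "continuous_on {0..T} U" unfolding U_def by (rule RL_integral_continuous[OF k(3) z])
  have Uv: "U s = RL_integral (1 - \<kappa>) (RL_integral \<kappa> v) s" if s: "0 \<le> s" "s \<le> T" for s
  proof -
    have "(v has_integral (U s - U 0)) {0..s}"
    proof (rule fundamental_theorem_of_calculus_interior)
      show "continuous_on {0..s} U" using U by (rule continuous_on_subset) (use s in auto)
      show "(U has_vector_derivative v r) (at r)" if "r \<in> {0<..<s}" for r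
        using D[of r] that s False
        by (simp add: has_caputo_derivative_def has_real_derivative_iff_has_vector_derivative U_def z_def[abs_def])
    qed (use s in auto)
    moreover have "U 0 = 0" by (simp add: U_def RL_integral_def)
    ultimately have "U s = integral {0..s} v" by (simp add: integral_unique)
    then show ?thesis using RL_integral_complementary[OF k(1,2) v s] by simp
  qed
  let ?w = "RL_integral \<kappa> v"
  have w: "continuous_on {0..T} ?w" by (rule RL_integral_continuous[OF k(1) v])
  have "z t = ?w t"
  proof (rule continuous_eq_if_integrals_eq[OF z w _ T t])
    fix s assume s: "0 \<le> s" "s \<le> T"
    have "integral {0..s} z = RL_integral \<kappa> U s"
      using RL_integral_complementary[OF k(3,4) z s] by (simp add: U_def)
    also have "\<dots> = RL_integral \<kappa> (RL_integral (1 - \<kappa>) ?w) s"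
      by (rule RL_integral_cong) (use Uv s in auto)
    also have "\<dots> = integral {0..s} ?w"
      using RL_integral_complementary[OF k(3,4) w s] by simp
    finally show "integral {0..s} z = integral {0..s} ?w" .
  qed
  then show ?thesis by (simp add: z_def)
qed

text \<open>Extracting \<open>exp (l * t)\<close> leaves the Laplace transform of the fractional
  kernel at \<open>l\<close>, namely \<open>l powr (- \<kappa>)\<close>. A large \<open>l\<close>
  thus makes the Volterra operator a contraction in the exponentially weighted norm.\<close>

lemma conv_exp_weighted_bound:
  assumes k: "0 < \<kappa>" and l: "0 < l" and h: "continuous_on {0..t} h"
    and H: "\<And>s. 0 \<le> s \<Longrightarrow> s \<le> t \<Longrightarrow> \<bar>h s\<bar> \<le> H * exp (l * s)" and t: "0 \<le> t"
  shows "\<bar>conv (frac_kernel \<kappa>) h t\<bar> \<le> H * l powr (- \<kappa>) * exp (l * t)"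
proof -
  let ?k = "frac_kernel \<kappa>"
  have H0: "0 \<le> H" using order_trans[OF abs_ge_zero H[of 0]] t by simp
  have kp: "0 \<le> ?k s" for s using k Gamma_real_pos[OF k] by (simp add: frac_kernel_def)
  have i: "integrable lborel (\<lambda>s. indicator {0<..} s *\<^sub>R (exp (- l * s) * ?k s))"
  proof -
    have "integrable lborel (\<lambda>s. (indicator {0<..} s * (s powr (\<kappa> - 1) * exp (- l * s))) / Gamma \<kappa>)"
      using has_bochner_integral_Gamma_scaled[OF k l] by (intro integrable_divide) (auto simp: has_bochner_integral_iff)
    moreover have "(indicator {0<..} s * (s powr (\<kappa> - 1) * exp (- l * s))) / Gamma \<kappa> = indicator {0<..} s *\<^sub>R (exp (- l * s) * ?k s)" for s
      by (simp add: frac_kernel_def mult_ac)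
    ultimately show ?thesis by (simp only:)
  qed
  have "\<bar>conv ?k h t\<bar> \<le> (\<integral>s. norm (indicator {0<..t} s *\<^sub>R (?k s * h (t - s))) \<partial>lborel)"
    unfolding conv_def set_lebesgue_integral_def using integral_norm_bound by fastforce
  also have "\<dots> \<le> (\<integral>s. H * exp (l * t) * (indicator {0<..} s *\<^sub>R (exp (- l * s) * ?k s)) \<partial>lborel)"
  proof (rule integral_mono)
    show "integrable lborel (\<lambda>s. norm (indicator {0<..t} s *\<^sub>R (?k s * h (t - s))))"
      using conv_set_integrable[OF frac_kernel_damped[OF k] h] unfolding set_integrable_def by (rule integrable_norm)
    show "integrable lborel (\<lambda>s. H * exp (l * t) * (indicator {0<..} s *\<^sub>R (exp (- l * s) * ?k s)))"
      by (intro integrable_mult_right i)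
    fix s :: real
    show "norm (indicator {0<..t} s *\<^sub>R (?k s * h (t - s))) \<le> H * exp (l * t) * (indicator {0<..} s *\<^sub>R (exp (- l * s) * ?k s))"
    proof (cases "0 < s \<and> s \<le> t")
      case True
      have "?k s * \<bar>h (t - s)\<bar> \<le> ?k s * (H * exp (l * (t - s)))" using True by (intro mult_left_mono H kp) auto
      also have "exp (l * (t - s)) = exp (l * t) * exp (- l * s)" by (simp add: mult_exp_exp algebra_simps)
      finally show ?thesis using True kp[of s] by (simp add: abs_mult mult_ac)
    next
      case False
      have "0 \<le> H * exp (l * t) * (indicator {0<..} s *\<^sub>R (exp (- l * s) * ?k s))"
        using H0 kp by (intro mult_nonneg_nonneg) auto
      then show ?thesis using False by (auto simp: indicator_def)
    qed
  qed
  also have "\<dots> = H * exp (l * t) * laplace ?k l"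
    by (simp add: laplace_def set_lebesgue_integral_def)
  finally show ?thesis by (simp add: frac_kernel_laplace k l mult_ac)
qed

lemma infnorm_2: "infnorm (x :: real ^ 2) = max \<bar>x $ 1\<bar> \<bar>x $ 2\<bar>"
proof -
  have "{\<bar>x \<bullet> i\<bar> |i. i \<in> Basis} = {\<bar>x $ 1\<bar>, \<bar>x $ 2\<bar>}"
    by (auto simp: Basis_vec_def inner_axis UNIV_2 intro: exI[of _ "axis 1 1"] exI[of _ "axis 2 1"])
  then show ?thesis unfolding infnorm_def by (simp add: cSup_insert sup_max)
qed

text \<open>Bielecki's weight instead of a fractional Gronwall inequality: with \<open>l\<close> so
  large that both components contract by 1/2, the maximum \<open>g m\<close> of the weighted
  difference satisfies \<open>g m \<le> g m / 2\<close>.\<close>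

lemma fractional_volterra_unique:
  fixes x y vx vy :: "real \<Rightarrow> real ^ 2" and \<alpha> :: "real ^ 2"
  assumes \<alpha>: "\<And>i. 0 < \<alpha> $ i" and T: "0 \<le> T"
    and cont: "continuous_on {0..T} x" "continuous_on {0..T} y" "continuous_on {0..T} vx" "continuous_on {0..T} vy"
    and x: "\<And>i t. 0 \<le> t \<Longrightarrow> t \<le> T \<Longrightarrow> x t $ i = x0 $ i + RL_integral (\<alpha> $ i) (\<lambda>s. vx s $ i) t"
    and y: "\<And>i t. 0 \<le> t \<Longrightarrow> t \<le> T \<Longrightarrow> y t $ i = x0 $ i + RL_integral (\<alpha> $ i) (\<lambda>s. vy s $ i) t"
    and L: "\<And>s. 0 \<le> s \<Longrightarrow> s \<le> T \<Longrightarrow> infnorm (vx s - vy s) \<le> L * infnorm (x s - y s)"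
    and t: "0 \<le> t" "t \<le> T"
  shows "x t = y t"
proof -
  define L' where "L' = max L 1"
  have L': "0 < L'" "\<And>s. 0 \<le> s \<Longrightarrow> s \<le> T \<Longrightarrow> infnorm (vx s - vy s) \<le> L' * infnorm (x s - y s)"
  proof -
    show "0 < L'" by (simp add: L'_def)
    fix s assume "0 \<le> s" "s \<le> T"
    then have "infnorm (vx s - vy s) \<le> L * infnorm (x s - y s)" by (rule L)
    also have "\<dots> \<le> L' * infnorm (x s - y s)" by (intro mult_right_mono infnorm_pos_le) (simp add: L'_def)
    finally show "infnorm (vx s - vy s) \<le> L' * infnorm (x s - y s)" .
  qed
  have "\<forall>\<^sub>F l in at_top. \<forall>i. L' * l powr (- \<alpha> $ i) \<le> 1 / 2"
  proof (rule eventually_all_finite)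
    fix i
    have "((\<lambda>l. L' * l powr (- \<alpha> $ i)) \<longlongrightarrow> L' * 0) at_top"
      using \<alpha>[of i] by (intro tendsto_intros tendsto_neg_powr filterlim_ident) auto
    then have "\<forall>\<^sub>F l in at_top. L' * l powr (- \<alpha> $ i) < 1 / 2" by (rule order_tendstoD) simp
    then show "\<forall>\<^sub>F l in at_top. L' * l powr (- \<alpha> $ i) \<le> 1 / 2" by (rule eventually_mono) simp
  qed
  then have "\<forall>\<^sub>F l in at_top. (\<forall>i. L' * l powr (- \<alpha> $ i) \<le> 1 / 2) \<and> 0 < l"
    using eventually_gt_at_top[of 0] by (rule eventually_conj)
  then obtain l where l: "\<And>i. L' * l powr (- \<alpha> $ i) \<le> 1 / 2" "0 < l"
    using eventually_happens'[OF trivial_limit_at_top_linorder] by blast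
  define g where "g s = exp (- l * s) * infnorm (x s - y s)" for s
  have "continuous_on {0..T} g"
    unfolding g_def by (intro continuous_intros continuous_on_infnorm cont)
  then obtain m where m: "m \<in> {0..T}" "\<And>s. s \<in> {0..T} \<Longrightarrow> g s \<le> g m"
    using continuous_attains_sup[of "{0..T}" g] T by auto
  have D: "infnorm (x s - y s) \<le> g m * exp (l * s)" if "0 \<le> s" "s \<le> T" for s
  proof -
    have "g s * exp (l * s) \<le> g m * exp (l * s)" using m(2)[of s] that by (intro mult_right_mono) auto
    moreover have "g s * exp (l * s) = infnorm (x s - y s)" by (simp add: g_def exp_minus)
    ultimately show ?thesis by simp
  qed
  have mT: "0 \<le> m" "m \<le> T" using m by auto
  have comp: "\<bar>(x m - y m) $ i\<bar> \<le> g m / 2 * exp (l * m)" for i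
  proof -
    have cvx: "continuous_on {0..m} (\<lambda>s. vx s $ i)" "continuous_on {0..m} (\<lambda>s. vy s $ i)"
      using mT by (auto intro!: continuous_on_component continuous_on_subset[OF cont(3)] continuous_on_subset[OF cont(4)])
    have "(x m - y m) $ i = conv (frac_kernel (\<alpha> $ i)) (\<lambda>s. vx s $ i - vy s $ i) m"
      unfolding conv_diff[OF frac_kernel_damped[OF \<alpha>] cvx]
      using x[OF mT, of i] y[OF mT, of i] RL_integral_eq_conv[OF \<alpha> cvx(1)] RL_integral_eq_conv[OF \<alpha> cvx(2)] by simp
    also have "\<bar>\<dots>\<bar> \<le> (L' * g m) * l powr (- \<alpha> $ i) * exp (l * m)"
    proof (rule conv_exp_weighted_bound[OF \<alpha> l(2) _ _ mT(1)])
      show "continuous_on {0..m} (\<lambda>s. vx s $ i - vy s $ i)" by (intro continuous_intros cvx)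
      fix s assume s: "0 \<le> s" "s \<le> m"
      have "\<bar>vx s $ i - vy s $ i\<bar> \<le> infnorm (vx s - vy s)"
        using exhaust_2[of i] by (auto simp: infnorm_2)
      also have "\<dots> \<le> L' * infnorm (x s - y s)" using s mT by (intro L') auto
      also have "\<dots> \<le> L' * (g m * exp (l * s))" using s mT L' by (intro mult_left_mono D) auto
      finally show "\<bar>vx s $ i - vy s $ i\<bar> \<le> L' * g m * exp (l * s)" by simp
    qed
    also have "\<dots> = (L' * l powr (- \<alpha> $ i)) * (g m * exp (l * m))" by simp
    also have "\<dots> \<le> 1 / 2 * (g m * exp (l * m))"
      using l(1)[of i] by (intro mult_right_mono) (auto simp: g_def infnorm_pos_le)
    finally show ?thesis by simp
  qed
  have "infnorm (x m - y m) \<le> g m / 2 * exp (l * m)"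
    using comp[of 1] comp[of 2] unfolding infnorm_2 by simp
  then have "exp (- l * m) * infnorm (x m - y m) \<le> exp (- l * m) * (g m / 2 * exp (l * m))"
    by (intro mult_left_mono) auto
  also have "\<dots> = g m / 2" by (simp add: exp_minus)
  finally have "g m \<le> g m / 2" by (simp only: g_def)
  then have "g m \<le> 0" by simp
  then have "infnorm (x t - y t) \<le> 0"
    using order_trans[OF D[OF t] mult_right_mono[of "g m" 0 "exp (l * t)"]] by simp
  then show ?thesis using infnorm_pos_le[of "x t - y t"] by (simp add: infnorm_eq_0)
qed

section \<open>The nonlinear system\<close>

lemma norm_le_2_infnorm: "norm (x :: real ^ 2) \<le> 2 * infnorm x"
  using norm_le_l1_cart[of x] by (simp add: infnorm_2 sum_2)

lemma continuous_on_max_ball: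
  assumes lip: "\<And>x y. x \<in> max_ball r \<Longrightarrow> y \<in> max_ball r \<Longrightarrow> infnorm (f x - f y) \<le> l * infnorm (x - y)" and l: "0 \<le> l"
  shows "continuous_on (max_ball r) (f :: real ^ 2 \<Rightarrow> real ^ 2)"
proof (rule lipschitz_on_continuous_on[of "2 * l"], rule lipschitz_onI)
  fix x y assume xy: "x \<in> max_ball r" "y \<in> max_ball r"
  have "norm (f x - f y) \<le> 2 * infnorm (f x - f y)" by (rule norm_le_2_infnorm)
  also have "\<dots> \<le> 2 * (l * infnorm (x - y))" using lip[OF xy] by simp
  also have "\<dots> \<le> 2 * (l * norm (x - y))" using l by (intro mult_left_mono infnorm_le_norm) auto
  finally show "dist (f x) (f y) \<le> 2 * l * dist x y" by (simp add: dist_norm)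
qed (use l in auto)

lemma infnorm_component: "\<bar>x $ i\<bar> \<le> infnorm (x :: real ^ 2)"
  using exhaust_2[of i] by (auto simp: infnorm_2)

text \<open>Banach's fixed point theorem for the variation of constants formula on a ball of radius
  \<open>\<rho>\<close> in the space weighted by \<open>(1 + t) powr a\<close>. The solution is
  returned as a solution of the Volterra equation, the form in which uniqueness is proved.\<close>

lemma fractional_system_small_solution:
  fixes A :: "real ^ 2 ^ 2" and \<alpha> :: "real ^ 2" and f :: "real ^ 2 \<Rightarrow> real ^ 2"
  assumes ab: "0 < \<alpha> $ 1" "\<alpha> $ 1 < \<alpha> $ 2" "\<alpha> $ 2 \<le> 1"
    and q: "q1 = sin (\<alpha> $ 1 * pi / 2) / sin ((\<alpha> $ 1 + \<alpha> $ 2) * pi / 2)"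
      "q2 = sin (\<alpha> $ 2 * pi / 2) / sin ((\<alpha> $ 1 + \<alpha> $ 2) * pi / 2)"
    and cond: "stability_condition (\<alpha> $ 1) (\<alpha> $ 2) q1 q2 (A $ 1 $ 1) (A $ 2 $ 2) (det A)"
    and f0: "f 0 = 0"
    and lip: "\<And>l. 0 < l \<Longrightarrow> \<exists>r>0. \<forall>x\<in>max_ball r. \<forall>y\<in>max_ball r. infnorm (f x - f y) \<le> l * infnorm (x - y)"
    and r1: "0 < r1"
  obtains \<delta> \<rho> where "0 < \<delta>" "0 < \<rho>" "\<rho> \<le> r1"
    "\<And>x0. infnorm x0 \<le> \<delta> \<Longrightarrow> \<exists>\<phi>. continuous_on {0..} \<phi> \<and>
      (\<forall>t\<ge>0. infnorm (\<phi> t) \<le> \<rho> * (1 + t) powr (- \<alpha> $ 1)) \<and>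
      (\<forall>t\<ge>0. \<forall>i. \<phi> t $ i = x0 $ i + RL_integral (\<alpha> $ i) (\<lambda>s. (A *v \<phi> s + f (\<phi> s)) $ i) t)"
proof -
  define a where "a = \<alpha> $ 1"
  define b where "b = \<alpha> $ 2"
  have ab': "0 < a" "a < b" "b \<le> 1" using ab by (simp_all add: a_def b_def)
  have detA: "det A = A $ 1 $ 1 * A $ 2 $ 2 - A $ 1 $ 2 * A $ 2 $ 1" by (rule det_2)
  obtain C S1 S2 where C: "0 < C" and
    cont: "\<And>x1 x2 h1 h2. continuous_on {0..} h1 \<Longrightarrow> continuous_on {0..} h2 \<Longrightarrow>
      continuous_on {0..} (S1 x1 x2 h1 h2) \<and> continuous_on {0..} (S2 x1 x2 h1 h2)" and
    main: "\<And>x1 x2 h1 h2 H t. continuous_on {0..} h1 \<Longrightarrow> continuous_on {0..} h2 \<Longrightarrow>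
      (\<And>s. 0 \<le> s \<Longrightarrow> \<bar>h1 s\<bar> \<le> H * (1 + s) powr (- a)) \<Longrightarrow> (\<And>s. 0 \<le> s \<Longrightarrow> \<bar>h2 s\<bar> \<le> H * (1 + s) powr (- a)) \<Longrightarrow> 0 \<le> t \<Longrightarrow>
      \<bar>S1 x1 x2 h1 h2 t\<bar> \<le> C * (\<bar>x1\<bar> + \<bar>x2\<bar> + H) * (1 + t) powr (- a) \<and>
      \<bar>S2 x1 x2 h1 h2 t\<bar> \<le> C * (\<bar>x1\<bar> + \<bar>x2\<bar> + H) * (1 + t) powr (- a) \<and>
      S1 x1 x2 h1 h2 t = x1 + conv (frac_kernel a) (\<lambda>s. A $ 1 $ 1 * S1 x1 x2 h1 h2 s + A $ 1 $ 2 * S2 x1 x2 h1 h2 s + h1 s) t \<and>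
      S2 x1 x2 h1 h2 t = x2 + conv (frac_kernel b) (\<lambda>s. A $ 2 $ 1 * S1 x1 x2 h1 h2 s + A $ 2 $ 2 * S2 x1 x2 h1 h2 s + h2 s) t" and
    diff: "\<And>x1 x2 h1 h2 k1 k2 t. continuous_on {0..} h1 \<Longrightarrow> continuous_on {0..} h2 \<Longrightarrow>
      continuous_on {0..} k1 \<Longrightarrow> continuous_on {0..} k2 \<Longrightarrow> 0 \<le> t \<Longrightarrow>
      S1 x1 x2 h1 h2 t - S1 x1 x2 k1 k2 t = S1 0 0 (\<lambda>s. h1 s - k1 s) (\<lambda>s. h2 s - k2 s) t \<and>
      S2 x1 x2 h1 h2 t - S2 x1 x2 k1 k2 t = S2 0 0 (\<lambda>s. h1 s - k1 s) (\<lambda>s. h2 s - k2 s) t"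
    by (rule linear_system_solution[OF ab q cond detA, folded a_def b_def]) blast
  \<comment> \<open>Each component contracts by \<open>C * l = 1 / 4\<close>. The norm on the fixed
    point space is built on the Euclidean norm, which is bounded by the sum of two components, hence
    the contraction constant 1/2.\<close>
  define l where "l = 1 / (4 * C)"
  have l: "0 < l" "C * l = 1 / 4" using C by (simp_all add: l_def)
  obtain r where r: "0 < r" "\<And>x y. x \<in> max_ball r \<Longrightarrow> y \<in> max_ball r \<Longrightarrow> infnorm (f x - f y) \<le> l * infnorm (x - y)"
    using lip[OF l(1)] by blast
  define \<rho> where "\<rho> = min r r1"
  have \<rho>: "0 < \<rho>" "\<rho> \<le> r1" using r r1 by (auto simp: \<rho>_def)
  have lf: "infnorm (f x - f y) \<le> l * infnorm (x - y)" if "x \<in> max_ball \<rho>" "y \<in> max_ball \<rho>" for x y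
    using that by (intro r(2)) (auto simp: max_ball_def \<rho>_def)
  have cf: "continuous_on (max_ball \<rho>) f" by (rule continuous_on_max_ball[OF lf]) (use l in auto)
  \<comment> \<open>Chosen so that each component is at most
    \<open>C * (2 * \<delta> + l * \<rho>) = 3 * \<rho> / 8\<close> times the weight. The two
    together give \<open>3 * \<rho> / 4\<close>, so the ball of radius \<open>\<rho>\<close> is
    mapped into itself.\<close>
  define \<delta> where "\<delta> = \<rho> / (16 * C)"
  have \<delta>: "0 < \<delta>" "C * \<delta> = \<rho> / 16" using \<rho> C by (simp_all add: \<delta>_def)
  define w where "w t = (1 + t) powr (- a)" for t :: real
  have w1: "w t \<le> 1" if "0 \<le> t" for t
    using powr_mono2'[of "- a" 1 "1 + t"] that ab' by (simp add: w_def)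
  have w0: "0 \<le> w t" for t by (simp add: w_def)
  have wa: "(1 + t) powr a * w t = 1" if "0 \<le> t" for t
    using that by (simp add: w_def powr_add[symmetric])
  have cw: "continuous_on {0..} w" unfolding w_def by (intro continuous_intros) auto
  \<comment> \<open>The weighted space is modelled by bounded continuous functions \<open>u\<close>
    on the real line, whose completeness is inherited; \<open>X u\<close> is the actual trajectory,
    considered for \<open>t \<ge> 0\<close> only.\<close>
  define X where "X u t = w t *\<^sub>R apply_bcontfun u t" for u :: "(real, real ^ 2) bcontfun" and t
  have cu: "continuous_on S (apply_bcontfun u)" for u :: "(real, real ^ 2) bcontfun" and S
    by (intro continuous_on_apply_bcontfun continuous_on_id)
  have cX: "continuous_on {0..} (X u)" for u unfolding X_def by (intro continuous_intros cw cu)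
  have iX: "infnorm (X u t) \<le> \<rho> * w t" if "norm u \<le> \<rho>" "0 \<le> t" for u t
  proof -
    have "infnorm (X u t) = w t * infnorm (apply_bcontfun u t)" by (simp add: X_def infnorm_mul w0)
    also have "\<dots> \<le> w t * \<rho>"
      using order_trans[OF infnorm_le_norm order_trans[OF norm_bounded that(1)]] w0 by (intro mult_left_mono) auto
    finally show ?thesis by (simp add: mult.commute)
  qed
  have Xball: "X u t \<in> max_ball \<rho>" if "norm u \<le> \<rho>" "0 \<le> t" for u t
    using order_trans[OF iX[OF that] mult_left_mono[OF w1[OF that(2)], of \<rho>]] \<rho> by (simp add: max_ball_def)
  define h where "h u i s = f (X u s) $ i" for u :: "(real, real ^ 2) bcontfun" and i :: 2 and s
  have ch: "continuous_on {0..} (h u i)" if "norm u \<le> \<rho>" for u i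
    unfolding h_def
    by (intro continuous_on_component continuous_on_compose2[OF cf cX]) (use Xball[OF that] in auto)
  have zero_ball: "0 \<in> max_ball \<rho>" using \<rho> by (simp add: max_ball_def infnorm_0)
  have bh: "\<bar>h u i s\<bar> \<le> (l * \<rho>) * (1 + s) powr (- a)" if "norm u \<le> \<rho>" "0 \<le> s" for u i s
  proof -
    have "\<bar>h u i s\<bar> \<le> infnorm (f (X u s))" unfolding h_def by (rule infnorm_component)
    also have "\<dots> \<le> l * infnorm (X u s)" using lf[OF Xball[OF that] zero_ball] f0 by simp
    also have "\<dots> \<le> l * (\<rho> * w s)" using iX[OF that] l by (intro mult_left_mono) auto
    finally show ?thesis by (simp add: w_def)
  qed
  have bhd: "\<bar>h u i s - h v i s\<bar> \<le> (l * dist u v) * (1 + s) powr (- a)" if uv: "norm u \<le> \<rho>" "norm v \<le> \<rho>" "0 \<le> s" for u v i s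
  proof -
    have "\<bar>h u i s - h v i s\<bar> \<le> infnorm (f (X u s) - f (X v s))"
      using infnorm_component[of "f (X u s) - f (X v s)" i] by (simp add: h_def)
    also have "\<dots> \<le> l * infnorm (X u s - X v s)" by (intro lf Xball uv)
    also have "X u s - X v s = w s *\<^sub>R (apply_bcontfun u s - apply_bcontfun v s)"
      by (simp add: X_def scaleR_diff_right)
    also have "l * infnorm \<dots> \<le> l * (w s * dist u v)"
    proof (rule mult_left_mono)
      have "infnorm (apply_bcontfun u s - apply_bcontfun v s) \<le> dist (apply_bcontfun u s) (apply_bcontfun v s)"
        unfolding dist_norm by (rule infnorm_le_norm)
      also have "\<dots> \<le> dist u v" by (rule dist_bounded)
      finally show "infnorm (w s *\<^sub>R (apply_bcontfun u s - apply_bcontfun v s)) \<le> w s * dist u v"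
        using w0[of s] by (simp add: infnorm_mul mult_left_mono)
    qed (use l in auto)
    finally show ?thesis by (simp add: w_def mult_ac)
  qed
  have solution: "\<exists>\<phi>. continuous_on {0..} \<phi> \<and>
      (\<forall>t\<ge>0. infnorm (\<phi> t) \<le> \<rho> * (1 + t) powr (- \<alpha> $ 1)) \<and>
      (\<forall>t\<ge>0. \<forall>i. \<phi> t $ i = x0 $ i + RL_integral (\<alpha> $ i) (\<lambda>s. (A *v \<phi> s + f (\<phi> s)) $ i) t)"
    if x0: "infnorm x0 \<le> \<delta>" for x0 :: "real ^ 2"
  proof -
    define Y where "Y u t = (\<chi> i::2. if i = 1 then S1 (x0 $ 1) (x0 $ 2) (h u 1) (h u 2) t
       else S2 (x0 $ 1) (x0 $ 2) (h u 1) (h u 2) t)" for u and t :: real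
    \<comment> \<open>Undoes the weight and extends by the value at 0 to negative times, so that the
      image is again a bounded continuous function on the whole line.\<close>
    define F where "F u t = (1 + max 0 t) powr a *\<^sub>R Y u (max 0 t)" for u and t :: real
    have Y1: "Y u t $ 1 = S1 (x0 $ 1) (x0 $ 2) (h u 1) (h u 2) t"
      and Y2: "Y u t $ 2 = S2 (x0 $ 1) (x0 $ 2) (h u 1) (h u 2) t" for u t by (simp_all add: Y_def)
    have cY: "continuous_on {0..} (Y u)" if "norm u \<le> \<rho>" for u
      unfolding Y_def
    proof (rule continuous_on_vec_lambda)
      fix i :: 2
      show "continuous_on {0..} (\<lambda>t. if i = 1 then S1 (x0 $ 1) (x0 $ 2) (h u 1) (h u 2) t else S2 (x0 $ 1) (x0 $ 2) (h u 1) (h u 2) t)"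
        using cont[OF ch[OF that, of 1] ch[OF that, of 2]] by (cases "i = 1") simp_all
    qed
    have x012: "C * (\<bar>x0 $ 1\<bar> + \<bar>x0 $ 2\<bar> + l * \<rho>) \<le> 3 * \<rho> / 8"
    proof -
      have "\<bar>x0 $ 1\<bar> \<le> \<delta>" "\<bar>x0 $ 2\<bar> \<le> \<delta>" using x0 by (auto simp: infnorm_2)
      then have "C * (\<bar>x0 $ 1\<bar> + \<bar>x0 $ 2\<bar> + l * \<rho>) \<le> C * (\<delta> + \<delta> + l * \<rho>)" using C by (intro mult_left_mono) auto
      also have "\<dots> = 2 * (C * \<delta>) + (C * l) * \<rho>" by (simp add: algebra_simps)
      also have "\<dots> = 3 * \<rho> / 8" by (simp add: l \<delta>)
      finally show ?thesis .
    qed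
    have bY: "norm (Y u t) \<le> 3 * \<rho> / 4 * w t" if u: "norm u \<le> \<rho>" "0 \<le> t" for u t
    proof -
      note m = main[OF ch[OF u(1)] ch[OF u(1)] bh[OF u(1)] bh[OF u(1)] u(2), of "x0 $ 1" "x0 $ 2" 1 2]
      have "norm (Y u t) \<le> \<bar>Y u t $ 1\<bar> + \<bar>Y u t $ 2\<bar>" using norm_le_l1_cart[of "Y u t"] by (simp add: sum_2)
      moreover have "C * (\<bar>x0 $ 1\<bar> + \<bar>x0 $ 2\<bar> + l * \<rho>) * (1 + t) powr (- a) \<le> 3 * \<rho> / 8 * w t"
        unfolding w_def by (intro mult_right_mono x012) auto
      ultimately show ?thesis using m unfolding Y1 Y2 by linarith
    qed
    have dY: "norm (Y u t - Y v t) \<le> 1 / 2 * dist u v * w t" if uv: "norm u \<le> \<rho>" "norm v \<le> \<rho>" "0 \<le> t" for u v t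
    proof -
      have cd: "continuous_on {0..} (\<lambda>s. h u i s - h v i s)" for i by (intro continuous_intros ch uv)
      note m = main[OF cd cd bhd[OF uv(1,2)] bhd[OF uv(1,2)] uv(3), of 0 0 1 2]
      note dd = diff[OF ch[OF uv(1)] ch[OF uv(1)] ch[OF uv(2)] ch[OF uv(2)] uv(3), of "x0 $ 1" "x0 $ 2" 1 2 1 2]
      have "norm (Y u t - Y v t) \<le> \<bar>(Y u t - Y v t) $ 1\<bar> + \<bar>(Y u t - Y v t) $ 2\<bar>"
        using norm_le_l1_cart[of "Y u t - Y v t"] by (simp add: sum_2)
      moreover have "C * (\<bar>0\<bar> + \<bar>0\<bar> + l * dist u v) * (1 + t) powr (- a) = 1 / 4 * dist u v * w t"
        using l by (simp add: w_def mult.assoc[symmetric])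
      ultimately show ?thesis using m dd unfolding vector_minus_component Y1 Y2 by linarith
    qed
    have bF: "norm (F u t) \<le> 3 * \<rho> / 4" if u: "norm u \<le> \<rho>" for u t
    proof -
      have "norm (F u t) = (1 + max 0 t) powr a * norm (Y u (max 0 t))" by (simp add: F_def)
      also have "\<dots> \<le> (1 + max 0 t) powr a * (3 * \<rho> / 4 * w (max 0 t))" by (intro mult_left_mono bY u) auto
      also have "\<dots> = 3 * \<rho> / 4 * ((1 + max 0 t) powr a * w (max 0 t))" by (simp only: mult_ac)
      also have "\<dots> = 3 * \<rho> / 4" using wa[of "max 0 t"] by simp
      finally show ?thesis .
    qed
    have dF: "dist (F u t) (F v t) \<le> 1 / 2 * dist u v" if uv: "norm u \<le> \<rho>" "norm v \<le> \<rho>" for u v t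
    proof -
      have "dist (F u t) (F v t) = (1 + max 0 t) powr a * norm (Y u (max 0 t) - Y v (max 0 t))"
        by (simp add: F_def dist_norm scaleR_diff_right[symmetric])
      also have "\<dots> \<le> (1 + max 0 t) powr a * (1 / 2 * dist u v * w (max 0 t))" by (intro mult_left_mono dY uv) auto
      also have "\<dots> = 1 / 2 * dist u v * ((1 + max 0 t) powr a * w (max 0 t))" by (simp only: mult_ac)
      also have "\<dots> = 1 / 2 * dist u v" using wa[of "max 0 t"] by simp
      finally show ?thesis .
    qed
    have FB: "F u \<in> bcontfun" if "norm u \<le> \<rho>" for u
    proof (rule bcontfun_normI)
      show "continuous_on UNIV (F u)"
        unfolding F_def by (intro continuous_intros continuous_on_compose2[OF cY[OF that]]) auto
      show "norm (F u t) \<le> 3 * \<rho> / 4" for t by (rule bF[OF that])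
    qed
    define \<Theta> where "\<Theta> u = Bcontfun (F u)" for u
    have \<Theta>: "apply_bcontfun (\<Theta> u) = F u" if "norm u \<le> \<rho>" for u
      unfolding \<Theta>_def by (rule Bcontfun_inverse[OF FB[OF that]])
    have "\<exists>!u. u \<in> cball 0 \<rho> \<and> \<Theta> u = u"
    proof (rule Banach_fix[where c = "1 / 2"])
      show "complete (cball (0 :: (real, real ^ 2) bcontfun) \<rho>)" by (simp add: complete_eq_closed)
      show "cball (0 :: (real, real ^ 2) bcontfun) \<rho> \<noteq> {}" using \<rho> by simp
      show "\<Theta> ` cball 0 \<rho> \<subseteq> cball 0 \<rho>"
      proof safe
        fix u :: "(real, real ^ 2) bcontfun" assume "u \<in> cball 0 \<rho>"
        then have u: "norm u \<le> \<rho>" by simp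
        have "norm (\<Theta> u) \<le> 3 * \<rho> / 4"           by (rule norm_bound) (simp only: \<Theta>[OF u] bF[OF u])
        then show "\<Theta> u \<in> cball 0 \<rho>" using \<rho> by simp
      qed
      show "dist (\<Theta> u) (\<Theta> v) \<le> 1 / 2 * dist u v" if "u \<in> cball 0 \<rho>" "v \<in> cball 0 \<rho>" for u v
      proof (rule dist_bound)
        have uv: "norm u \<le> \<rho>" "norm v \<le> \<rho>" using that by auto
        show "dist (apply_bcontfun (\<Theta> u) t) (apply_bcontfun (\<Theta> v) t) \<le> 1 / 2 * dist u v" for t
          unfolding \<Theta>[OF uv(1)] \<Theta>[OF uv(2)] by (rule dF[OF uv])
      qed
    qed auto
    then obtain u where u: "norm u \<le> \<rho>" "\<Theta> u = u" by auto
    have XY: "X u t = Y u t" if "0 \<le> t" for t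
    proof -
      have "X u t = w t *\<^sub>R F u t" using \<Theta>[OF u(1)] u(2) by (simp add: X_def)
      also have "\<dots> = ((1 + t) powr a * w t) *\<^sub>R Y u t" using that by (simp add: F_def mult.commute)
      finally show ?thesis using wa[OF that] by simp
    qed
    have eq: "X u t $ i = x0 $ i + RL_integral (\<alpha> $ i) (\<lambda>s. (A *v X u s + f (X u s)) $ i) t" if t: "0 \<le> t" for t i
    proof -
      note m = main[OF ch[OF u(1)] ch[OF u(1)] bh[OF u(1)] bh[OF u(1)] t, of "x0 $ 1" "x0 $ 2" 1 2]
      let ?v = "\<lambda>i s. (A *v X u s + f (X u s)) $ i"
      have cv: "continuous_on {0..t} (?v i)" for i
        by (rule continuous_on_subset[of "{0..}"], intro continuous_intros continuous_on_component cX
              bounded_linear.continuous_on[OF matrix_vector_mul_bounded_linear] continuous_on_compose2[OF cf cX])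
          (use Xball[OF u(1)] in auto)
      have vi: "?v i s = A $ i $ 1 * Y u s $ 1 + A $ i $ 2 * Y u s $ 2 + h u i s" if "0 \<le> s" for i s
        by (simp add: XY[OF that, symmetric] h_def matrix_vector_mult_def sum_2)
      have conv_v: "conv K (\<lambda>s. A $ i $ 1 * Y u s $ 1 + A $ i $ 2 * Y u s $ 2 + h u i s) t = conv K (?v i) t" for K i
        by (rule conv_cong) (simp only: vi)
      have "X u t $ 1 = x0 $ 1 + conv (frac_kernel a) (?v 1) t" "X u t $ 2 = x0 $ 2 + conv (frac_kernel b) (?v 2) t"
        using m unfolding Y1[symmetric] Y2[symmetric] conv_v XY[OF t] by auto
      moreover have "RL_integral a (?v 1) t = conv (frac_kernel a) (?v 1) t" "RL_integral b (?v 2) t = conv (frac_kernel b) (?v 2) t"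
        using ab' by (intro RL_integral_eq_conv cv; simp)+
      ultimately show ?thesis using exhaust_2[of i] by (auto simp: a_def b_def)
    qed
    show ?thesis
      using cX[of u] iX[OF u(1)] eq unfolding w_def a_def by blast
  qed
  show ?thesis by (rule that[OF \<delta>(1) \<rho> solution])
qed

section \<open>Uniqueness among all solutions and the stability statement\<close>

lemma lip_modulus_bound:
  assumes lim: "(lip_modulus f \<longlongrightarrow> 0) (at_right 0)" and l: "0 < l"
  shows "\<exists>r>0. \<forall>x\<in>max_ball r. \<forall>y\<in>max_ball r. infnorm (f x - f y) \<le> l * infnorm (x - y)"
proof -
  have "eventually (\<lambda>r. lip_modulus f r < ereal l) (at_right 0)"
    by (rule order_tendstoD(2)[OF lim]) (use l in simp)
  then obtain b where b: "0 < b" "\<And>r. 0 < r \<Longrightarrow> r < b \<Longrightarrow> lip_modulus f r < ereal l"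
    unfolding eventually_at_right_field by auto
  have "infnorm (f x - f y) \<le> l * infnorm (x - y)" if "x \<in> max_ball (b / 2)" "y \<in> max_ball (b / 2)" for x y
  proof (cases "x = y")
    case False
    then have pos: "0 < infnorm (x - y)" by (simp add: infnorm_pos_lt)
    have "ereal (infnorm (f x - f y) / infnorm (x - y)) \<le> lip_modulus f (b / 2)"
      unfolding lip_modulus_def using that False by (intro SUP_upper2[of "(x, y)"]) auto
    also have "\<dots> < ereal l" using b by simp
    finally show ?thesis using pos by (simp add: field_simps)
  qed (simp add: infnorm_0)
  then show ?thesis using b(1) by (intro exI[of _ "b / 2"]) auto
qed

lemma infnorm_matrix_vector_mult:
  fixes A :: "real ^ 2 ^ 2"
  obtains L where "0 \<le> L" "\<And>x. infnorm (A *v x) \<le> L * infnorm x"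
proof
  let ?L = "\<bar>A $ 1 $ 1\<bar> + \<bar>A $ 1 $ 2\<bar> + \<bar>A $ 2 $ 1\<bar> + \<bar>A $ 2 $ 2\<bar>"
  show "0 \<le> ?L" by simp
  fix x :: "real ^ 2"
  have e: "(A *v x) $ i = A $ i $ 1 * x $ 1 + A $ i $ 2 * x $ 2" for i
    by (simp add: matrix_vector_mult_def sum_2)
  have m: "\<bar>A $ i $ j * x $ j\<bar> \<le> \<bar>A $ i $ j\<bar> * infnorm x" for i j
    unfolding abs_mult by (intro mult_left_mono infnorm_component) auto
  have p: "0 \<le> \<bar>A $ i $ j\<bar> * infnorm x" for i j by (simp add: infnorm_pos_le)
  have "\<bar>(A *v x) $ 1\<bar> \<le> ?L * infnorm x" "\<bar>(A *v x) $ 2\<bar> \<le> ?L * infnorm x"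
    unfolding e distrib_right
    using m[of 1 1] m[of 1 2] m[of 2 1] m[of 2 2] p[of 1 1] p[of 1 2] p[of 2 1] p[of 2 2] by linarith+
  then show "infnorm (A *v x) \<le> ?L * infnorm x" by (simp add: infnorm_2[of "A *v x"])
qed

text \<open>
  A second solution agrees with \<open>\<phi>\<close> as long as it stays in the ball on which \<open>f\<close> is Lipschitz
  continuous; as \<open>\<phi>\<close> stays in a smaller ball, it can never leave the larger one.
\<close>

lemma unique_global_solutionI:
  fixes A :: "real ^ 2 ^ 2" and \<alpha> :: "real ^ 2"
  assumes \<alpha>: "\<And>i. 0 < \<alpha> $ i \<and> \<alpha> $ i \<le> 1"
    and lip: "\<And>x y. x \<in> max_ball r \<Longrightarrow> y \<in> max_ball r \<Longrightarrow> infnorm (f x - f y) \<le> l * infnorm (x - y)" and l: "0 \<le> l"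
    and sub: "max_ball r \<subseteq> \<Omega>" and \<rho>: "\<rho> < r"
    and cont: "continuous_on {0..} \<phi>" and small: "\<And>t. 0 \<le> t \<Longrightarrow> infnorm (\<phi> t) \<le> \<rho>"
    and eq: "\<And>t i. 0 \<le> t \<Longrightarrow> \<phi> t $ i = x0 $ i + RL_integral (\<alpha> $ i) (\<lambda>s. (A *v \<phi> s + f (\<phi> s)) $ i) t"
  shows "unique_global_solution \<alpha> A \<Omega> f x0 \<phi>"
proof -
  have ball: "\<phi> t \<in> max_ball r" if "0 \<le> t" for t
    using small[OF that] \<rho> by (simp add: max_ball_def)
  have cf: "continuous_on (max_ball r) f" by (rule continuous_on_max_ball[OF lip l])
  have cv: "continuous_on S (\<lambda>s. A *v x s + f (x s))"
    if "continuous_on S x" "\<And>s. s \<in> S \<Longrightarrow> x s \<in> max_ball r" for S and x :: "real \<Rightarrow> real ^ 2"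
    using that
    by (intro continuous_intros bounded_linear.continuous_on[OF matrix_vector_mul_bounded_linear] continuous_on_compose2[OF cf]) auto
  have cvi: "continuous_on S (\<lambda>s. (A *v x s + f (x s)) $ i)"
    if "continuous_on S x" "\<And>s. s \<in> S \<Longrightarrow> x s \<in> max_ball r" for S i and x :: "real \<Rightarrow> real ^ 2"
    by (rule continuous_on_component[OF cv[OF that]])
  have \<phi>0: "\<phi> 0 = x0"
    using eq[of 0] by (simp add: vec_eq_iff RL_integral_def)
  obtain LA where LA: "0 \<le> LA" "\<And>x. infnorm (A *v x) \<le> LA * infnorm x"
    using infnorm_matrix_vector_mult by blast
  have local_unique: "y t = \<phi> t"
    if T: "0 < T'" and y: "continuous_on {0..T'} y" "y 0 = x0" "\<And>s. s \<in> {0..T'} \<Longrightarrow> y s \<in> max_ball r"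
      and D: "\<And>s. 0 < s \<Longrightarrow> s < T' \<Longrightarrow> has_caputo_derivative2 \<alpha> y (A *v y s + f (y s)) s"
      and t: "0 \<le> t" "t \<le> T'" for y T' t
  proof (rule fractional_volterra_unique[where \<alpha> = \<alpha> and T = T' and L = "LA + l"
        and vx = "\<lambda>s. A *v y s + f (y s)" and vy = "\<lambda>s. A *v \<phi> s + f (\<phi> s)"])
    show "continuous_on {0..T'} \<phi>" by (rule continuous_on_subset[OF cont]) auto
    then show "continuous_on {0..T'} (\<lambda>s. A *v \<phi> s + f (\<phi> s))" using ball by (intro cv) auto
    show "continuous_on {0..T'} (\<lambda>s. A *v y s + f (y s))" using y by (intro cv) auto
    show "y s $ i = x0 $ i + RL_integral (\<alpha> $ i) (\<lambda>s. (A *v y s + f (y s)) $ i) s" if s: "0 \<le> s" "s \<le> T'" for i s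
    proof -
      have "y s $ i = y 0 $ i + RL_integral (\<alpha> $ i) (\<lambda>s. (A *v y s + f (y s)) $ i) s"
      proof (rule RL_integral_of_has_caputo_derivative[where y = "\<lambda>s. y s $ i", OF _ _ T _ _ _ s])
        show "continuous_on {0..T'} (\<lambda>s. y s $ i)" by (intro continuous_on_component y)
        show "continuous_on {0..T'} (\<lambda>s. (A *v y s + f (y s)) $ i)" by (intro cvi y)
        show "has_caputo_derivative (\<alpha> $ i) (\<lambda>s. y s $ i) ((A *v y s + f (y s)) $ i) s" if "0 < s" "s < T'" for s
          using D[OF that] unfolding has_caputo_derivative2_def by blast
      qed (use \<alpha> in auto)
      then show ?thesis using y(2) by simp
    qed
    show "infnorm (A *v y s + f (y s) - (A *v \<phi> s + f (\<phi> s))) \<le> (LA + l) * infnorm (y s - \<phi> s)"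
      if s: "0 \<le> s" "s \<le> T'" for s
    proof -
      have "A *v y s + f (y s) - (A *v \<phi> s + f (\<phi> s)) = A *v (y s - \<phi> s) + (f (y s) - f (\<phi> s))"
        by (simp add: matrix_vector_mult_diff_distrib)
      then have "infnorm (A *v y s + f (y s) - (A *v \<phi> s + f (\<phi> s))) \<le> infnorm (A *v (y s - \<phi> s)) + infnorm (f (y s) - f (\<phi> s))"
        using infnorm_triangle by metis
      also have "\<dots> \<le> LA * infnorm (y s - \<phi> s) + l * infnorm (y s - \<phi> s)"
        using s ball y(3) by (intro add_mono LA lip) auto
      finally show ?thesis by (simp add: distrib_right)
    qed
    show "\<phi> s $ i = x0 $ i + RL_integral (\<alpha> $ i) (\<lambda>s. (A *v \<phi> s + f (\<phi> s)) $ i) s" if "0 \<le> s" for i s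
      by (rule eq[OF that])
  qed (use \<alpha> T y t in auto)
  have sol: "solution_on \<alpha> A \<Omega> f x0 \<infinity> \<phi>"
    unfolding solution_on_def
  proof (intro conjI allI impI)
    have "{t. 0 \<le> t \<and> ereal t < \<infinity>} = {0..}" by auto
    then show "continuous_on {t. 0 \<le> t \<and> ereal t < \<infinity>} \<phi>" using cont by simp
    show "\<phi> t \<in> \<Omega>" if "0 \<le> t \<and> ereal t < \<infinity>" for t using ball[of t] sub that by blast
    show "\<phi> 0 = x0" by (rule \<phi>0)
    show "has_caputo_derivative2 \<alpha> \<phi> (A *v \<phi> t + f (\<phi> t)) t" if "0 < t \<and> ereal t < \<infinity>" for t
      unfolding has_caputo_derivative2_def
    proof
      fix i
      show "has_caputo_derivative (\<alpha> $ i) (\<lambda>s. \<phi> s $ i) ((A *v \<phi> t + f (\<phi> t)) $ i) t"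
        by (rule has_caputo_derivative_of_RL_integral[where v = "\<lambda>s. (A *v \<phi> s + f (\<phi> s)) $ i"])
          (use \<alpha> that eq ball in \<open>auto intro!: cvi[simplified] cont\<close>)
    qed
  qed
  have "y t = \<phi> t" if y: "solution_on \<alpha> A \<Omega> f x0 T y" and t: "0 \<le> t" "ereal t < T" for T y t
  proof -
    have y0: "y 0 = x0" using y by (simp add: solution_on_def)
    have lt: "ereal s < T" if "s \<le> t" for s using that t(2) by (meson ereal_less_eq(3) le_less_trans)
    have cy: "continuous_on {0..s} y" if "s \<le> t" for s
    proof (rule continuous_on_subset)
      show "continuous_on {t. 0 \<le> t \<and> ereal t < T} y" using y by (simp add: solution_on_def)
      show "{0..s} \<subseteq> {t. 0 \<le> t \<and> ereal t < T}" using lt that by auto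
    qed
    have Dy: "has_caputo_derivative2 \<alpha> y (A *v y s + f (y s)) s" if "0 < s" "s \<le> t" for s
      using y lt that by (simp add: solution_on_def)
    have x0r: "infnorm x0 < r" using small[of 0] \<phi>0 \<rho> by simp
    have in_ball: "infnorm (y s) < r" if s: "0 \<le> s" "s \<le> t" for s
    proof (rule ccontr)
      assume "\<not> infnorm (y s) < r"
      \<comment> \<open>The least element \<open>\<tau>\<close> of this compact set is the first
        exit time. The intermediate value theorem and minimality give norm exactly \<open>r\<close>
        at \<open>\<tau>\<close>, so \<open>y\<close> stays in the closed ball up to and including
        \<open>\<tau>\<close>. There it equals \<open>\<phi>\<close>, whose norm is at most
        \<open>\<rho> < r\<close>.\<close>
      let ?E = "{0..t} \<inter> (\<lambda>s. infnorm (y s)) -` {r..}"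
      have ci: "continuous_on {0..t} (\<lambda>s. infnorm (y s))" by (intro continuous_on_infnorm cy) simp
      have "closed ?E" by (rule continuous_closed_preimage[OF ci]) auto
      then have "compact ({0..t} \<inter> ?E)" by (rule compact_Int_closed[OF compact_Icc])
      then have "compact ?E" by (simp add: Int_assoc[symmetric])
      moreover have "?E \<noteq> {}" using s \<open>\<not> infnorm (y s) < r\<close> by auto
      ultimately obtain \<tau> where \<tau>: "\<tau> \<in> ?E" "\<And>s. s \<in> ?E \<Longrightarrow> \<tau> \<le> s"
        using compact_attains_inf[of ?E] by blast
      have \<tau>t: "0 \<le> \<tau>" "\<tau> \<le> t" and \<tau>r: "r \<le> infnorm (y \<tau>)" using \<tau>(1) by auto
      have "\<tau> \<noteq> 0" using \<tau>r y0 x0r by auto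
      then have \<tau>0: "0 < \<tau>" using \<tau>t by simp
      have "continuous_on {0..\<tau>} (\<lambda>s. infnorm (y s))" by (intro continuous_on_infnorm cy \<tau>t)
      then obtain \<sigma> where \<sigma>: "0 \<le> \<sigma>" "\<sigma> \<le> \<tau>" "infnorm (y \<sigma>) = r"
        using IVT'[of "\<lambda>s. infnorm (y s)" 0 r \<tau>] y0 x0r \<tau>r \<tau>t by auto
      have "\<tau> \<le> \<sigma>" using \<sigma> \<tau>t by (intro \<tau>(2)) auto
      then have yr: "infnorm (y \<tau>) = r" using \<sigma> by simp
      have yball: "y s \<in> max_ball r" if "s \<in> {0..\<tau>}" for s
      proof (cases "s = \<tau>")
        case False
        then show ?thesis using that \<tau>(2)[of s] \<tau>t by (force simp: max_ball_def)
      qed (simp add: max_ball_def yr)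
      have "y \<tau> = \<phi> \<tau>"
        by (rule local_unique[OF \<tau>0 cy[OF \<tau>t(2)] y0 yball]) (use Dy \<tau>t in auto)
      then show False using small[OF \<tau>t(1)] yr \<rho> by simp
    qed
    show "y t = \<phi> t"
    proof (cases "t = 0")
      case False
      then have "0 < t" using t by simp
      then show ?thesis
        by (rule local_unique[OF _ cy[OF order_refl] y0]) (use Dy t in_ball in \<open>auto simp: max_ball_def less_imp_le\<close>)
    qed (simp add: y0 \<phi>0)
  qed
  then show ?thesis using sol unfolding unique_global_solution_def by blast
qed

theorem corollary5p5:
  fixes \<alpha>\<^sub>1 \<alpha>\<^sub>2 q\<^sub>1 q\<^sub>2 a\<^sub>1\<^sub>1 a\<^sub>2\<^sub>2 :: real
    and \<alpha> :: "real ^ 2"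
    and A :: "real ^ 2 ^ 2"
    and \<Omega> :: "(real ^ 2) set"
    and f :: "real ^ 2 \<Rightarrow> real ^ 2"
  assumes "0 < \<alpha>\<^sub>1" and "\<alpha>\<^sub>1 < \<alpha>\<^sub>2" and "\<alpha>\<^sub>2 \<le> 1"
    and "\<alpha> = vector [\<alpha>\<^sub>1, \<alpha>\<^sub>2]"
    and "a\<^sub>1\<^sub>1 = A $ 1 $ 1" and "a\<^sub>2\<^sub>2 = A $ 2 $ 2"
    and "q\<^sub>1 = sin (\<alpha>\<^sub>1 * pi / 2) / sin ((\<alpha>\<^sub>1 + \<alpha>\<^sub>2) * pi / 2)"
    and "q\<^sub>2 = sin (\<alpha>\<^sub>2 * pi / 2) / sin ((\<alpha>\<^sub>1 + \<alpha>\<^sub>2) * pi / 2)"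
    and "open \<Omega>" and "0 \<in> \<Omega>"
    and "locally_lipschitz_at_origin \<Omega> f"
    and "f 0 = 0"
    and "(lip_modulus f \<longlongrightarrow> 0) (at_right 0)"
    and "(a\<^sub>1\<^sub>1 \<le> 0 \<and> a\<^sub>2\<^sub>2 \<le> 0 \<and> det A > 0) \<or>
      (a\<^sub>1\<^sub>1 = 0 \<and> a\<^sub>2\<^sub>2 > 0 \<and> det A > 0 \<and>
        (a\<^sub>2\<^sub>2 * q\<^sub>1) powr (\<alpha>\<^sub>1 / \<alpha>\<^sub>2) * a\<^sub>2\<^sub>2 * q\<^sub>2 < det A) \<or>
      (a\<^sub>2\<^sub>2 = 0 \<and> a\<^sub>1\<^sub>1 > 0 \<and> det A > 0 \<and>
        (a\<^sub>1\<^sub>1 * q\<^sub>2) powr (\<alpha>\<^sub>2 / \<alpha>\<^sub>1) * a\<^sub>1\<^sub>1 * q\<^sub>1 < det A) \<or>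
      (a\<^sub>1\<^sub>1 > 0 \<and> a\<^sub>2\<^sub>2 > 0 \<and> det A > 0 \<and>
        ((a\<^sub>1\<^sub>1 * q\<^sub>2 + a\<^sub>2\<^sub>2 * q\<^sub>1 > 1 \<and>
          a\<^sub>1\<^sub>1 * q\<^sub>2 * ((a\<^sub>1\<^sub>1 + a\<^sub>2\<^sub>2) * q\<^sub>2) powr (\<alpha>\<^sub>2 / \<alpha>\<^sub>1)
            + a\<^sub>2\<^sub>2 * (a\<^sub>1\<^sub>1 + a\<^sub>2\<^sub>2) * q\<^sub>2 ^ 2 \<le> det A) \<or>
         (a\<^sub>1\<^sub>1 * q\<^sub>2 + a\<^sub>2\<^sub>2 * q\<^sub>1 \<le> 1 \<and> a\<^sub>1\<^sub>1 * q\<^sub>1 + a\<^sub>2\<^sub>2 * q\<^sub>2 < det A))) \<or>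
      (a\<^sub>1\<^sub>1 < 0 \<and> a\<^sub>2\<^sub>2 > 0 \<and> det A > 0 \<and>
        ((a\<^sub>1\<^sub>1 * q\<^sub>2 + a\<^sub>2\<^sub>2 * q\<^sub>1 > 1 \<and>
          (a\<^sub>2\<^sub>2 * q\<^sub>1) powr (\<alpha>\<^sub>1 / \<alpha>\<^sub>2) * a\<^sub>2\<^sub>2 * q\<^sub>2 \<le> det A) \<or>
         (a\<^sub>1\<^sub>1 * q\<^sub>2 + a\<^sub>2\<^sub>2 * q\<^sub>1 \<le> 1 \<and> a\<^sub>2\<^sub>2 * q\<^sub>2 \<le> det A)))"
  shows "mittag_leffler_stable \<alpha> A \<Omega> f \<and>
    (\<exists>\<delta>>0. \<exists>\<epsilon>>0. \<forall>x0. infnorm x0 < \<delta> \<longrightarrow>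
      (\<exists>\<phi>. unique_global_solution \<alpha> A \<Omega> f x0 \<phi> \<and>
        (SUP t\<in>{1..}. ereal (t powr min \<alpha>\<^sub>1 \<alpha>\<^sub>2 * infnorm (\<phi> t))) \<le> ereal \<epsilon>))"
proof -
  have \<alpha>12: "\<alpha> $ 1 = \<alpha>\<^sub>1" "\<alpha> $ 2 = \<alpha>\<^sub>2" using assms(4) by simp_all
  have \<alpha>: "0 < \<alpha> $ i \<and> \<alpha> $ i \<le> 1" for i
    using exhaust_2[of i] \<alpha>12 assms(1-3) by auto
  have cond: "stability_condition \<alpha>\<^sub>1 \<alpha>\<^sub>2 q\<^sub>1 q\<^sub>2 a\<^sub>1\<^sub>1 a\<^sub>2\<^sub>2 (det A)"
    using assms(14) unfolding stability_condition_def by blast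
  obtain \<epsilon>\<^sub>0 where \<epsilon>\<^sub>0: "0 < \<epsilon>\<^sub>0" "max_ball \<epsilon>\<^sub>0 \<subseteq> \<Omega>"
    using assms(11) by (auto simp: locally_lipschitz_at_origin_def)
  obtain r' where r': "0 < r'" "\<And>x y. x \<in> max_ball r' \<Longrightarrow> y \<in> max_ball r' \<Longrightarrow> infnorm (f x - f y) \<le> 1 * infnorm (x - y)"
    using lip_modulus_bound[OF assms(13), of 1] by auto
  define r where "r = min r' \<epsilon>\<^sub>0"
  have r: "0 < r" "max_ball r \<subseteq> \<Omega>"
    and lip: "\<And>x y. x \<in> max_ball r \<Longrightarrow> y \<in> max_ball r \<Longrightarrow> infnorm (f x - f y) \<le> 1 * infnorm (x - y)"
    using r' \<epsilon>\<^sub>0 by (auto simp: r_def max_ball_def)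
  \<comment> \<open>Half the radius keeps \<open>\<phi>\<close> strictly inside the ball on which
    \<open>f\<close> is Lipschitz continuous, as the exit time argument for uniqueness
    requires.\<close>
  have r2: "0 < r / 2" using r by simp
  obtain \<delta> \<rho> where \<delta>: "0 < \<delta>" and \<rho>: "0 < \<rho>" "\<rho> \<le> r / 2" and
    sol: "\<And>x0. infnorm x0 \<le> \<delta> \<Longrightarrow> \<exists>\<phi>. continuous_on {0..} \<phi> \<and>
      (\<forall>t\<ge>0. infnorm (\<phi> t) \<le> \<rho> * (1 + t) powr (- \<alpha> $ 1)) \<and>
      (\<forall>t\<ge>0. \<forall>i. \<phi> t $ i = x0 $ i + RL_integral (\<alpha> $ i) (\<lambda>s. (A *v \<phi> s + f (\<phi> s)) $ i) t)"
    by (rule fractional_system_small_solution[where \<alpha> = \<alpha> and A = A and f = f,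
          unfolded \<alpha>12, OF assms(1-3,7,8) cond[unfolded assms(5,6)] assms(12) lip_modulus_bound[OF assms(13)] r2])
      (auto simp: \<alpha>12)
  have main: "\<exists>\<phi>. unique_global_solution \<alpha> A \<Omega> f x0 \<phi> \<and>
      (SUP t\<in>{0..1}. ereal (infnorm (\<phi> t))) \<le> ereal \<rho> \<and>
      (SUP t\<in>{1..}. ereal (t powr \<alpha>\<^sub>1 * infnorm (\<phi> t))) \<le> ereal \<rho>"
    if x0: "infnorm x0 \<le> \<delta>" for x0
  proof -
    obtain \<phi> where \<phi>: "continuous_on {0..} \<phi>" "\<And>t. 0 \<le> t \<Longrightarrow> infnorm (\<phi> t) \<le> \<rho> * (1 + t) powr (- \<alpha>\<^sub>1)"
      "\<And>t i. 0 \<le> t \<Longrightarrow> \<phi> t $ i = x0 $ i + RL_integral (\<alpha> $ i) (\<lambda>s. (A *v \<phi> s + f (\<phi> s)) $ i) t"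
      using sol[OF x0] unfolding \<alpha>12 by blast
    have small: "infnorm (\<phi> t) \<le> \<rho>" if "0 \<le> t" for t
    proof -
      have "(1 + t) powr (- \<alpha>\<^sub>1) \<le> 1 powr (- \<alpha>\<^sub>1)" using that assms(1) by (intro powr_mono2') auto
      then have "\<rho> * (1 + t) powr (- \<alpha>\<^sub>1) \<le> \<rho> * 1" using \<rho> by (intro mult_left_mono) auto
      then show ?thesis using \<phi>(2)[OF that] by simp
    qed
    have dec: "t powr \<alpha>\<^sub>1 * infnorm (\<phi> t) \<le> \<rho>" if "1 \<le> t" for t
    proof -
      have "t powr \<alpha>\<^sub>1 * infnorm (\<phi> t) \<le> (1 + t) powr \<alpha>\<^sub>1 * (\<rho> * (1 + t) powr (- \<alpha>\<^sub>1))"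
        using that assms(1) by (intro mult_mono \<phi>(2) powr_mono2 infnorm_pos_le) auto
      also have "\<dots> = \<rho>" using that by (simp add: powr_minus)
      finally show ?thesis .
    qed
    have "unique_global_solution \<alpha> A \<Omega> f x0 \<phi>"
      by (rule unique_global_solutionI[OF \<alpha> lip _ r(2) _ \<phi>(1) small \<phi>(3)]) (use \<rho> r in auto)
    then show ?thesis
      by (intro exI[of _ \<phi>] conjI SUP_least) (auto intro: small dec)
  qed
  have "mittag_leffler_stable \<alpha> A \<Omega> f"
    unfolding mittag_leffler_stable_def
  proof (rule exI[of _ "\<alpha>\<^sub>1"], rule conjI[OF assms(1)], rule exI[of _ \<rho>], rule conjI[OF \<rho>(1)],
      rule exI[of _ \<delta>], rule conjI[OF \<delta>], rule ballI)
    fix x0 assume "x0 \<in> max_ball \<delta>"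
    then show "\<exists>\<phi>. unique_global_solution \<alpha> A \<Omega> f x0 \<phi> \<and>
        max (SUP t\<in>{0..1}. ereal (infnorm (\<phi> t))) (SUP t\<in>{1..}. ereal (t powr \<alpha>\<^sub>1 * infnorm (\<phi> t))) \<le> ereal \<rho>"
      using main[of x0] by (simp add: max_ball_def)
  qed
  moreover have "\<exists>\<delta>>0. \<exists>\<epsilon>>0. \<forall>x0. infnorm x0 < \<delta> \<longrightarrow>
      (\<exists>\<phi>. unique_global_solution \<alpha> A \<Omega> f x0 \<phi> \<and>
        (SUP t\<in>{1..}. ereal (t powr min \<alpha>\<^sub>1 \<alpha>\<^sub>2 * infnorm (\<phi> t))) \<le> ereal \<epsilon>)"
  proof (rule exI[of _ \<delta>], rule conjI[OF \<delta>], rule exI[of _ \<rho>], rule conjI[OF \<rho>(1)], intro allI impI)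
    fix x0 :: "real ^ 2" assume "infnorm x0 < \<delta>"
    moreover have "min \<alpha>\<^sub>1 \<alpha>\<^sub>2 = \<alpha>\<^sub>1" using assms(2) by simp
    ultimately show "\<exists>\<phi>. unique_global_solution \<alpha> A \<Omega> f x0 \<phi> \<and>
        (SUP t\<in>{1..}. ereal (t powr min \<alpha>\<^sub>1 \<alpha>\<^sub>2 * infnorm (\<phi> t))) \<le> ereal \<rho>"
      using main[of x0] by auto
  qed
  ultimately show ?thesis by blast
qed

end
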